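(* Let $m>n\geq 1$, let $\Lambda\subset\mathbb R^n$ be a Delone, Bohr almost periodic set of toral type, with associated toral compactification $(\mathbb T^m,\psi)$ of $\mathbb R^n$, $\psi=\rho_m\circ M$, where $M\in\mathbb R^{m\times n}$ satisfies $M^TM=I_n$. Let $K:=\overline{\psi(\Lambda)}\subset\mathbb T^m$, let $K_c$ be a connected component of $K$, let $H_c$ be a connected component of $\rho_m^{-1}(K_c)$, and let $\Lambda_c:=\psi^{-1}(K_c)$. Let $S:=\{k\in\mathbb Z^m: H_c+k=H_c\}$, let $S_1:=\{k\in\mathbb Z^m: ak\in S\text{ for some }a\in\mathbb N\}$, and let $S_2:=\{k\in\mathbb Z^m: k^Ts=0\text{ for all }s\in S\}$. Let $E\in\mathbb Z^{m\times n}$ satisfy $S_2=E\,\mathbb Z^n$. Then the density of $\Lambda_c$ equals $|S_1/S|\,|\det E^TM|$.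
   Context: Notation. $\mathbb T=\{z\in\mathbb C:|z|=1\}$, $\mathbb N=\{1,2,3,\dots\}$. $\rho_m:\mathbb R^m\to\mathbb T^m$ is $\rho_m([x_1,\dots,x_m]^T)=[e^{2\pi i x_1},\dots,e^{2\pi i x_m}]^T$. For $y\in\mathbb R^n$, $\chi_y(x)=e^{2\pi i y^Tx}$. $U(\mathbb R^n)$ (Bohr almost periodic functions) is the sup-norm closure of $\mathrm{span}\{\chi_y:y\in\mathbb R^n\}$ in the bounded continuous functions $\mathbb R^n\to\mathbb C$. $B(x,R)$ is the open ball and $V_n(R)$ is the volume of $B(0,R)\subset\mathbb R^n$. $|S_1/S|$ is the cardinality of the quotient group $S_1/S$, which is finite. The density of $A\subset\mathbb R^n$ is $\lim_{R\to\infty}\mathrm{card}(A\cap B(0,R))/V_n(R)$. The set $W_S:=\mathrm{span}_{\mathbb R}S$ is an $(m-n)$-dimensional subspace of $\mathbb R^m$, $\rho_m(W_S)$ is a closed connected subgroup of $\mathbb T^m$, and $S_2$ is its annihilator in $\mathbb Z^m$, i.e. the set of $k\in\mathbb Z^m$ such that $z_1^{k_1}\cdots z_m^{k_m}=1$ for all $z\in\rho_m(W_S)$. Delone: $\Lambda\subset\mathbb R^n$ is Delone if $R_1(\Lambda):=\inf\{\|\lambda_2-\lambda_1\|:\lambda_1\ne\lambda_2\in\Lambda\}>0$ and there is a finite $R$ with $\bigcup_{\lambda\in\Lambda}B(\lambda,R)=\mathbb R^n$. Bohr almost periodic: with $\mu:=\sum_{\lambda\in\Lambda}\delta_\lambda$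 and $(\mu*f)(x)=\sum_{\lambda\in\Lambda}f(x-\lambda)$, $\Lambda$ is Bohr almost periodic if $\mu*f\in U(\mathbb R^n)$ for every $f\in C_c(\mathbb R^n)$. Toral type: for such $\Lambda$ the spectrum $\Omega(\mu)$ is the set of $y\in\mathbb R^n$ for which $\widehat\mu(y):=\lim_{R\to\infty}V_n(R)^{-1}\sum_{\lambda\in\Lambda\cap B(0,R)}\chi_{-y}(\lambda)\neq 0$. $\Lambda$ is of toral type if $\Omega(\mu)$ generates a subgroup of $\mathbb R^n$ of finite rank $m$. Toral compactification: a pair $(\mathbb T^m,\psi)$ with $\psi:\mathbb R^n\to\mathbb T^m$ a continuous homomorphism with dense image; then $\psi=\rho_m\circ M$ for a matrix $M\in\mathbb R^{m\times n}$ whose rows are linearly independent over $\mathbb Q$. It is associated with $\Lambda$ if $\Omega(\mu)\subset M^T\mathbb Z^m$; equivalently (for Bohr almost periodic $\Lambda$), for each $f\in C_c(\mathbb R^n)$ there is a continuous $\Theta f:\mathbb T^m\to\mathbb C$ with $(\Theta f)\circ\psi=\mu*f$. *)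

theory Defs
  imports "HOL-Analysis.Analysis"
begin

definition int_vecs :: "(real^'k) set"
  where "int_vecs = {k. \<forall>i. k $ i \<in> \<int>}"

definition torus :: "(complex^'k) set"
  where "torus = {z. \<forall>i. norm (z $ i) = 1}"

definition rho :: "real^'k \<Rightarrow> complex^'k"
  where "rho x = (\<chi> i. cis (2 * pi * x $ i))"

definition character :: "real^'k \<Rightarrow> real^'k \<Rightarrow> complex"
  where "character y x = cis (2 * pi * (y \<bullet> x))"

text \<open>If \<open>L\<close> has at most one point, the infimum is that of the empty set, which is unspecified;
  this is harmless, since the covering condition then fails.\<close>

definition delone :: "(real^'k) set \<Rightarrow> bool"
  where "delone L \<longleftrightarrow>
    Inf {norm (l2 - l1) | l1 l2. l1 \<in> L \<and> l2 \<in> L \<and> l1 \<noteq> l2} > 0 \<and>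
    (\<exists>R. (\<Union>l\<in>L. ball l R) = UNIV)"

definition bohr_ap_functions :: "(real^'k \<Rightarrow> complex) set"
  where "bohr_ap_functions = apply_bcontfun `
    closure {p. \<exists>Y c. finite Y \<and> apply_bcontfun p = (\<lambda>x. \<Sum>y\<in>Y. c y * character y x)}"

text \<open>For locally finite \<open>L\<close> and compactly supported \<open>f\<close>, the sum has only finitely many
  nonzero terms.\<close>

definition conv_comb :: "(real^'k) set \<Rightarrow> (real^'k \<Rightarrow> complex) \<Rightarrow> real^'k \<Rightarrow> complex"
  where "conv_comb L f x = (\<Sum>\<^sub>\<infinity>l\<in>L. f (x - l))"

definition bohr_ap_set :: "(real^'k) set \<Rightarrow> bool"
  where "bohr_ap_set L \<longleftrightarrow>
    (\<forall>f. continuous_on UNIV f \<and> compact (closure {x. f x \<noteq> 0})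
      \<longrightarrow> conv_comb L f \<in> bohr_ap_functions)"

definition has_fourier_coeff :: "(real^'k) set \<Rightarrow> real^'k \<Rightarrow> complex \<Rightarrow> bool"
  where "has_fourier_coeff L y c \<longleftrightarrow>
    ((\<lambda>R. (\<Sum>l\<in>L \<inter> ball 0 R. character (- y) l) / of_real (measure lborel (ball (0 :: real^'k) R)))
      \<longlongrightarrow> c) at_top"

definition freq_set :: "(real^'k) set \<Rightarrow> (real^'k) set"
  where "freq_set L = {y. \<exists>c. c \<noteq> 0 \<and> has_fourier_coeff L y c}"

text \<open>A real vector space regarded as a \<open>\<int>\<close>-module; its submodules are the additive subgroups,
  and \<open>module.span\<close> is the subgroup generated by a set.\<close>

definition int_scale :: "int \<Rightarrow> 'v::real_vector \<Rightarrow> 'v"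
  where "int_scale k x = of_int k *\<^sub>R x"

lemma module_int_scale: "module int_scale"
  by unfold_locales (simp_all add: int_scale_def algebra_simps)

text \<open>The rank of a torsion-free abelian group: the cardinality of a maximal
  \<open>\<int>\<close>-linearly independent subset.\<close>

definition has_rank :: "'v::real_vector set \<Rightarrow> nat \<Rightarrow> bool"
  where "has_rank G r \<longleftrightarrow>
    (\<exists>B\<subseteq>G. finite B \<and> card B = r \<and> \<not> module.dependent int_scale B \<and>
      (\<forall>C\<subseteq>G. B \<subset> C \<longrightarrow> module.dependent int_scale C))"

definition toral_type :: "(real^'k) set \<Rightarrow> bool"
  where "toral_type L \<longleftrightarrow> (\<exists>r. has_rank (module.span int_scale (freq_set L)) r)"

text \<open>Multiplication on \<open>complex^'m\<close> is componentwise, hence is the group operation of the torus.\<close>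

definition toral_compactification :: "(real^'n \<Rightarrow> complex^'m) \<Rightarrow> bool"
  where "toral_compactification \<psi> \<longleftrightarrow>
    range \<psi> \<subseteq> torus \<and> continuous_on UNIV \<psi> \<and>
    (\<forall>x y. \<psi> (x + y) = \<psi> x * \<psi> y) \<and> closure (range \<psi>) = torus"

definition associated :: "real^'n^'m \<Rightarrow> (real^'n) set \<Rightarrow> bool"
  where "associated M L \<longleftrightarrow> freq_set L \<subseteq> (\<lambda>k. transpose M *v k) ` int_vecs"

definition has_density :: "(real^'k) set \<Rightarrow> real \<Rightarrow> bool"
  where "has_density A d \<longleftrightarrow>
    (\<forall>R. finite (A \<inter> ball 0 R)) \<and>
    ((\<lambda>R. real (card (A \<inter> ball 0 R)) / measure lborel (ball (0 :: real^'k) R)) \<longlongrightarrow> d) at_top"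

definition quotient_card :: "'v::ab_group_add set \<Rightarrow> 'v set \<Rightarrow> nat"
  where "quotient_card G H = card (G // {(a, b). a \<in> G \<and> b \<in> G \<and> b - a \<in> H})"

end

theory Submission
  imports Defs
begin

text \<open>Let \<open>H = rho -` K\<close> and let \<open>W\<close> be the orthogonal complement of the range of \<open>M\<close>. Since the
  spectrum of \<open>\<Lambda>\<close> lies in \<open>M\<^sup>T \<int>\<^sup>m\<close>, vectors \<open>t\<close> with \<open>M t\<close> close to \<open>\<int>\<^sup>m\<close> are almost periods of
  \<open>\<Lambda>\<close>, uniformly in the points. Hence the discrete sets in which \<open>H\<close> meets the translates of the
  range of \<open>M\<close> move uniformly continuously, which makes the orthogonal projection \<open>H \<rightarrow> W\<close> a covering. As
  \<open>W\<close> is simply connected, each component of \<open>H\<close> is the graph of a continuous function over \<open>W\<close>.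
  So \<open>H\<^sub>c + k\<close> contains exactly one point of the form \<open>M x\<close> for each coset \<open>k + S\<close>, and these \<open>x\<close> make up
  \<open>\<Lambda>\<^sub>c\<close>. The component is within bounded distance of \<open>span S = ker E\<^sup>T\<close>, so \<open>E\<^sup>T M x - E\<^sup>T k\<close> is
  bounded. Thus \<open>E\<^sup>T M\<close> maps \<open>\<Lambda>\<^sub>c\<close> to a bounded perturbation of \<open>E\<^sup>T \<int>\<^sup>m = \<int>\<^sup>n\<close>, in which every point is
  repeated \<open>\<bar>S\<^sub>1 / S\<bar>\<close> times, and the density follows by counting lattice points.\<close>

section \<open>Means over balls\<close>

text \<open>Bohr almost periodicity alone yields trigonometric polynomials with arbitrary
  frequencies, whereas almost periods that can be read off from \<open>M *v t\<close> require
  frequencies in M^T Z^m. Hence a Fejer-type approximation inside the spectrum is needed; the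
  spectrum of the convolution is compared with that of the point set by estimating boundary terms.
  The final count rests on three facts. \<open>transpose E ** M\<close> is invertible because
  nonzero elements of \<open>S\<close> cannot project close to 0, so \<open>span S\<close> meets the
  range of \<open>M\<close> only in 0; this invertibility also yields the boundedness. The transpose
  of \<open>E\<close> maps Z^m onto Z^n, rather than onto a proper sublattice, because every integer
  vector in the real range of \<open>E\<close> is an integral combination of its columns. And S_1 is
  the whole integral kernel of that map, by a pigeonhole argument on a finite fibre. It is not clear
  in advance that the integer translates of \<open>H\<^sub>c\<close> reach all of
  \<open>K\<^sub>c\<close>; the connectedness of \<open>K\<^sub>c\<close> settles this.\<close>

lemma character_add: "character (y + z) x = character y x * character z x"
  by (simp add: character_def inner_add_left distrib_left flip: cis_mult)

lemma character_add_right: "character y (x + t) = character y x * character y t"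
  by (simp add: character_def inner_add_right distrib_left flip: cis_mult)

lemma character_zero [simp]: "character 0 = (\<lambda>x. 1)"
  by (simp add: character_def fun_eq_iff)

lemma character_minus: "character (- y) x = cnj (character y x)"
  by (simp add: character_def cis_cnj)

lemma character_minus_right: "character y (- x) = character (- y) x"
  by (simp add: character_def)

lemma norm_character [simp]: "norm (character y x) = 1"
  by (simp add: character_def)

lemma continuous_on_character [continuous_intros]:
  "continuous_on A f \<Longrightarrow> continuous_on A (\<lambda>x. character y (f x))"
  unfolding character_def by (intro continuous_intros)

lemma measure_lborel_ball:
  "R \<ge> 0 \<Longrightarrow> measure lborel (ball (a :: real^'n) R) = unit_ball_vol (real CARD('n)) * R ^ CARD('n)"
  by (simp add: content_ball)

lemma measure_lborel_ball_pos: "R > 0 \<Longrightarrow> measure lborel (ball (a :: real^'n) R) > 0"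
  by (simp add: content_ball)

text \<open>Boundary errors below are carried by shells of fixed width near the sphere of radius
  \<open>R\<close>; this limit makes them negligible relative to the ball.\<close>

lemma measure_ball_ratio_tendsto:
  "((\<lambda>R. measure lborel (ball (0 :: real^'n) (R + c)) / measure lborel (ball (0 :: real^'n) R)) \<longlongrightarrow> 1) at_top"
proof -
  have "((\<lambda>R::real. 1 + c / R) \<longlongrightarrow> 1 + 0) at_top"
    by (intro tendsto_intros tendsto_divide_0[OF tendsto_const] filterlim_at_top_imp_at_infinity filterlim_ident)
  then have "((\<lambda>R::real. (1 + c / R) ^ CARD('n)) \<longlongrightarrow> 1) at_top"
    using tendsto_power by fastforce
  moreover have "\<forall>\<^sub>F R in at_top. (1 + c / R) ^ CARD('n)
      = measure lborel (ball (0 :: real^'n) (R + c)) / measure lborel (ball (0 :: real^'n) R)"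
    using eventually_gt_at_top[of "\<bar>c\<bar>"]
  proof eventually_elim
    case (elim R)
    moreover have "1 + c / R = (R + c) / R"
      using elim by (simp add: field_simps)
    moreover have "unit_ball_vol (real CARD('n)) > 0" by simp
    ultimately show ?case
      using elim by (simp add: content_ball power_divide less_imp_neq[symmetric] del: unit_ball_vol_pos)
  qed
  ultimately show ?thesis by (rule Lim_transform_eventually)
qed

lemma measure_ball_diff_ratio_tendsto:
  "((\<lambda>R. (measure lborel (ball (0 :: real^'n) (R + c)) - measure lborel (ball (0 :: real^'n) (R + d)))
      / measure lborel (ball (0 :: real^'n) R)) \<longlongrightarrow> 0) at_top"
  using tendsto_diff[OF measure_ball_ratio_tendsto[where 'n='n, of c] measure_ball_ratio_tendsto[where 'n='n, of d]]
  by (simp add: diff_divide_distrib)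

lemma set_integrable_ball_continuous:
  fixes g :: "real^'n \<Rightarrow> 'b::{banach, second_countable_topology}"
  assumes "continuous_on UNIV g"
  shows "set_integrable lborel (ball a R) g"
proof -
  have "set_integrable lborel (cball a R) g"
    unfolding set_integrable_def
    by (rule borel_integrable_compact) (use assms continuous_on_subset in auto)
  then show ?thesis by (rule set_integrable_subset) auto
qed

definition ball_mean :: "(real^'n \<Rightarrow> complex) \<Rightarrow> real \<Rightarrow> complex"
  where "ball_mean g R = (LINT x:ball 0 R|lborel. g x) / of_real (measure lborel (ball (0 :: real^'n) R))"

lemma ball_mean_cmult: "ball_mean (\<lambda>x. c * g x) R = c * ball_mean g R"
  by (simp add: ball_mean_def)

lemma ball_mean_diff:
  assumes "continuous_on UNIV g" "continuous_on UNIV h"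
  shows "ball_mean (\<lambda>x. g x - h x) R = ball_mean g R - ball_mean h R"
  unfolding ball_mean_def
  by (simp add: set_integral_diff set_integrable_ball_continuous assms diff_divide_distrib)

lemma ball_mean_sum:
  assumes "\<And>i. i \<in> I \<Longrightarrow> continuous_on UNIV (g i)"
  shows "ball_mean (\<lambda>x. \<Sum>i\<in>I. g i x) R = (\<Sum>i\<in>I. ball_mean (g i) R)"
proof -
  have "(LINT x:ball 0 R|lborel. \<Sum>i\<in>I. g i x) = (\<Sum>i\<in>I. LINT x:ball 0 R|lborel. g i x)"
    using set_integrable_ball_continuous[OF assms]
    unfolding set_lebesgue_integral_def set_integrable_def
    by (simp add: scaleR_sum_right Bochner_Integration.integral_sum)
  then show ?thesis by (simp add: ball_mean_def sum_divide_distrib)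
qed

lemma norm_ball_mean_le:
  assumes "continuous_on UNIV h" "continuous_on UNIV k" "\<And>t. norm (h t) \<le> k t"
  shows "norm (ball_mean h R) \<le> Re (ball_mean (\<lambda>t. of_real (k t)) R)"
proof -
  have ih: "set_integrable lborel (ball 0 R) h" and ik: "set_integrable lborel (ball 0 R) k"
    by (auto intro: set_integrable_ball_continuous assms)
  have inh: "set_integrable lborel (ball 0 R) (\<lambda>t. norm (h t))"
    by (intro set_integrable_ball_continuous continuous_intros assms)
  have "norm (LINT x:ball 0 R|lborel. h x) \<le> (LINT x:ball 0 R|lborel. norm (h x))"
    by (rule set_integral_norm_bound[OF ih])
  also have "\<dots> \<le> (LINT x:ball 0 R|lborel. k x)"
    by (rule set_integral_mono[OF inh ik]) (rule assms)
  finally have "norm (LINT x:ball 0 R|lborel. h x) \<le> (LINT x:ball 0 R|lborel. k x)" .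
  moreover have "(LINT x:ball 0 R|lborel. complex_of_real (k x)) = of_real (LINT x:ball 0 R|lborel. k x)"
    by (rule set_integral_complex_of_real)
  ultimately show ?thesis
    by (simp add: ball_mean_def norm_divide divide_right_mono flip: of_real_divide)
qed

lemma ball_mean_const: "R > 0 \<Longrightarrow> ball_mean (\<lambda>x :: real^'n. c) R = c"
proof -
  assume "R > 0"
  then have "measure lborel (ball (0::real^'n) R) \<noteq> 0"
    using measure_lborel_ball_pos[of R 0] by simp
  moreover have "(LINT x:ball (0::real^'n) R|lborel. c) = measure lborel (ball (0::real^'n) R) *\<^sub>R c"
    using less_imp_neq[OF emeasure_lborel_ball_finite[of 0 R]] by (intro set_integral_const) auto
  ultimately show ?thesis by (simp add: ball_mean_def scaleR_conv_of_real)
qed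

lemma norm_ball_mean_le_const:
  assumes "continuous_on UNIV h" "\<And>t. norm (h t) \<le> B" "R > 0"
  shows "norm (ball_mean h R) \<le> B"
  using norm_ball_mean_le[OF assms(1) _ assms(2), of R] assms(3) by (simp add: ball_mean_const)

lemma set_integral_le_measure:
  fixes h :: "real^'n \<Rightarrow> complex"
  assumes "A \<in> sets lborel" "emeasure lborel A < \<infinity>" "set_integrable lborel A h" "\<And>x. norm (h x) \<le> 1"
  shows "norm (LINT x:A|lborel. h x) \<le> measure lborel A"
proof -
  have "norm (LINT x:A|lborel. h x) \<le> (LINT x:A|lborel. norm (h x))"
    by (rule set_integral_norm_bound) fact
  also have "\<dots> \<le> (LINT x:A|lborel. 1::real)"
  proof (rule set_integral_mono)
    show "set_integrable lborel A (\<lambda>x. norm (h x))" using assms by (intro set_integrable_norm)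
    show "set_integrable lborel A (\<lambda>x. 1::real)" using assms by (simp add: set_integrable_def)
  qed (rule assms)
  also have "\<dots> = measure lborel A"
    using assms by (simp add: set_integral_const)
  finally show ?thesis .
qed

text \<open>Translating by \<open>t\<close> with \<open>character y t = -1\<close> flips the sign of the integral, and changes it
  only by a boundary term.\<close>

lemma ball_mean_character_tendsto:
  "(ball_mean (character (y :: real^'n)) \<longlongrightarrow> of_bool (y = 0)) at_top"
proof (cases "y = 0")
  case True
  have "\<forall>\<^sub>F R in at_top. 1 = ball_mean (character y) R"
    using eventually_gt_at_top[of 0]
    by eventually_elim (simp add: True ball_mean_const)
  then show ?thesis
    using True by (simp add: tendsto_eventually eventually_mono)
next
  case False
  \<comment> \<open>The factor makes \<open>y \<bullet> t\<close> equal to 1/2, half a period of the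
    character.\<close>
  define t where "t = (1 / (2 * (y \<bullet> y))) *\<^sub>R y"
  have t: "character y t = -1"
    using False by (simp add: character_def t_def cis.ctr complex_eq_iff)
  have bound: "norm (ball_mean (character y) R)
      \<le> (measure lborel (ball (0::real^'n) (R + 0)) - measure lborel (ball (0::real^'n) (R + (- norm t)))) / measure lborel (ball (0::real^'n) R)"
    if R: "R > norm t" for R
  proof -
    \<comment> \<open>\<open>?S\<close> lies in both \<open>?B\<close> and its translate
      \<open>?T\<close>, so the integrals over it cancel; each remainder has the measure of a shell
      of width \<open>norm t\<close>.\<close>
    let ?c = "character y" and ?B = "ball (0::real^'n) R" and ?T = "ball t R" and ?S = "ball (0::real^'n) (R - norm t)"
    have sub: "?S \<subseteq> ?B" "?S \<subseteq> ?T"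
    proof -
      show "?S \<subseteq> ?B" by (intro subset_ball) simp
      show "?S \<subseteq> ?T"
      proof
        fix x assume "x \<in> ?S"
        then show "x \<in> ?T" using norm_triangle_ineq4[of t x] by (simp add: dist_norm)
      qed
    qed
    have ci: "set_integrable lborel (ball a r) ?c" for a r
      by (intro set_integrable_ball_continuous continuous_intros)
    have meas: "?c \<in> borel_measurable borel"
      using continuous_on_character[OF continuous_on_id] by (rule borel_measurable_continuous_onI)
    have "(LINT x:?T|lborel. ?c x) = (LINT x|distr lborel borel ((+) t). indicator ?T x *\<^sub>R ?c x)"
      by (simp add: lborel_distr_plus set_lebesgue_integral_def)
    also have "\<dots> = (LINT x|lborel. indicator ?T (t + x) *\<^sub>R ?c (t + x))"
      by (rule integral_distr) (intro borel_measurable_scaleR borel_measurable_indicator meas | simp)+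
    also have "\<dots> = (LINT x|lborel. - (indicator ?B x *\<^sub>R ?c x))"
      by (intro Bochner_Integration.integral_cong)
         (auto simp: indicator_def dist_norm character_add_right t)
    also have "\<dots> = - (LINT x:?B|lborel. ?c x)"
      by (simp add: set_lebesgue_integral_def)
    finally have T: "(LINT x:?T|lborel. ?c x) = - (LINT x:?B|lborel. ?c x)" .
    have split: "(LINT x:U|lborel. ?c x) = (LINT x:?S|lborel. ?c x) + (LINT x:U - ?S|lborel. ?c x)"
      and small: "norm (LINT x:U - ?S|lborel. ?c x) \<le> measure lborel ?B - measure lborel ?S"
      if U: "U = ball a R" "?S \<subseteq> U" for U a
    proof -
      have m: "?S \<in> sets lborel" "U - ?S \<in> sets lborel" using U by auto
      have i: "set_integrable lborel U ?c" using ci U by simp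
      have iD: "set_integrable lborel (U - ?S) ?c"
        by (rule set_integrable_subset[OF i m(2)]) auto
      show "(LINT x:U|lborel. ?c x) = (LINT x:?S|lborel. ?c x) + (LINT x:U - ?S|lborel. ?c x)"
        using set_integral_Un[of ?S "U - ?S" lborel ?c] ci iD U
        by (simp add: Un_absorb1 Int_Diff)
      have fin: "emeasure lborel U < \<infinity>" using emeasure_lborel_ball_finite[of a R] U by simp
      have "norm (LINT x:U - ?S|lborel. ?c x) \<le> measure lborel (U - ?S)"
      proof (rule set_integral_le_measure[OF m(2) _ iD])
        show "emeasure lborel (U - ?S) < \<infinity>"
          using fin by (rule le_less_trans[rotated]) (intro emeasure_mono; use U in auto)
      qed simp
      also have "\<dots> = measure lborel U - measure lborel ?S"
        using fin U by (intro measure_Diff) auto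
      also have "measure lborel U = measure lborel ?B"
        using R U norm_ge_zero[of t] by (simp only: measure_lborel_ball order.strict_implies_order[OF le_less_trans])
      finally show "norm (LINT x:U - ?S|lborel. ?c x) \<le> measure lborel ?B - measure lborel ?S" .
    qed
    have "2 * (LINT x:?B|lborel. ?c x) = (LINT x:?B|lborel. ?c x) - (LINT x:?T|lborel. ?c x)"
      by (simp add: T)
    also have "\<dots> = (LINT x:?B - ?S|lborel. ?c x) - (LINT x:?T - ?S|lborel. ?c x)"
      using split[OF refl sub(1)] split[OF refl sub(2)] by simp
    finally have eq: "2 * (LINT x:?B|lborel. ?c x)
        = (LINT x:?B - ?S|lborel. ?c x) - (LINT x:?T - ?S|lborel. ?c x)" .
    have "2 * norm (LINT x:?B|lborel. ?c x)
        = norm ((LINT x:?B - ?S|lborel. ?c x) - (LINT x:?T - ?S|lborel. ?c x))"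
      unfolding eq[symmetric] norm_mult by (simp only: norm_numeral)
    also have "\<dots> \<le> 2 * (measure lborel ?B - measure lborel ?S)"
      unfolding mult_2
      by (rule order_trans[OF norm_triangle_ineq4]) (intro add_mono small[OF refl] sub)
    finally have "norm (LINT x:?B|lborel. ?c x) \<le> measure lborel ?B - measure lborel ?S"
      by (simp only: mult_le_cancel_left_pos zero_less_numeral)
    then show ?thesis
      using R by (simp add: ball_mean_def norm_divide divide_right_mono)
  qed
  have "(ball_mean (character y) \<longlongrightarrow> 0) at_top"
    by (rule Lim_null_comparison[OF _ measure_ball_diff_ratio_tendsto[where 'n='n, of 0 "- norm t"]])
       (use eventually_gt_at_top[of "norm t"] in eventually_elim, use bound in blast)
  then show ?thesis using False by simp
qed

section \<open>Approximation by frequencies in the spectrum\<close>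

text \<open>The sets of combinations with coefficients below \<open>N\<close> grow polynomially in \<open>N\<close>, hence by a
  factor close to 1 for some \<open>N\<close>.\<close>

lemma exists_almost_invariant_finite_set:
  fixes Y :: "'v::real_vector set"
  assumes "finite Y" "\<delta> > 0"
  obtains F where "finite F" "F \<noteq> {}"
    "\<And>y. y \<in> Y \<Longrightarrow> real (card (F \<inter> (\<lambda>v. v + y) ` F)) \<ge> (1 - \<delta>) * real (card F)"
proof -
  define G where "G N = (\<lambda>j. \<Sum>y\<in>Y. real (j y) *\<^sub>R y) ` (Y \<rightarrow>\<^sub>E {..<N})" for N :: nat
  have finG: "finite (G N)" for N
    unfolding G_def using assms by (intro finite_imageI finite_PiE) auto
  have zero: "0 \<in> G (Suc N)" for N
    unfolding G_def
    by (rule image_eqI[of _ _ "\<lambda>y\<in>Y. 0"]) auto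
  have cardG: "card (G N) \<le> N ^ card Y" for N
  proof -
    have "card (G N) \<le> card (Y \<rightarrow>\<^sub>E {..<N})"
      unfolding G_def using assms by (intro card_image_le finite_PiE) auto
    then show ?thesis using assms by (simp add: card_PiE)
  qed
  have mono: "G N \<subseteq> G (Suc N)" for N
    unfolding G_def by (intro image_mono PiE_mono) auto
  have shift: "(\<lambda>v. v + y) ` G N \<subseteq> G (Suc N)" if y: "y \<in> Y" for y N
  proof clarify
    fix v assume "v \<in> G N"
    then obtain j where j: "j \<in> Y \<rightarrow>\<^sub>E {..<N}" "v = (\<Sum>y\<in>Y. real (j y) *\<^sub>R y)"
      unfolding G_def by auto
    have "(\<Sum>z\<in>Y. real ((j(y := Suc (j y))) z) *\<^sub>R z)
        = (\<Sum>z\<in>Y. real (j z) *\<^sub>R z + (if z = y then y else 0))"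
      by (intro sum.cong) (auto simp: algebra_simps)
    also have "\<dots> = v + y"
      using assms y by (simp add: sum.distrib j)
    finally show "v + y \<in> G (Suc N)"
      unfolding G_def using j(1) y
      by (intro image_eqI[of _ _ "j(y := Suc (j y))"]) (auto simp: PiE_iff extensional_def less_Suc_eq)
  qed
  \<comment> \<open>Otherwise the cardinality grows at least like \<open>(1 + \<delta>) ^ N\<close>,
    against the polynomial bound \<open>cardG\<close>. The indices start at \<open>Suc\<close>
    because \<open>G 0\<close> is empty unless \<open>Y\<close> is.\<close>
  have "\<exists>N. real (card (G (Suc (Suc N)))) \<le> (1 + \<delta>) * real (card (G (Suc N)))"
  proof (rule ccontr)
    assume "\<not> ?thesis"
    then have *: "real (card (G (Suc (Suc N)))) > (1 + \<delta>) * real (card (G (Suc N)))" for N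
      by (meson not_le)
    have lower: "real (card (G (Suc N))) \<ge> (1 + \<delta>) ^ N" for N
    proof (induction N)
      case 0
      have "card (G (Suc 0)) > 0" using zero[of 0] finG by (auto simp: card_gt_0_iff)
      then show ?case by simp
    next
      case (Suc N)
      have "(1 + \<delta>) ^ Suc N \<le> (1 + \<delta>) * real (card (G (Suc N)))"
        using Suc assms by simp
      with *[of N] show ?case by linarith
    qed
    define a where "a = ln (1 + \<delta>)"
    have a: "a > 0" using assms by (simp add: a_def)
    have "((\<lambda>N. (a * real N) ^ card Y / exp (a * real N)) \<longlonglongrightarrow> 0)"
      by (rule filterlim_compose[OF tendsto_power_div_exp_0])
         (intro filterlim_tendsto_pos_mult_at_top[OF tendsto_const a] filterlim_real_sequentially)
    then have "((\<lambda>N. (a * real (Suc N)) ^ card Y / exp (a * real (Suc N))) \<longlonglongrightarrow> 0)"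
      by (rule LIMSEQ_Suc)
    then have "\<forall>\<^sub>F N in sequentially. (a * real (Suc N)) ^ card Y / exp (a * real (Suc N)) < a ^ card Y / (1 + \<delta>)"
      using a assms by (intro order_tendstoD(2)) auto
    then obtain N where N: "(a * real (Suc N)) ^ card Y / exp (a * real (Suc N)) < a ^ card Y / (1 + \<delta>)"
      by (auto simp: eventually_sequentially)
    have "exp (a * real (Suc N)) = exp a ^ Suc N"
      by (metis exp_of_nat2_mult)
    also have "\<dots> = (1 + \<delta>) ^ Suc N"
      using assms by (simp add: a_def)
    finally have e: "exp (a * real (Suc N)) = (1 + \<delta>) ^ Suc N" .
    have "a ^ card Y * (real (Suc N) ^ card Y / (1 + \<delta>) ^ Suc N) < a ^ card Y * (1 / (1 + \<delta>))"
      using N unfolding e power_mult_distrib by simp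
    then have "real (Suc N) ^ card Y / (1 + \<delta>) ^ Suc N < 1 / (1 + \<delta>)"
      by (simp only: mult_less_cancel_left_pos a zero_less_power)
    then have "real (Suc N) ^ card Y < 1 / (1 + \<delta>) * (1 + \<delta>) ^ Suc N"
      using assms by (subst (asm) pos_divide_less_eq) auto
    also have "\<dots> = (1 + \<delta>) ^ N"
      using assms by simp
    finally have "real (Suc N) ^ card Y < (1 + \<delta>) ^ N" .
    moreover have "real (card (G (Suc N))) \<le> real (Suc N) ^ card Y"
      using cardG[of "Suc N"] by (metis of_nat_le_iff of_nat_power)
    ultimately show False using lower[of N] by linarith
  qed
  then obtain N where N: "real (card (G (Suc (Suc N)))) \<le> (1 + \<delta>) * real (card (G (Suc N)))" by blast
  show thesis
  proof (rule that)
    show "finite (G (Suc N))" "G (Suc N) \<noteq> {}" using finG zero by auto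
    fix y assume y: "y \<in> Y"
    let ?A = "G (Suc N)" and ?B = "(\<lambda>v. v + y) ` G (Suc N)"
    have "card ?B = card ?A" by (rule card_image) (auto simp: inj_on_def)
    \<comment> \<open>\<open>?A\<close> and \<open>?B\<close> have equal size and their union lies
      in the next set; a union hardly larger than \<open>?A\<close> forces a large
      intersection.\<close>
    then have "2 * card ?A = card (?A \<union> ?B) + card (?A \<inter> ?B)"
      using card_Un_Int[of ?A ?B] finG by simp
    moreover have "card (?A \<union> ?B) \<le> card (G (Suc (Suc N)))"
      using mono shift[OF y] finG by (intro card_mono) auto
    ultimately have "2 * real (card ?A) \<le> real (card (G (Suc (Suc N)))) + real (card (?A \<inter> ?B))"
      by linarith
    with N show "real (card (?A \<inter> ?B)) \<ge> (1 - \<delta>) * real (card ?A)"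
      by (simp add: algebra_simps)
  qed
qed

lemma bohr_ap_functions_approx:
  assumes "g \<in> bohr_ap_functions" "\<epsilon> > 0"
  obtains Y c where "finite Y" "\<And>x. norm (g x - (\<Sum>y\<in>Y. c y * character y x)) < \<epsilon>"
proof -
  obtain G where G: "g = apply_bcontfun G"
    "G \<in> closure {p. \<exists>Y c. finite Y \<and> apply_bcontfun p = (\<lambda>x. \<Sum>y\<in>Y. c y * character y x)}"
    using assms unfolding bohr_ap_functions_def by blast
  then obtain p Y c where p: "dist p G < \<epsilon>" "finite Y" "apply_bcontfun p = (\<lambda>x. \<Sum>y\<in>Y. c y * character y x)"
    unfolding closure_approachable using assms by blast
  have "norm (g x - (\<Sum>y\<in>Y. c y * character y x)) < \<epsilon>" for x
  proof -
    have "norm (g x - (\<Sum>y\<in>Y. c y * character y x)) = dist (apply_bcontfun p x) (apply_bcontfun G x)"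
      by (simp add: G p dist_norm norm_minus_commute)
    also have "\<dots> \<le> dist p G" by (rule dist_bounded)
    finally show ?thesis using p by simp
  qed
  with p that show thesis by blast
qed

lemma bohr_ap_functions_continuous:
  "g \<in> bohr_ap_functions \<Longrightarrow> continuous_on UNIV g"
  unfolding bohr_ap_functions_def using apply_bcontfun bcontfun_def by blast

lemma ball_mean_trig_poly_tendsto:
  assumes "finite Y"
  shows "(ball_mean (\<lambda>x. (\<Sum>y\<in>Y. c y * character y x) * character (- z) x)
    \<longlongrightarrow> (\<Sum>y\<in>Y. c y * of_bool (y = z))) at_top"
proof -
  have "((\<lambda>R. \<Sum>y\<in>Y. c y * ball_mean (character (y - z)) R) \<longlongrightarrow> (\<Sum>y\<in>Y. c y * of_bool (y - z = 0))) at_top"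
    by (intro tendsto_intros ball_mean_character_tendsto)
  moreover have "(\<Sum>y\<in>Y. c y * ball_mean (character (y - z)) R)
      = ball_mean (\<lambda>x. (\<Sum>y\<in>Y. c y * character y x) * character (- z) x) R" for R
  proof -
    have "(\<lambda>x. (\<Sum>y\<in>Y. c y * character y x) * character (- z) x)
        = (\<lambda>x. \<Sum>y\<in>Y. c y * character (y - z) x)"
      using character_add[of _ "- z"] by (simp add: sum_distrib_right mult.assoc)
    then show ?thesis
      by (simp add: ball_mean_sum continuous_intros ball_mean_cmult)
  qed
  ultimately show ?thesis by simp
qed

text \<open>The means of the approximating polynomials converge, and they approximate the means of
  \<open>g\<close> uniformly in \<open>R\<close>, so the two limits can be interchanged.\<close>

lemma bohr_ap_mean_exists:
  assumes g: "g \<in> bohr_ap_functions"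
  obtains a where "(ball_mean (\<lambda>x. g x * character (- z) x) \<longlongrightarrow> a) at_top"
proof -
  have "\<exists>Y c. finite Y \<and> (\<forall>x. norm (g x - (\<Sum>y\<in>Y. c y * character y x)) < 1 / real (Suc n))" for n
    by (rule bohr_ap_functions_approx[OF g, of "1 / real (Suc n)"]) (simp, blast)
  then obtain Y c where Y: "\<And>n. finite (Y n)"
    and c: "\<And>n x. norm (g x - (\<Sum>y\<in>Y n. c n y * character y x)) < 1 / real (Suc n)"
    by metis
  define p where "p n x = (\<Sum>y\<in>Y n. c n y * character y x)" for n x
  define m where "m n = (\<Sum>y\<in>Y n. c n y * of_bool (y = z))" for n
  let ?g = "ball_mean (\<lambda>x. g x * character (- z) x)"
  let ?p = "\<lambda>n. ball_mean (\<lambda>x. p n x * character (- z) x)"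
  have lim: "(?p n \<longlongrightarrow> m n) at_top" for n
    unfolding p_def m_def by (rule ball_mean_trig_poly_tendsto[OF Y])
  have cg: "continuous_on UNIV (\<lambda>x. g x * character (- z) x)"
    by (intro continuous_intros bohr_ap_functions_continuous g)
  have cp: "continuous_on UNIV (\<lambda>x. p n x * character (- z) x)" for n
    unfolding p_def by (intro continuous_intros)
  have close: "norm (?g R - ?p n R) \<le> 1 / real (Suc n)" if "R > 0" for n R
  proof -
    have "?g R - ?p n R = ball_mean (\<lambda>x. g x * character (- z) x - p n x * character (- z) x) R"
      by (simp add: ball_mean_diff[OF cg cp])
    moreover have "norm (g x * character (- z) x - p n x * character (- z) x) \<le> 1 / real (Suc n)" for x
      using c[of x n] by (simp add: norm_mult p_def flip: left_diff_distrib)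
    ultimately show ?thesis
      using that by (simp only:) (intro norm_ball_mean_le_const continuous_intros cg cp)
  qed
  have unif: "uniform_limit {0<..} (\<lambda>n R. ?p n R) ?g sequentially"
  proof (rule uniform_limitI)
    fix e :: real assume "e > 0"
    then have "\<forall>\<^sub>F n in sequentially. 1 / real (Suc n) < e"
      using order_tendstoD(2)[OF LIMSEQ_inverse_real_of_nat] by (simp add: inverse_eq_divide)
    then show "\<forall>\<^sub>F n in sequentially. \<forall>R\<in>{0<..}. dist (?p n R) (?g R) < e"
    proof eventually_elim
      case (elim n)
      then show ?case using close[of _ n] by (fastforce simp: dist_norm norm_minus_commute)
    qed
  qed
  have "Cauchy m"
  proof (rule metric_CauchyI)
    fix e :: real assume "e > 0"
    then obtain K where K: "1 / real (Suc K) < e / 2"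
      using reals_Archimedean[of "e / 2"] by (auto simp: inverse_eq_divide)
    have "dist (m k) (m l) < e" if "k \<ge> K" "l \<ge> K" for k l
    proof -
      have "norm (m k - m l) \<le> 1 / real (Suc k) + 1 / real (Suc l)"
      proof (rule tendsto_upperbound)
        show "((\<lambda>R. norm (?p k R - ?p l R)) \<longlongrightarrow> norm (m k - m l)) at_top"
          by (intro tendsto_intros lim)
        show "\<forall>\<^sub>F R in at_top. norm (?p k R - ?p l R) \<le> 1 / real (Suc k) + 1 / real (Suc l)"
          using eventually_gt_at_top[of 0]
        proof eventually_elim
          case (elim R)
          then show ?case using close[of R k] close[of R l]
              norm_triangle_ineq4[of "?g R - ?p l R" "?g R - ?p k R"] by simp
        qed
      qed simp
      also have "\<dots> \<le> 1 / real (Suc K) + 1 / real (Suc K)"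
        using that by (intro add_mono divide_left_mono) auto
      finally show ?thesis using K by (simp add: dist_norm)
    qed
    then show "\<exists>M. \<forall>k\<ge>M. \<forall>l\<ge>M. dist (m k) (m l) < e" by blast
  qed
  then obtain a where "m \<longlonglongrightarrow> a"
    using Cauchy_convergent_iff convergent_def by blast
  then have "(?g \<longlongrightarrow> a) at_top"
    using swap_uniform_limit'[of ?p m at_top sequentially a "{0<..}" ?g, OF _ _ unif]
      lim eventually_gt_at_top[of "0::real"] by simp
  then show thesis by (rule that)
qed

text \<open>Convolving \<open>g\<close> with the nonnegative kernel \<open>\<bar>\<Sum>u\<in>F. \<chi>\<^sub>u\<bar>\<^sup>2 / card F\<close> gives a trigonometric
  polynomial which only involves frequencies in the spectrum of \<open>g\<close>. If \<open>F\<close> is almost invariant under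
  the frequencies of a trigonometric polynomial close to \<open>g\<close>, then this polynomial, and hence \<open>g\<close>, is
  hardly changed.\<close>

lemma bohr_ap_approx_spectrum:
  fixes g :: "real^'n \<Rightarrow> complex"
  assumes g: "g \<in> bohr_ap_functions"
    and \<Gamma>: "\<And>z. z \<notin> \<Gamma> \<Longrightarrow> (ball_mean (\<lambda>x. g x * character (- z) x) \<longlongrightarrow> 0) at_top"
    and \<epsilon>: "\<epsilon> > 0"
  obtains I :: "((real^'n) \<times> (real^'n)) set" and w b
    where "finite I" "\<And>i. i \<in> I \<Longrightarrow> w i \<in> \<Gamma>"
      "\<And>x. norm (g x - (\<Sum>i\<in>I. b i * character (w i) x)) \<le> \<epsilon>"
proof -
  obtain Y c where Y: "finite Y" and pg: "\<And>x. norm (g x - (\<Sum>y\<in>Y. c y * character y x)) < \<epsilon> / 3"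
    using bohr_ap_functions_approx[OF g, of "\<epsilon> / 3"] \<epsilon> by auto
  define p where "p x = (\<Sum>y\<in>Y. c y * character y x)" for x
  \<comment> \<open>The coefficients of \<open>p\<close> get multiplied by factors within
    \<open>\<delta>\<close> of 1, which costs at most \<open>\<delta>\<close> times the sum of all
    \<open>norm (c y)\<close>. The summand 1 excludes a zero denominator.\<close>
  define \<delta> where "\<delta> = \<epsilon> / 3 / (1 + (\<Sum>y\<in>Y. norm (c y)))"
  have cpos: "1 + (\<Sum>y\<in>Y. norm (c y)) > 0" by (simp add: add_pos_nonneg sum_nonneg)
  have \<delta>: "\<delta> > 0" unfolding \<delta>_def using \<epsilon> cpos by simp
  obtain F where F: "finite F" "F \<noteq> {}"
    and inv: "\<And>y. y \<in> Y \<Longrightarrow> real (card (F \<inter> (\<lambda>v. v + y) ` F)) \<ge> (1 - \<delta>) * real (card F)"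
    using exists_almost_invariant_finite_set[OF Y \<delta>] by metis
  have "\<exists>a. (ball_mean (\<lambda>x. g x * character (- z) x) \<longlongrightarrow> a) at_top" for z
    using bohr_ap_mean_exists[OF g] by metis
  then obtain a where a: "\<And>z. (ball_mean (\<lambda>x. g x * character (- z) x) \<longlongrightarrow> a z) at_top"
    by metis
  have a0: "a z = 0" if "z \<notin> \<Gamma>" for z
    by (rule tendsto_unique[OF _ a \<Gamma>]) (use that in auto)
  define N where "N = complex_of_real (real (card F))"
  have N: "N \<noteq> 0" using F by (simp add: N_def)
  \<comment> \<open>Expanding the square gives the frequencies \<open>u - v\<close>; only pairs with
    \<open>u = v\<close> have a nonzero mean, and dividing by \<open>card F\<close> makes their
    total 1.\<close>
  define kr where "kr s = (norm (\<Sum>u\<in>F. character u s))\<^sup>2 / real (card F)" for s :: "real^'n"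
  have kr_nonneg: "kr s \<ge> 0" for s by (simp add: kr_def)
  have kr: "complex_of_real (kr s) = (\<Sum>(u,v)\<in>F\<times>F. character (u - v) s) / N" for s
  proof -
    have "complex_of_real ((norm (\<Sum>u\<in>F. character u s))\<^sup>2)
        = (\<Sum>u\<in>F. character u s) * (\<Sum>v\<in>F. character (- v) s)"
      unfolding complex_norm_square by (simp add: character_minus)
    also have "\<dots> = (\<Sum>(u,v)\<in>F\<times>F. character (u - v) s)"
      using character_add[of _ "- _" s] by (simp add: sum_product sum.cartesian_product)
    finally show ?thesis by (simp add: kr_def N_def)
  qed
  have ckr: "continuous_on A (\<lambda>t. kr (x - t))" for A x
    unfolding kr_def using F by (intro continuous_intros) auto
  have conv: "ball_mean (\<lambda>t. h t * of_real (kr (x - t))) R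
      = (\<Sum>(u,v)\<in>F\<times>F. character (u - v) x * ball_mean (\<lambda>t. h t * character (- (u - v)) t) R) / N"
    if "continuous_on UNIV h" for h x R
  proof -
    have "(\<lambda>t. h t * of_real (kr (x - t)))
        = (\<lambda>t. (1 / N) * (\<Sum>i\<in>F\<times>F. character (fst i - snd i) x * (h t * character (- (fst i - snd i)) t)))"
    proof
      fix t
      have "character (u - v) (x - t) = character (u - v) x * character (- (u - v)) t" for u v
        using character_add_right[of "u - v" x "- t"] character_minus_right[of "u - v" t] by simp
      then show "h t * of_real (kr (x - t))
          = (1 / N) * (\<Sum>i\<in>F\<times>F. character (fst i - snd i) x * (h t * character (- (fst i - snd i)) t))"
        unfolding kr by (simp add: sum_distrib_left sum_divide_distrib case_prod_unfold mult_ac)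
    qed
    then show ?thesis
      by (simp only: ball_mean_cmult)
         (simp add: ball_mean_sum ball_mean_cmult that continuous_intros case_prod_unfold)
  qed
  \<comment> \<open>\<open>\<kappa> y\<close> is the Fourier coefficient of the kernel at
    \<open>y\<close>; \<open>q\<close> and \<open>r\<close> are the convolutions, in the sense of
    means, of \<open>g\<close> and \<open>p\<close> with the kernel.\<close>
  define \<kappa> where "\<kappa> y = real (card (F \<inter> (\<lambda>v. v + y) ` F)) / real (card F)" for y
  define q where "q x = (\<Sum>(u,v)\<in>F\<times>F. character (u - v) x * a (u - v)) / N" for x
  define r where "r x = (\<Sum>y\<in>Y. c y * of_real (\<kappa> y) * character y x)" for x
  have count: "(\<Sum>(u,v)\<in>F\<times>F. character (u - v) x * of_bool (y = u - v)) / N = of_real (\<kappa> y) * character y x"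
    for x y
  proof -
    have "(\<Sum>(u,v)\<in>F\<times>F. character (u - v) x * of_bool (y = u - v))
        = (\<Sum>u\<in>F. \<Sum>v\<in>F. if v = u - y then character y x else 0)"
      unfolding sum.cartesian_product
      by (intro sum.cong) (auto simp: algebra_simps)
    also have "\<dots> = (\<Sum>u\<in>F. if u \<in> (\<lambda>v. v + y) ` F then character y x else 0)"
      by (intro sum.cong) (use F in \<open>auto simp: image_iff\<close>)
    also have "\<dots> = of_nat (card (F \<inter> (\<lambda>v. v + y) ` F)) * character y x"
      using F by (simp add: sum.If_cases Int_def)
    finally show ?thesis by (simp add: \<kappa>_def N_def)
  qed
  have cg: "continuous_on UNIV g" by (rule bohr_ap_functions_continuous[OF g])
  have cp: "continuous_on UNIV p" unfolding p_def by (intro continuous_intros)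
  have limg: "(ball_mean (\<lambda>t. g t * of_real (kr (x - t))) \<longlongrightarrow> q x) at_top" for x
    unfolding conv[OF cg] q_def case_prod_unfold
    by (intro tendsto_intros a N)
  have limp: "(ball_mean (\<lambda>t. p t * of_real (kr (x - t))) \<longlongrightarrow> r x) at_top" for x
  proof -
    have "(ball_mean (\<lambda>t. p t * of_real (kr (x - t)))
        \<longlongrightarrow> (\<Sum>(u,v)\<in>F\<times>F. character (u - v) x * (\<Sum>y\<in>Y. c y * of_bool (y = u - v))) / N) at_top"
      unfolding conv[OF cp] case_prod_unfold unfolding p_def
      by (intro tendsto_intros ball_mean_trig_poly_tendsto Y N)
    also have "(\<Sum>(u,v)\<in>F\<times>F. character (u - v) x * (\<Sum>y\<in>Y. c y * of_bool (y = u - v))) / N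
        = (\<Sum>y\<in>Y. c y * ((\<Sum>(u,v)\<in>F\<times>F. character (u - v) x * of_bool (y = u - v)) / N))"
      by (subst sum_divide_distrib, simp only: case_prod_unfold sum_distrib_left sum_divide_distrib,
          subst sum.swap, intro sum.cong) (auto simp: mult_ac)
    also have "\<dots> = r x"
      by (simp only: count r_def mult.assoc)
    finally show ?thesis .
  qed
  have lim1: "(ball_mean (\<lambda>t. of_real (kr (x - t))) \<longlongrightarrow> 1) at_top" for x
  proof -
    have one: "ball_mean (\<lambda>t. 1 * character (- (u - v)) t) = ball_mean (character (v - u))" for u v :: "real^'n"
      by simp
    have "(ball_mean (\<lambda>t. 1 * of_real (kr (x - t)))
        \<longlongrightarrow> (\<Sum>(u,v)\<in>F\<times>F. character (u - v) x * of_bool (v - u = 0)) / N) at_top"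
      unfolding conv[OF continuous_on_const] case_prod_unfold one
      by (intro tendsto_intros ball_mean_character_tendsto N)
    also have "(\<Sum>(u,v)\<in>F\<times>F. character (u - v) x * of_bool (v - u = 0)) / N
        = (\<Sum>(u,v)\<in>F\<times>F. character (u - v) x * of_bool (0 = u - v)) / N"
      by (intro arg_cong[where f = "\<lambda>s. s / N"] sum.cong) auto
    also have "\<dots> = 1"
      unfolding count using F by (simp add: \<kappa>_def)
    finally show ?thesis by simp
  qed
  \<comment> \<open>Averaging against a nonnegative kernel of mean 1 does not enlarge the uniform
    distance between \<open>g\<close> and \<open>p\<close>.\<close>
  have qr: "norm (q x - r x) \<le> \<epsilon> / 3" for x
  proof (rule tendsto_le)
    show "((\<lambda>R. norm (ball_mean (\<lambda>t. g t * of_real (kr (x - t))) R - ball_mean (\<lambda>t. p t * of_real (kr (x - t))) R))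
        \<longlongrightarrow> norm (q x - r x)) at_top"
      by (intro tendsto_intros limg limp)
    show "((\<lambda>R. \<epsilon> / 3 * Re (ball_mean (\<lambda>t. of_real (kr (x - t))) R)) \<longlongrightarrow> \<epsilon> / 3) at_top"
      using tendsto_mult[OF tendsto_const[of "\<epsilon> / 3"] tendsto_Re[OF lim1[of x]]] by simp
    show "\<forall>\<^sub>F R in at_top. norm (ball_mean (\<lambda>t. g t * of_real (kr (x - t))) R - ball_mean (\<lambda>t. p t * of_real (kr (x - t))) R)
        \<le> \<epsilon> / 3 * Re (ball_mean (\<lambda>t. of_real (kr (x - t))) R)"
    proof (rule always_eventually, rule allI)
      fix R
      have "norm (ball_mean (\<lambda>t. g t * of_real (kr (x - t)) - p t * of_real (kr (x - t))) R)
          \<le> Re (ball_mean (\<lambda>t. of_real (\<epsilon> / 3 * kr (x - t))) R)"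
      proof (rule norm_ball_mean_le)
        fix t
        show "norm (g t * of_real (kr (x - t)) - p t * of_real (kr (x - t))) \<le> \<epsilon> / 3 * kr (x - t)"
          using mult_right_mono[OF less_imp_le[OF pg[of t]] kr_nonneg[of "x - t"]] kr_nonneg[of "x - t"]
          by (simp add: norm_mult p_def flip: left_diff_distrib)
      qed (intro continuous_intros cg cp ckr)+
      also have "ball_mean (\<lambda>t. complex_of_real (\<epsilon> / 3 * kr (x - t))) R = of_real (\<epsilon> / 3) * ball_mean (\<lambda>t. of_real (kr (x - t))) R"
        unfolding of_real_mult by (rule ball_mean_cmult)
      finally show "norm (ball_mean (\<lambda>t. g t * of_real (kr (x - t))) R - ball_mean (\<lambda>t. p t * of_real (kr (x - t))) R)
          \<le> \<epsilon> / 3 * Re (ball_mean (\<lambda>t. of_real (kr (x - t))) R)"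
        by (subst ball_mean_diff[symmetric]) (auto intro!: continuous_intros cg cp ckr)
    qed
  qed simp
  have rp: "norm (p x - r x) \<le> \<epsilon> / 3" for x
  proof -
    have k: "\<bar>1 - \<kappa> y\<bar> \<le> \<delta>" if "y \<in> Y" for y
    proof -
      have "card (F \<inter> (\<lambda>v. v + y) ` F) \<le> card F" using F by (intro card_mono) auto
      then have "\<kappa> y \<le> 1" using F by (simp add: \<kappa>_def card_gt_0_iff)
      moreover have "\<kappa> y \<ge> 1 - \<delta>"
        using inv[OF that] F by (simp add: \<kappa>_def card_gt_0_iff field_simps)
      ultimately show ?thesis by simp
    qed
    have "p x - r x = (\<Sum>y\<in>Y. c y * of_real (1 - \<kappa> y) * character y x)"
      by (simp add: p_def r_def algebra_simps sum_subtractf)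
    also have "norm \<dots> \<le> (\<Sum>y\<in>Y. norm (c y) * \<delta>)"
    proof (rule sum_norm_le)
      fix y assume "y \<in> Y"
      then show "norm (c y * of_real (1 - \<kappa> y) * character y x) \<le> norm (c y) * \<delta>"
        unfolding norm_mult norm_of_real norm_character using k by (simp add: mult_left_mono)
    qed
    also have "\<dots> = (\<Sum>y\<in>Y. norm (c y)) * \<delta>" by (simp add: sum_distrib_right)
    also have "\<dots> \<le> (1 + (\<Sum>y\<in>Y. norm (c y))) * \<delta>" using \<delta> by simp
    also have "\<dots> = \<epsilon> / 3" unfolding \<delta>_def using cpos
      by (metis less_irrefl nonzero_mult_div_cancel_left times_divide_eq_right)
    finally show ?thesis .
  qed
  \<comment> \<open>Indexing by pairs lets frequencies repeat; pairs whose difference is outside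
    \<open>\<Gamma>\<close> drop out since \<open>a\<close> vanishes there.\<close>
  define I where "I = {i \<in> F \<times> F. fst i - snd i \<in> \<Gamma>}"
  show thesis
  proof (rule that)
    show "finite I" using F by (simp add: I_def)
    show "fst i - snd i \<in> \<Gamma>" if "i \<in> I" for i using that by (simp add: I_def)
    fix x
    have "(\<Sum>i\<in>I. a (fst i - snd i) / N * character (fst i - snd i) x)
        = (\<Sum>i\<in>F\<times>F. a (fst i - snd i) / N * character (fst i - snd i) x)"
      unfolding I_def using F by (intro sum.mono_neutral_left) (auto simp: a0)
    also have "\<dots> = q x"
      by (simp add: q_def case_prod_unfold sum_divide_distrib mult_ac)
    finally have "norm (g x - (\<Sum>i\<in>I. a (fst i - snd i) / N * character (fst i - snd i) x)) = norm (g x - q x)"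
      by simp
    also have "g x - q x = (g x - p x) + (p x - r x) - (q x - r x)" by simp
    also have "norm \<dots> \<le> norm (g x - p x) + norm (p x - r x) + norm (q x - r x)"
      by (meson add_mono norm_triangle_ineq norm_triangle_ineq4 order_refl order_trans)
    also have "\<dots> \<le> \<epsilon> / 3 + \<epsilon> / 3 + \<epsilon> / 3"
      using pg[of x] rp[of x] qr[of x] by (intro add_mono) (auto simp: p_def)
    finally show "norm (g x - (\<Sum>i\<in>I. a (fst i - snd i) / N * character (fst i - snd i) x)) \<le> \<epsilon>" by simp
  qed
qed

section \<open>Almost periods of the point set\<close>

lemma delone_separated:
  assumes "delone L"
  obtains r where "r > 0" "\<And>a b. a \<in> L \<Longrightarrow> b \<in> L \<Longrightarrow> norm (a - b) < r \<Longrightarrow> a = b"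
proof -
  let ?D = "{norm (l2 - l1) | l1 l2. l1 \<in> L \<and> l2 \<in> L \<and> l1 \<noteq> l2}"
  have "Inf ?D > 0" using assms by (simp add: delone_def)
  moreover have "a = b" if "a \<in> L" "b \<in> L" "norm (a - b) < Inf ?D" for a b
  proof (rule ccontr)
    assume "a \<noteq> b"
    then have "norm (a - b) \<in> ?D" using that by blast
    then have "Inf ?D \<le> norm (a - b)" by (intro cInf_lower bdd_belowI[of _ 0]) auto
    with that show False by simp
  qed
  ultimately show thesis by (rule that)
qed

lemma separated_finite_ball:
  assumes "r > 0" "\<And>a b. a \<in> L \<Longrightarrow> b \<in> L \<Longrightarrow> norm (a - b) < r \<Longrightarrow> a = b"
  shows "finite (L \<inter> ball (0 :: real^'n) R)"
proof (rule ccontr)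
  assume inf: "infinite (L \<inter> ball 0 R)"
  have "bounded (L \<inter> ball 0 R)" by (simp add: bounded_Int)
  then obtain x where "x islimpt (L \<inter> ball 0 R)"
    using bounded_infinite_imp_islimpt[OF subset_refl _ inf] by blast
  then have infx: "infinite (L \<inter> ball 0 R \<inter> ball x (r / 2))"
    using assms(1) by (simp add: islimpt_eq_infinite_ball)
  then obtain a where a: "a \<in> L \<inter> ball 0 R \<inter> ball x (r / 2)"
    using infinite_imp_nonempty[OF infx] by blast
  have "infinite (L \<inter> ball 0 R \<inter> ball x (r / 2) - {a})" using infx by simp
  then obtain b where b: "b \<in> L \<inter> ball 0 R \<inter> ball x (r / 2)" "b \<noteq> a"
    using infinite_imp_nonempty by blast
  have "norm (a - b) < r"
    using dist_triangle_half_l[of a x r b] a b by (simp add: dist_norm norm_minus_commute)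
  then show False using assms(2) a b by blast
qed

text \<open>Packing: the balls of radius \<open>r / 2\<close> about the points are disjoint and fit
  into the shell widened by \<open>r / 2\<close> on both sides.\<close>

lemma separated_shell_card:
  fixes L :: "(real^'n) set"
  assumes "r > 0" and sep: "\<And>a b. a \<in> L \<Longrightarrow> b \<in> L \<Longrightarrow> norm (a - b) < r \<Longrightarrow> a = b"
    and "A \<ge> B"
  shows "real (card (L \<inter> (ball 0 A - ball 0 B))) * measure lborel (ball (0 :: real^'n) (r / 2))
    \<le> measure lborel (ball (0 :: real^'n) (A + r / 2)) - measure lborel (ball (0 :: real^'n) (B - r / 2))"
proof -
  let ?X = "L \<inter> (ball 0 A - ball 0 B)"
  have fin: "finite ?X"
    by (rule finite_subset[OF _ separated_finite_ball[OF assms(1) sep, of L A]]) auto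
  have f: "emeasure lborel (ball c s) \<noteq> \<infinity>" for c :: "real^'n" and s
    using less_imp_neq[OF emeasure_lborel_ball_finite] by simp
  have disj: "disjoint_family_on (\<lambda>l. ball l (r / 2)) ?X"
    unfolding disjoint_family_on_def
  proof (intro ballI impI, rule ccontr)
    fix a b assume ab: "a \<in> ?X" "b \<in> ?X" "a \<noteq> b" "ball a (r / 2) \<inter> ball b (r / 2) \<noteq> {}"
    then obtain x where "dist a x < r / 2" "dist b x < r / 2" by auto
    then have "norm (a - b) < r"
      using dist_triangle_half_l[of a x r b] by (simp add: dist_norm norm_minus_commute)
    with ab sep show False by blast
  qed
  have "real (card ?X) * measure lborel (ball (0 :: real^'n) (r / 2)) = (\<Sum>l\<in>?X. measure lborel (ball l (r / 2)))"
    using assms(1) by (simp only: measure_lborel_ball sum_constant half_gt_zero less_imp_le)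
  also have "\<dots> = measure lborel (\<Union>l\<in>?X. ball l (r / 2))"
    by (rule measure_finite_Union[symmetric]) (use fin disj f in auto)
  also have "\<dots> \<le> measure lborel (ball (0 :: real^'n) (A + r / 2) - ball 0 (B - r / 2))"
  proof (rule measure_mono_fmeasurable)
    show "(\<Union>l\<in>?X. ball l (r / 2)) \<subseteq> ball 0 (A + r / 2) - ball 0 (B - r / 2)"
    proof clarify
      fix l x assume l: "l \<in> L" "l \<in> ball 0 A" "l \<notin> ball 0 B" "x \<in> ball l (r / 2)"
      then show "x \<in> ball 0 (A + r / 2) - ball 0 (B - r / 2)"
        using norm_triangle_ineq2[of x l] norm_triangle_ineq2[of l x]
        by (auto simp: dist_norm norm_minus_commute)
    qed
    show "(\<Union>l\<in>?X. ball l (r / 2)) \<in> sets lborel" using fin by auto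
    show "ball 0 (A + r / 2) - ball 0 (B - r / 2) \<in> fmeasurable lborel"
      by (rule fmeasurable.Diff) (auto intro!: fmeasurableI emeasure_lborel_ball_finite)
  qed
  also have "\<dots> = measure lborel (ball (0 :: real^'n) (A + r / 2)) - measure lborel (ball (0 :: real^'n) (B - r / 2))"
    by (rule measure_Diff) (use f assms in \<open>auto intro!: subset_ball\<close>)
  finally show ?thesis .
qed

lemma separated_shell_card_ratio_tendsto:
  fixes L :: "(real^'n) set"
  assumes "r > 0" and sep: "\<And>a b. a \<in> L \<Longrightarrow> b \<in> L \<Longrightarrow> norm (a - b) < r \<Longrightarrow> a = b"
    and "A \<ge> B"
  shows "((\<lambda>R. real (card (L \<inter> (ball 0 (R + A) - ball 0 (R + B)))) / measure lborel (ball (0 :: real^'n) R)) \<longlongrightarrow> 0) at_top"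
proof (rule real_tendsto_sandwich[OF _ _ tendsto_const])
  let ?V = "\<lambda>R. measure lborel (ball (0 :: real^'n) R)"
  have p: "?V (r / 2) > 0" using assms(1) by (intro measure_lborel_ball_pos) simp
  show "((\<lambda>R. (?V (R + (A + r / 2)) - ?V (R + (B - r / 2))) / ?V R / ?V (r / 2)) \<longlongrightarrow> 0) at_top"
    by (rule tendsto_divide_zero) (rule measure_ball_diff_ratio_tendsto)
  show "\<forall>\<^sub>F R in at_top. real (card (L \<inter> (ball 0 (R + A) - ball 0 (R + B)))) / ?V R
      \<le> (?V (R + (A + r / 2)) - ?V (R + (B - r / 2))) / ?V R / ?V (r / 2)"
  proof (rule always_eventually, rule allI)
    fix R
    have "real (card (L \<inter> (ball 0 (R + A) - ball 0 (R + B)))) * ?V (r / 2)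
        \<le> ?V (R + (A + r / 2)) - ?V (R + (B - r / 2))"
      using separated_shell_card[OF assms(1) sep, of L "R + B" "R + A"] assms(3)
      by (simp only: add.assoc add_diff_eq add_le_cancel_left)
    then have "real (card (L \<inter> (ball 0 (R + A) - ball 0 (R + B))))
        \<le> (?V (R + (A + r / 2)) - ?V (R + (B - r / 2))) / ?V (r / 2)"
      by (simp only: pos_le_divide_eq[OF p])
    then have "real (card (L \<inter> (ball 0 (R + A) - ball 0 (R + B)))) / ?V R
        \<le> (?V (R + (A + r / 2)) - ?V (R + (B - r / 2))) / ?V (r / 2) / ?V R"
      by (rule divide_right_mono) simp
    then show "real (card (L \<inter> (ball 0 (R + A) - ball 0 (R + B)))) / ?V R
        \<le> (?V (R + (A + r / 2)) - ?V (R + (B - r / 2))) / ?V R / ?V (r / 2)"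
      by (simp only: divide_divide_eq_left mult.commute)
  qed
qed (auto intro!: always_eventually)

section \<open>Fourier coefficients of the point set and of its convolutions\<close>

lemma integrable_continuous_supported_ball:
  fixes h :: "real^'n \<Rightarrow> complex"
  assumes "continuous_on UNIV h" "\<And>x. h x \<noteq> 0 \<Longrightarrow> norm (x - a) \<le> \<rho>"
  shows "integrable lborel h"
proof -
  have "integrable lborel (\<lambda>x. indicator (cball a \<rho>) x *\<^sub>R h x)"
    by (rule borel_integrable_compact) (auto intro: continuous_on_subset[OF assms(1)])
  also have "(\<lambda>x. indicator (cball a \<rho>) x *\<^sub>R h x) = h"
    using assms(2) by (force simp: indicator_def dist_norm norm_minus_commute)
  finally show ?thesis .
qed

lemma integral_lborel_translation:
  fixes h :: "real^'n \<Rightarrow> complex"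
  assumes "continuous_on UNIV h"
  shows "(LINT x|lborel. h x) = (LINT x|lborel. h (l + x))"
proof -
  have "(LINT x|lborel. h x) = (LINT x|distr lborel borel ((+) l). h x)"
    by (simp add: lborel_distr_plus)
  also have "\<dots> = (LINT x|lborel. h (l + x))"
    by (rule integral_distr) (use borel_measurable_continuous_onI[OF assms] in simp_all)
  finally show ?thesis .
qed

lemma conv_comb_ball:
  assumes supp: "\<And>x. f x \<noteq> 0 \<Longrightarrow> norm x < \<rho>"
    and fin: "finite (L \<inter> ball 0 (R + \<rho>))" and x: "norm x < R"
  shows "conv_comb L f x = (\<Sum>l\<in>L \<inter> ball 0 (R + \<rho>). f (x - l))"
proof -
  have "f (x - l) = 0" if "l \<notin> ball 0 (R + \<rho>)" for l
    using supp[of "x - l"] norm_triangle_ineq4[of x "x - l"] that x by auto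
  then have "conv_comb L f x = infsum (\<lambda>l. f (x - l)) (L \<inter> ball 0 (R + \<rho>))"
    unfolding conv_comb_def by (intro infsum_cong_neutral) auto
  then show ?thesis using fin by simp
qed

text \<open>Integrate termwise. A point deeper than \<open>\<rho>\<close> inside the ball
  contributes its full integral, which is \<open>character (- y) l\<close> times the Fourier
  transform of \<open>f\<close>; a point beyond \<open>R + \<rho>\<close> contributes nothing. Each
  point of the shell in between causes an error of at most twice the L1 norm of \<open>f\<close>,
  and these points are too few to matter.\<close>

lemma ball_mean_conv_comb:
  fixes L :: "(real^'n) set"
  assumes "r > 0" and sep: "\<And>a b. a \<in> L \<Longrightarrow> b \<in> L \<Longrightarrow> norm (a - b) < r \<Longrightarrow> a = b"
    and cf: "continuous_on UNIV f" and "\<rho> > 0" and supp: "\<And>x. f x \<noteq> 0 \<Longrightarrow> norm x < \<rho>"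
  shows "((\<lambda>R. ball_mean (\<lambda>x. conv_comb L f x * character (- y) x) R
      - (LINT x|lborel. f x * character (- y) x)
        * ((\<Sum>l\<in>L \<inter> ball 0 R. character (- y) l) / of_real (measure lborel (ball (0 :: real^'n) R)))) \<longlongrightarrow> 0) at_top"
proof -
  define fh where "fh = (LINT x|lborel. f x * character (- y) x)"
  define N1 where "N1 = (LINT x|lborel. norm (f x))"
  let ?V = "\<lambda>R. measure lborel (ball (0 :: real^'n) R)"
  define h where "h l x = f (x - l) * character (- y) x" for l x
  have ch: "continuous_on UNIV (h l)" for l
    unfolding h_def by (intro continuous_intros continuous_on_compose2[OF cf]) auto
  have ih: "integrable lborel (h l)" for l
    by (rule integrable_continuous_supported_ball[OF ch, of l l \<rho>]) (use supp in \<open>force simp: h_def\<close>)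
  have cfl: "continuous_on UNIV (\<lambda>x. complex_of_real (norm (f (x - l))))" for l
    by (intro continuous_intros continuous_on_compose2[OF cf]) auto
  have in1: "(LINT x|lborel. norm (h l x)) = N1" for l
  proof -
    have "complex_of_real (LINT x|lborel. norm (f (x - l))) = complex_of_real N1"
      using integral_lborel_translation[OF cfl, of l l] by (simp add: N1_def)
    then show ?thesis unfolding of_real_eq_iff by (simp add: h_def norm_mult)
  qed
  have J: "(LINT x|lborel. h l x) = character (- y) l * fh" for l
  proof -
    have "(\<lambda>x. h l (l + x)) = (\<lambda>x. character (- y) l * (f x * character (- y) x))"
      by (simp add: h_def character_add_right mult_ac)
    then show ?thesis by (simp add: integral_lborel_translation[OF ch, of l l] fh_def)
  qed
  have bJ: "norm (LINT x|lborel. h l x) \<le> N1" for l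
    using integral_norm_bound[of lborel "h l"] in1 by simp
  define I where "I R l = (LINT x:ball 0 R|lborel. h l x)" for R l
  have bI: "norm (I R l) \<le> N1" for R l
  proof -
    have "norm (I R l) \<le> (LINT x|lborel. norm (indicator (ball 0 R) x *\<^sub>R h l x))"
      unfolding I_def set_lebesgue_integral_def by (rule integral_norm_bound)
    also have "\<dots> \<le> (LINT x|lborel. norm (h l x))"
    proof (rule integral_mono)
      show "integrable lborel (\<lambda>x. norm (indicator (ball 0 R) x *\<^sub>R h l x))"
        using ih by (intro integrable_norm integrable_mult_indicator) auto
      show "integrable lborel (\<lambda>x. norm (h l x))" using ih by simp
    qed (simp add: indicator_def)
    finally show ?thesis by (simp add: in1)
  qed
  have inner: "I R l = (LINT x|lborel. h l x)" if "norm l < R - \<rho>" for R l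
    unfolding I_def set_lebesgue_integral_def
  proof (rule Bochner_Integration.integral_cong)
    fix x
    show "indicator (ball 0 R) x *\<^sub>R h l x = h l x"
    proof (cases "f (x - l) = 0")
      case False
      then have "norm x < R" using supp[OF False] norm_triangle_ineq[of "x - l" l] that by simp
      then show ?thesis by simp
    qed (simp add: h_def)
  qed simp
  have bound: "norm (ball_mean (\<lambda>x. conv_comb L f x * character (- y) x) R
      - fh * ((\<Sum>l\<in>L \<inter> ball 0 R. character (- y) l) / of_real (?V R)))
      \<le> 2 * N1 * (real (card (L \<inter> (ball 0 (R + \<rho>) - ball 0 (R + (- \<rho>))))) / ?V R)" for R
  proof -
    let ?F = "L \<inter> ball 0 (R + \<rho>)"
    have F: "finite ?F" by (rule separated_finite_ball[OF assms(1) sep])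
    have "(LINT x:ball 0 R|lborel. conv_comb L f x * character (- y) x) = (LINT x:ball 0 R|lborel. \<Sum>l\<in>?F. h l x)"
      using conv_comb_ball[OF supp F]
      by (intro set_lebesgue_integral_cong) (auto simp: h_def sum_distrib_right)
    also have "\<dots> = (\<Sum>l\<in>?F. I R l)"
      using set_integrable_ball_continuous[OF ch]
      unfolding I_def set_lebesgue_integral_def set_integrable_def
      by (simp add: scaleR_sum_right Bochner_Integration.integral_sum)
    finally have 1: "(LINT x:ball 0 R|lborel. conv_comb L f x * character (- y) x) = (\<Sum>l\<in>?F. I R l)" .
    have 2: "fh * (\<Sum>l\<in>L \<inter> ball 0 R. character (- y) l)
        = (\<Sum>l\<in>?F. if l \<in> ball 0 R then (LINT x|lborel. h l x) else 0)"
    proof -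
      have "fh * (\<Sum>l\<in>L \<inter> ball 0 R. character (- y) l) = (\<Sum>l\<in>?F \<inter> ball 0 R. (LINT x|lborel. h l x))"
        unfolding J sum_distrib_left using assms(4)
        by (intro sum.cong) (auto simp: mult.commute)
      also have "\<dots> = (\<Sum>l\<in>?F. if l \<in> ball 0 R then (LINT x|lborel. h l x) else 0)"
        by (rule sum.inter_restrict[OF F])
      finally show ?thesis .
    qed
    have "norm ((\<Sum>l\<in>?F. I R l) - (\<Sum>l\<in>?F. if l \<in> ball 0 R then (LINT x|lborel. h l x) else 0))
        \<le> (\<Sum>l\<in>?F. if l \<in> - ball 0 (R + (- \<rho>)) then 2 * N1 else 0)"
      unfolding sum_subtractf[symmetric]
    proof (rule sum_norm_le)
      fix l
      show "norm (I R l - (if l \<in> ball 0 R then (LINT x|lborel. h l x) else 0))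
          \<le> (if l \<in> - ball 0 (R + (- \<rho>)) then 2 * N1 else 0)"
        using inner[of l R] bI[of R l] bJ[of l] assms(4)
          norm_triangle_ineq4[of "I R l" "LINT x|lborel. h l x"] norm_ge_zero[of "I R l"]
        by (auto simp del: norm_ge_zero)
    qed
    also have "\<dots> = (\<Sum>l\<in>?F \<inter> - ball 0 (R + (- \<rho>)). 2 * N1)"
      by (rule sum.inter_restrict[OF F, symmetric])
    also have "?F \<inter> - ball 0 (R + (- \<rho>)) = L \<inter> (ball 0 (R + \<rho>) - ball 0 (R + (- \<rho>)))" by auto
    finally have 3: "norm ((LINT x:ball 0 R|lborel. conv_comb L f x * character (- y) x)
        - fh * (\<Sum>l\<in>L \<inter> ball 0 R. character (- y) l))
        \<le> 2 * N1 * real (card (L \<inter> (ball 0 (R + \<rho>) - ball 0 (R + (- \<rho>)))))"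
      unfolding 1 2 by (simp add: mult.commute)
    have "ball_mean (\<lambda>x. conv_comb L f x * character (- y) x) R
        - fh * ((\<Sum>l\<in>L \<inter> ball 0 R. character (- y) l) / of_real (?V R))
        = ((LINT x:ball 0 R|lborel. conv_comb L f x * character (- y) x)
        - fh * (\<Sum>l\<in>L \<inter> ball 0 R. character (- y) l)) / of_real (?V R)"
      by (simp add: ball_mean_def diff_divide_distrib)
    then show ?thesis
      using divide_right_mono[OF 3, of "?V R"] by (simp add: norm_divide)
  qed
  have "((\<lambda>R. 2 * N1 * (real (card (L \<inter> (ball 0 (R + \<rho>) - ball 0 (R + (- \<rho>))))) / ?V R)) \<longlongrightarrow> 2 * N1 * 0) at_top"
    by (intro tendsto_mult tendsto_const separated_shell_card_ratio_tendsto[OF assms(1) sep]) (use assms(4) in auto)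
  then show ?thesis
    unfolding fh_def[symmetric]
    by (intro Lim_null_comparison[OF always_eventually[OF allI[OF bound]]]) simp
qed

text \<open>The mean of \<open>(\<mu> * f) \<chi>\<^bsub>-y\<^esub>\<close> exists and equals the \<open>y\<close>-th Fourier coefficient of \<open>f\<close> times that
  of \<open>\<mu>\<close>; in particular the latter exists as soon as the former is nonzero.\<close>

lemma ball_mean_conv_comb_off_freq_set:
  fixes L :: "(real^'n) set"
  assumes "r > 0" "\<And>a b. a \<in> L \<Longrightarrow> b \<in> L \<Longrightarrow> norm (a - b) < r \<Longrightarrow> a = b"
    and "continuous_on UNIV f" "\<rho> > 0" "\<And>x. f x \<noteq> 0 \<Longrightarrow> norm x < \<rho>"
    and ap: "conv_comb L f \<in> bohr_ap_functions" and y: "y \<notin> freq_set L"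
  shows "(ball_mean (\<lambda>x. conv_comb L f x * character (- y) x) \<longlongrightarrow> 0) at_top"
proof -
  define fh where "fh = (LINT x|lborel. f x * character (- y) x)"
  define D where "D R = (\<Sum>l\<in>L \<inter> ball 0 R. character (- y) l) / of_real (measure lborel (ball (0 :: real^'n) R))" for R
  let ?m = "ball_mean (\<lambda>x. conv_comb L f x * character (- y) x)"
  obtain a where a: "(?m \<longlongrightarrow> a) at_top"
    using bohr_ap_mean_exists[OF ap] by blast
  have "((\<lambda>R. ?m R - fh * D R) \<longlongrightarrow> 0) at_top"
    unfolding D_def fh_def by (rule ball_mean_conv_comb[OF assms(1-5)])
  from tendsto_diff[OF a this] have lim: "((\<lambda>R. fh * D R) \<longlongrightarrow> a) at_top" by simp
  have "a = 0"
  proof (cases "fh = 0")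
    case True
    then show ?thesis using lim by (simp add: tendsto_const_iff)
  next
    case False
    have "((\<lambda>R. fh * D R / fh) \<longlongrightarrow> a / fh) at_top"
      by (intro tendsto_intros lim False)
    then have "has_fourier_coeff L y (a / fh)"
      using False by (simp add: has_fourier_coeff_def D_def)
    then have "a / fh = 0" using y unfolding freq_set_def by blast
    then show ?thesis using False by simp
  qed
  with a show ?thesis by simp
qed

lemma norm_cis_minus_one_le: "norm (cis \<theta> - 1) \<le> \<bar>\<theta>\<bar>"
  using dist_exp_i_1[of \<theta>] abs_sin_x_le_abs_x[of "\<theta> / 2"] by (simp add: cis_conv_exp)

lemma inner_int_vecs: "k \<in> int_vecs \<Longrightarrow> l \<in> int_vecs \<Longrightarrow> k \<bullet> l \<in> \<int>"
  by (auto simp: int_vecs_def inner_vec_def intro!: Ints_sum Ints_mult)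

text \<open>The integer \<open>k \<bullet> l\<close> does not affect the character, so only the
  distance from \<open>M *v t\<close> to the lattice matters.\<close>

lemma character_transpose_close_to_one:
  fixes M :: "real^'n^'m"
  assumes "k \<in> int_vecs" "l \<in> int_vecs"
  shows "norm (character (transpose M *v k) t - 1) \<le> 2 * pi * norm k * norm (M *v t - l)"
proof -
  have "character (transpose M *v k) t = cis (2 * pi * (k \<bullet> (M *v t)))"
    by (simp add: character_def dot_lmul_matrix)
  also have "\<dots> = cis (2 * pi * (k \<bullet> (M *v t - l)) + 2 * pi * (k \<bullet> l))"
    by (simp add: inner_diff_right algebra_simps)
  also have "\<dots> = cis (2 * pi * (k \<bullet> (M *v t - l)))"
    using inner_int_vecs[OF assms] by (simp add: cis_multiple_2pi flip: cis_mult)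
  also have "norm (\<dots> - 1) \<le> \<bar>2 * pi * (k \<bullet> (M *v t - l))\<bar>"
    by (rule norm_cis_minus_one_le)
  also have "\<dots> = 2 * pi * \<bar>k \<bullet> (M *v t - l)\<bar>" by (simp add: abs_mult)
  also have "\<dots> \<le> 2 * pi * (norm k * norm (M *v t - l))"
    by (intro mult_left_mono Cauchy_Schwarz_ineq2) simp
  finally show ?thesis by (simp add: mult.assoc)
qed

text \<open>Convolution with a narrow tent detects points: it is 1 on \<open>L\<close> and nonzero
  only near \<open>L\<close>. A close trigonometric polynomial with frequencies in M^T Z^m changes
  little under translation by \<open>t\<close>, uniformly in the position, so the convolution cannot
  vanish at \<open>l + t\<close>.\<close>

lemma almost_period_of_point_set:
  fixes L :: "(real^'n) set" and M :: "real^'n^'m"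
  assumes "delone L" "bohr_ap_set L" "associated M L" "\<epsilon> > 0"
  obtains \<delta> where "\<delta> > 0"
    "\<And>t k l. k \<in> int_vecs \<Longrightarrow> norm (M *v t - k) < \<delta> \<Longrightarrow> l \<in> L \<Longrightarrow> \<exists>l'\<in>L. norm (l + t - l') < \<epsilon>"
proof -
  obtain r where r: "r > 0" and sep: "\<And>a b. a \<in> L \<Longrightarrow> b \<in> L \<Longrightarrow> norm (a - b) < r \<Longrightarrow> a = b"
    using delone_separated[OF assms(1)] by metis
  \<comment> \<open>\<open>\<eta> \<le> \<epsilon>\<close> turns a nonzero value into a point within
    \<open>\<epsilon>\<close>; \<open>\<eta> \<le> r\<close> leaves a single nonzero term at a point
    of \<open>L\<close>, so the value there is exactly 1.\<close>
  define \<eta> where "\<eta> = min \<epsilon> r"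
  have \<eta>: "\<eta> > 0" "\<eta> \<le> \<epsilon>" "\<eta> \<le> r" using assms r by (auto simp: \<eta>_def)
  define f where "f x = complex_of_real (max 0 (1 - norm x / \<eta>))" for x :: "real^'n"
  have cf: "continuous_on UNIV f"
    unfolding f_def using \<eta> by (intro continuous_intros) auto
  have supp: "norm x < \<eta>" if "f x \<noteq> 0" for x
    using that \<eta> by (auto simp: f_def max_def field_simps split: if_splits)
  define g where "g = conv_comb L f"
  have "closure {x. f x \<noteq> 0} \<subseteq> cball 0 \<eta>"
    by (rule closure_minimal) (use supp in force)+
  then have "compact (closure {x. f x \<noteq> 0})"
    using compact_eq_bounded_closed bounded_subset[OF bounded_cball] by blast
  then have g: "g \<in> bohr_ap_functions"
    using assms(2) cf by (simp add: bohr_ap_set_def g_def)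
  let ?\<Gamma> = "(\<lambda>k. transpose M *v k) ` int_vecs"
  have zero: "(ball_mean (\<lambda>x. g x * character (- y) x) \<longlongrightarrow> 0) at_top" if "y \<notin> ?\<Gamma>" for y
    unfolding g_def
    by (rule ball_mean_conv_comb_off_freq_set[OF r sep cf \<eta>(1) supp])
       (use g that assms(3) in \<open>auto simp: g_def associated_def\<close>)
  obtain I w b where I: "finite (I :: ((real^'n) \<times> (real^'n)) set)"
    and w: "\<And>i. i \<in> I \<Longrightarrow> w i \<in> ?\<Gamma>"
    and gb: "\<And>x. norm (g x - (\<Sum>i\<in>I. b i * character (w i) x)) \<le> 1 / 4"
    by (rule bohr_ap_approx_spectrum[OF g, where \<Gamma> = ?\<Gamma> and \<epsilon> = "1 / 4"]) (rule zero, assumption, simp, rule that)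
  have "\<forall>i\<in>I. \<exists>k. k \<in> int_vecs \<and> w i = transpose M *v k" using w by blast
  then obtain \<kappa> where \<kappa>: "\<And>i. i \<in> I \<Longrightarrow> \<kappa> i \<in> int_vecs \<and> w i = transpose M *v \<kappa> i" by metis
  define C where "C = (\<Sum>i\<in>I. norm (b i) * (2 * pi * norm (\<kappa> i)))"
  have C: "C \<ge> 0" unfolding C_def by (intro sum_nonneg) simp
  \<comment> \<open>Keeps the change of the polynomial below 1/2; with two approximation errors of
    1/4 the total is below 1, too little to get from 1 to 0.\<close>
  define \<delta> where "\<delta> = 1 / (4 * (C + 1))"
  show thesis
  proof (rule that[of \<delta>])
    show "\<delta> > 0" using C by (simp add: \<delta>_def)
    fix t k l assume k: "k \<in> int_vecs" and t: "norm (M *v t - k) < \<delta>" and l: "l \<in> L"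
    let ?p = "\<lambda>x. \<Sum>i\<in>I. b i * character (w i) x"
    have "?p (l + t) - ?p l = (\<Sum>i\<in>I. b i * (character (w i) l * (character (w i) t - 1)))"
      by (simp add: character_add_right algebra_simps flip: sum_subtractf)
    also have "norm \<dots> \<le> (\<Sum>i\<in>I. norm (b i) * (2 * pi * norm (\<kappa> i)) * \<delta>)"
    proof (rule sum_norm_le)
      fix i assume i: "i \<in> I"
      have "norm (character (w i) t - 1) \<le> 2 * pi * norm (\<kappa> i) * norm (M *v t - k)"
        using character_transpose_close_to_one[of "\<kappa> i" k M t] \<kappa>[OF i] k by simp
      also have "\<dots> \<le> 2 * pi * norm (\<kappa> i) * \<delta>"
        using t by (intro mult_left_mono) auto
      finally have "norm (b i) * norm (character (w i) t - 1) \<le> norm (b i) * (2 * pi * norm (\<kappa> i) * \<delta>)"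
        by (rule mult_left_mono) simp
      then show "norm (b i * (character (w i) l * (character (w i) t - 1)))
          \<le> norm (b i) * (2 * pi * norm (\<kappa> i)) * \<delta>"
        by (simp add: norm_mult mult.assoc)
    qed
    also have "\<dots> = C * \<delta>" by (simp add: C_def sum_distrib_right)
    also have "\<dots> < 1 / 2" using C by (simp add: \<delta>_def field_simps)
    finally have p: "norm (?p (l + t) - ?p l) < 1 / 2" .
    have "norm (g (l + t) - g l) < 1"
    proof -
      have tri: "norm (a - b) < 1" if "norm (a - c) \<le> 1 / 4" "norm (c - d) < 1 / 2" "norm (b - d) \<le> 1 / 4"
        for a b c d :: complex
        using that norm_triangle_ineq4[of "a - d" "b - d"] norm_triangle_ineq[of "a - c" "c - d"] by simp
      show ?thesis by (rule tri[OF gb p gb])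
    qed
    moreover have "g l = 1"
    proof -
      have "g l = infsum (\<lambda>l'. f (l - l')) {l}"
        unfolding g_def conv_comb_def
      proof (rule infsum_cong_neutral)
        fix l' assume "l' \<in> L - {l}"
        then show "f (l - l') = 0" using supp[of "l - l'"] sep[of l l'] \<eta> l by force
      qed (use l in auto)
      then show ?thesis by (simp add: f_def)
    qed
    ultimately have "g (l + t) \<noteq> 0" by fastforce
    have "\<exists>l'\<in>L. f (l + t - l') \<noteq> 0"
    proof (rule ccontr)
      assume "\<not> ?thesis"
      then have "g (l + t) = 0" unfolding g_def conv_comb_def by (intro infsum_0) auto
      with \<open>g (l + t) \<noteq> 0\<close> show False by contradiction
    qed
    then obtain l' where "l' \<in> L" "f (l + t - l') \<noteq> 0" by blast
    then show "\<exists>l'\<in>L. norm (l + t - l') < \<epsilon>" using supp \<eta> by force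
  qed
qed

section \<open>Uniform transversals\<close>

lemma int_vecs_add: "k \<in> int_vecs \<Longrightarrow> l \<in> int_vecs \<Longrightarrow> k + l \<in> int_vecs"
  and int_vecs_minus: "k \<in> int_vecs \<Longrightarrow> - k \<in> int_vecs"
  and int_vecs_diff: "k \<in> int_vecs \<Longrightarrow> l \<in> int_vecs \<Longrightarrow> k - l \<in> int_vecs"
  and int_vecs_zero: "0 \<in> int_vecs"
  by (auto simp: int_vecs_def)

lemma rho_add_int_vec: "k \<in> int_vecs \<Longrightarrow> rho (x + k) = rho x"
  by (simp add: rho_def int_vecs_def vec_eq_iff distrib_left cis_multiple_2pi flip: cis_mult)

lemma rho_eq_iff: "rho x = rho y \<longleftrightarrow> x - y \<in> int_vecs"
proof
  assume "x - y \<in> int_vecs"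
  then show "rho x = rho y" using rho_add_int_vec[of "x - y" y] by simp
next
  assume eq: "rho x = rho y"
  have "x $ i - y $ i \<in> \<int>" for i
  proof -
    have "cis (2 * pi * x $ i) = cis (2 * pi * y $ i)"
      using eq by (simp add: rho_def vec_eq_iff)
    then have "cis (2 * pi * (x $ i - y $ i)) = 1"
      by (simp add: right_diff_distrib flip: cis_divide)
    then have "cos (2 * pi * (x $ i - y $ i)) = 1"
      by (metis cis.sel(1) one_complex.sel(1))
    then obtain n :: int where "2 * pi * (x $ i - y $ i) = of_int n * 2 * pi"
      unfolding cos_one_2pi_int by blast
    then have "x $ i - y $ i = of_int n" by simp
    then show ?thesis by simp
  qed
  then show "x - y \<in> int_vecs" by (simp add: int_vecs_def)
qed

lemma continuous_on_rho [continuous_intros]: "continuous_on A f \<Longrightarrow> continuous_on A (\<lambda>x. rho (f x))"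
  unfolding rho_def by (intro continuous_intros)

lemma norm_rho_diff: "norm (rho x - rho y) = norm (rho (x - y) - 1)"
proof -
  have "rho x $ i - rho y $ i = rho y $ i * (rho (x - y) $ i - 1)" for i
    by (simp add: rho_def right_diff_distrib cis_mult)
  then have "norm (rho x $ i - rho y $ i) = norm (rho (x - y) $ i - 1)" for i
    by (simp add: norm_mult) (simp add: rho_def)
  then show ?thesis by (simp add: norm_vec_def)
qed

definition nearest_int_vec :: "real^'m \<Rightarrow> real^'m"
  where "nearest_int_vec x = (\<chi> i. of_int (round (x $ i)))"

lemma nearest_int_vec_in_int_vecs: "nearest_int_vec x \<in> int_vecs"
  by (simp add: nearest_int_vec_def int_vecs_def)

lemma nearest_int_vec_component: "\<bar>(x - nearest_int_vec x) $ i\<bar> \<le> 1 / 2"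
  using of_int_round_abs_le[of "x $ i"] by (simp add: nearest_int_vec_def abs_minus_commute)

lemma mem_half_cube: "(x :: real^'m) \<in> cbox (- (\<chi> i. 1 / 2)) (\<chi> i. 1 / 2) \<longleftrightarrow> (\<forall>i. \<bar>x $ i\<bar> \<le> 1 / 2)"
proof -
  have "(- (1 / 2) \<le> a \<and> a \<le> 1 / 2) \<longleftrightarrow> \<bar>a\<bar> \<le> 1 / 2" for a :: real by arith
  then show ?thesis by (simp add: mem_box_cart)
qed

text \<open>Reduce \<open>x - y\<close> to the centred unit cube. Its only integer vector is 0, so
  by compactness \<open>rho \<theta>\<close> stays away from 1 on the vectors in it of length at
  least \<open>\<delta>\<close>.\<close>

lemma rho_close_imp_close_mod_int:
  assumes "\<delta> > 0"
  obtains \<eta> where "\<eta> > 0"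
    "\<And>x y :: real^'m. norm (rho x - rho y) < \<eta> \<Longrightarrow> \<exists>k\<in>int_vecs. norm (x - y - k) < \<delta>"
proof -
  define D where "D = {\<theta> :: real^'m. (\<forall>i. \<bar>\<theta> $ i\<bar> \<le> 1 / 2) \<and> norm \<theta> \<ge> \<delta>}"
  have "D = cbox (- (\<chi> i. 1/2)) (\<chi> i. 1/2) \<inter> {\<theta>. norm \<theta> \<ge> \<delta>}"
    by (simp add: D_def set_eq_iff mem_half_cube)
  then have "compact D"
    by (simp add: compact_Int_closed closed_Collect_le continuous_on_norm)
  have cont: "continuous_on D (\<lambda>\<theta>. norm (rho \<theta> - 1))"
    by (intro continuous_intros)
  have "\<exists>\<eta>>0. \<forall>\<theta>\<in>D. norm (rho \<theta> - 1) \<ge> \<eta>"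
  proof (cases "D = {}")
    case True
    then show ?thesis by (auto intro: exI[of _ 1])
  next
    case False
    then obtain \<theta>0 where \<theta>0: "\<theta>0 \<in> D" "\<And>\<theta>. \<theta> \<in> D \<Longrightarrow> norm (rho \<theta>0 - 1) \<le> norm (rho \<theta> - 1)"
      using continuous_attains_inf[OF \<open>compact D\<close> False cont] by blast
    have "rho \<theta>0 \<noteq> 1"
    proof
      assume "rho \<theta>0 = 1"
      also have "1 = rho (0 :: real^'m)" by (simp add: rho_def vec_eq_iff)
      finally have "\<theta>0 \<in> int_vecs" by (simp add: rho_eq_iff)
      moreover have "\<bar>\<theta>0 $ i\<bar> < 1" for i
      proof -
        have "\<bar>\<theta>0 $ i\<bar> \<le> 1 / 2" using \<theta>0(1) unfolding D_def by blast
        then show ?thesis by linarith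
      qed
      ultimately have "\<theta>0 $ i = 0" for i
        by (metis (mono_tags, lifting) Ints_nonzero_abs_less1 int_vecs_def mem_Collect_eq)
      then have "\<theta>0 = 0" by (simp add: vec_eq_iff)
      then show False using \<theta>0(1) assms by (simp add: D_def)
    qed
    then show ?thesis using \<theta>0(2) by (intro exI[of _ "norm (rho \<theta>0 - 1)"]) auto
  qed
  then obtain \<eta> where \<eta>: "\<eta> > 0" "\<And>\<theta>. \<theta> \<in> D \<Longrightarrow> norm (rho \<theta> - 1) \<ge> \<eta>" by blast
  show thesis
  proof (rule that[OF \<eta>(1)])
    fix x y :: "real^'m"
    assume less: "norm (rho x - rho y) < \<eta>"
    let ?k = "nearest_int_vec (x - y)"
    have "rho (x - y - ?k) = rho (x - y)"
      by (simp add: rho_eq_iff int_vecs_minus nearest_int_vec_in_int_vecs)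
    then have "norm (rho (x - y - ?k) - 1) < \<eta>" using less by (simp add: norm_rho_diff[of x y])
    then have "x - y - ?k \<notin> D" using \<eta>(2) by fastforce
    then have "norm (x - y - ?k) < \<delta>"
      using nearest_int_vec_component[of "x - y"] unfolding D_def by fastforce
    then show "\<exists>k\<in>int_vecs. norm (x - y - k) < \<delta>" using nearest_int_vec_in_int_vecs by blast
  qed
qed

text \<open>Closeness on the torus lifts to closeness modulo integer vectors, so the closure may be
  formed upstairs. This provides the preimage of \<open>K\<close> with the dense set of points
  \<open>M *v l + k\<close>.\<close>

lemma rho_vimage_closure:
  "rho -` closure (rho ` A) = closure {a + k | a k. a \<in> A \<and> k \<in> int_vecs}"
proof
  have "closed (rho -` closure (rho ` A))"
    by (intro closed_vimage closed_closure continuous_on_rho continuous_on_id)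
  moreover have "{a + k | a k. a \<in> A \<and> k \<in> int_vecs} \<subseteq> rho -` closure (rho ` A)"
    using closure_subset by (fastforce simp: rho_add_int_vec)
  ultimately show "closure {a + k | a k. a \<in> A \<and> k \<in> int_vecs} \<subseteq> rho -` closure (rho ` A)"
    by (rule closure_minimal[rotated])
  show "rho -` closure (rho ` A) \<subseteq> closure {a + k | a k. a \<in> A \<and> k \<in> int_vecs}"
  proof
    fix x assume "x \<in> rho -` closure (rho ` A)"
    then have x: "rho x \<in> closure (rho ` A)" by simp
    show "x \<in> closure {a + k | a k. a \<in> A \<and> k \<in> int_vecs}"
      unfolding closure_approachable
    proof (intro allI impI)
      fix \<delta> :: real assume "\<delta> > 0"
      then obtain \<eta> where \<eta>: "\<eta> > 0"
        "\<And>x y :: real^'a. norm (rho x - rho y) < \<eta> \<Longrightarrow> \<exists>k\<in>int_vecs. norm (x - y - k) < \<delta>"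
        using rho_close_imp_close_mod_int by metis
      obtain a where a: "a \<in> A" "norm (rho x - rho a) < \<eta>"
        using x \<eta>(1) unfolding closure_approachable by (metis dist_commute dist_norm image_iff)
      then obtain k where "k \<in> int_vecs" "norm (x - a - k) < \<delta>" using \<eta>(2) by blast
      then show "\<exists>y\<in>{a + k | a k. a \<in> A \<and> k \<in> int_vecs}. dist y x < \<delta>"
        using a by (intro bexI[of _ "a + k"]) (auto simp: dist_norm norm_minus_commute diff_diff_eq)
    qed
  qed
qed

lemma dense_orbit:
  fixes M :: "real^'n^'m"
  assumes "toral_compactification (\<lambda>x. rho (M *v x))" "\<delta> > 0"
  obtains t k where "k \<in> int_vecs" "norm (h - (M *v t + k)) < \<delta>"
proof -
  have "rho h \<in> torus" by (simp add: torus_def rho_def)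
  also have "torus = closure (rho ` range ((*v) M))"
    using assms(1) by (simp add: toral_compactification_def image_image)
  finally have "h \<in> closure {a + k | a k. a \<in> range ((*v) M) \<and> k \<in> int_vecs}"
    unfolding rho_vimage_closure[symmetric] by simp
  then obtain y where "y \<in> {a + k | a k. a \<in> range ((*v) M) \<and> k \<in> int_vecs}" "dist y h < \<delta>"
    using assms(2) unfolding closure_approachable by blast
  then show thesis using that by (auto simp: dist_norm norm_minus_commute)
qed

lemma norm_orthonormal_columns:
  fixes M :: "real^'n^'m"
  assumes "transpose M ** M = mat 1"
  shows "norm (M *v x) = norm x"
proof -
  have "(M *v x) v* M = x"
    using assms by (metis matrix_vector_mul_assoc matrix_vector_mul_lid transpose_matrix_vector)
  then have "(M *v x) \<bullet> (M *v x) = x \<bullet> x"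
    by (metis dot_lmul_matrix)
  then show ?thesis by (simp add: norm_eq_sqrt_inner)
qed

text \<open>A closed set \<open>H\<close> which meets the translates of the range of \<open>M\<close> in uniformly discrete sets, which
  in turn vary uniformly continuously with the translate.\<close>

locale uniform_transversal =
  fixes M :: "real^'n^'m" and H :: "(real^'m) set" and r :: real
  assumes orthonormal: "transpose M ** M = mat 1"
    and closed_H: "closed H"
    and r_pos: "r > 0"
    and separated: "\<And>h x. h \<in> H \<Longrightarrow> h + M *v x \<in> H \<Longrightarrow> norm x < r \<Longrightarrow> x = 0"
    and movable: "\<And>\<epsilon>. \<epsilon> > 0 \<Longrightarrow> \<exists>\<delta>>0. \<forall>h\<in>H. \<forall>w. norm w < \<delta> \<longrightarrow> (\<exists>x. norm x \<le> \<epsilon> \<and> h + w + M *v x \<in> H)"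

text \<open>For the dense points \<open>M *v l + k\<close> both properties come, up to an error,
  from almost periods \<open>t\<close>, those with \<open>M *v t\<close> near the lattice.
  Separation survives in the closure since a nonzero \<open>x\<close> leaves room for the error; for
  movability a compactness argument removes the error.\<close>

lemma uniform_transversal_of_point_set:
  fixes \<Lambda> :: "(real^'n) set" and M :: "real^'n^'m"
  assumes "delone \<Lambda>" "bohr_ap_set \<Lambda>" "associated M \<Lambda>"
    and comp: "toral_compactification (\<lambda>x. rho (M *v x))"
    and M: "transpose M ** M = mat 1"
  obtains r where "uniform_transversal M (rho -` closure ((\<lambda>x. rho (M *v x)) ` \<Lambda>)) r"
proof -
  define D where "D = {M *v l + k | l k. l \<in> \<Lambda> \<and> k \<in> int_vecs}"
  have "(\<lambda>x. rho (M *v x)) ` \<Lambda> = rho ` (*v) M ` \<Lambda>" by (simp add: image_image)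
  moreover have "D = {a + k | a k. a \<in> (*v) M ` \<Lambda> \<and> k \<in> int_vecs}" by (auto simp: D_def)
  ultimately have H: "rho -` closure ((\<lambda>x. rho (M *v x)) ` \<Lambda>) = closure D"
    by (simp add: rho_vimage_closure)
  have approx: "\<exists>l\<in>\<Lambda>. \<exists>k\<in>int_vecs. norm (h - (M *v l + k)) < \<delta>" if h: "h \<in> closure D" "\<delta> > 0" for h \<delta>
  proof -
    obtain y where "y \<in> D" "dist y h < \<delta>"
      using h unfolding closure_approachable by blast
    then show ?thesis unfolding D_def by (auto simp: dist_norm norm_minus_commute)
  qed
  obtain r where r: "r > 0" and sep: "\<And>a b. a \<in> \<Lambda> \<Longrightarrow> b \<in> \<Lambda> \<Longrightarrow> norm (a - b) < r \<Longrightarrow> a = b"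
    using delone_separated[OF assms(1)] by metis
  have "uniform_transversal M (closure D) r"
  proof (unfold_locales; (intro M closed_closure r)?)
    fix h x assume h: "h \<in> closure D" "h + M *v x \<in> closure D" and x: "norm x < r"
    show "x = 0"
    proof (rule ccontr)
      assume "x \<noteq> 0"
      \<comment> \<open>The bound \<open>r - norm x\<close> forces \<open>l'\<close> and
        \<open>l''\<close> to coincide; then \<open>norm x < \<epsilon>\<close>, against the other
        bound.\<close>
      define \<epsilon> where "\<epsilon> = min (norm x) (r - norm x)"
      have \<epsilon>: "\<epsilon> > 0" using \<open>x \<noteq> 0\<close> x by (simp add: \<epsilon>_def)
      obtain \<delta> where \<delta>: "\<delta> > 0"
        "\<And>t k l. k \<in> int_vecs \<Longrightarrow> norm (M *v t - k) < \<delta> \<Longrightarrow> l \<in> \<Lambda> \<Longrightarrow> \<exists>l'\<in>\<Lambda>. norm (l + t - l') < \<epsilon>"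
        using almost_period_of_point_set[OF assms(1-3) \<epsilon>] by metis
      obtain l k where l: "l \<in> \<Lambda>" "k \<in> int_vecs" "norm (h - (M *v l + k)) < \<delta> / 2"
        using approx[OF h(1), of "\<delta> / 2"] \<delta>(1) by auto
      obtain l' k' where l': "l' \<in> \<Lambda>" "k' \<in> int_vecs" "norm (h + M *v x - (M *v l' + k')) < \<delta> / 2"
        using approx[OF h(2), of "\<delta> / 2"] \<delta>(1) by auto
      have "M *v (l' - l - x) - (k - k') = (h - (M *v l + k)) - (h + M *v x - (M *v l' + k'))"
        by (simp add: matrix_vector_mult_diff_distrib)
      also have "norm \<dots> < \<delta>"
        using norm_triangle_ineq4[of "h - (M *v l + k)" "h + M *v x - (M *v l' + k')"] l(3) l'(3) by linarith
      finally obtain l'' where l'': "l'' \<in> \<Lambda>" "norm (l + (l' - l - x) - l'') < \<epsilon>"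
        using \<delta>(2)[of "k - k'" "l' - l - x" l] l l' int_vecs_diff by blast
      then have 1: "norm ((l' - l'') - x) < \<epsilon>" by (simp add: algebra_simps)
      then have "norm (l' - l'') < r"
        using norm_triangle_ineq2[of "l' - l''" x] by (simp add: \<epsilon>_def)
      then have "l' = l''" using sep l'(1) l''(1) by blast
      then show False using 1 by (simp add: \<epsilon>_def)
    qed
  next
    fix \<epsilon> :: real assume \<epsilon>: "\<epsilon> > 0"
    obtain \<delta> where \<delta>: "\<delta> > 0"
      "\<And>t k l. k \<in> int_vecs \<Longrightarrow> norm (M *v t - k) < \<delta> \<Longrightarrow> l \<in> \<Lambda> \<Longrightarrow> \<exists>l'\<in>\<Lambda>. norm (l + t - l') < \<epsilon>"
      using almost_period_of_point_set[OF assms(1-3) \<epsilon>] by metis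
    have "\<exists>x. norm x \<le> \<epsilon> \<and> h + w + M *v x \<in> closure D" if h: "h \<in> closure D" and w: "norm w < \<delta>" for h w
    proof -
      \<comment> \<open>Approximation only shows that this compact disc has distance 0 from
        \<open>closure D\<close>; compactness turns that into a common point. Hence the non-strict
        \<open>norm x \<le> \<epsilon>\<close> in the locale.\<close>
      define A where "A = (\<lambda>x. h + w + M *v x) ` cball 0 \<epsilon>"
      have "compact A" unfolding A_def
        by (intro compact_continuous_image continuous_intros compact_cball)
      have small: "setdist A (closure D) \<le> e" if "e > 0" for e
      proof -
        \<comment> \<open>\<open>e / 2\<close> shares the error between two approximations;
          \<open>\<delta> - norm w\<close> keeps \<open>M *v t\<close> within
          \<open>\<delta>\<close> of the lattice.\<close>
        define e' where "e' = min (e / 2) (\<delta> - norm w)"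
        have e': "e' > 0" using that w by (simp add: e'_def)
        obtain l k where l: "l \<in> \<Lambda>" "k \<in> int_vecs" "norm (h - (M *v l + k)) < e'"
          using approx[OF h e'] by blast
        obtain t k' where t: "k' \<in> int_vecs" "norm (w - (M *v t + k')) < e'"
          using dense_orbit[OF comp e'] by blast
        have "norm (M *v t - - k') \<le> norm w + norm (w - (M *v t + k'))"
          using norm_triangle_ineq4[of w "w - (M *v t + k')"] by simp
        also have "\<dots> < \<delta>" using t(2) by (simp add: e'_def)
        finally obtain l' where l': "l' \<in> \<Lambda>" "norm (l + t - l') < \<epsilon>"
          using \<delta>(2)[OF int_vecs_minus[OF t(1)] _ l(1)] by blast
        let ?x = "l' - l - t"
        have "norm ?x \<le> \<epsilon>" using l'(2) by (simp add: norm_minus_commute algebra_simps)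
        then have 1: "h + w + M *v ?x \<in> A" by (simp add: A_def)
        have "M *v l' + (k + k') \<in> D" unfolding D_def using l'(1) l(2) t(1) int_vecs_add by blast
        then have 2: "M *v l' + (k + k') \<in> closure D" using closure_subset by blast
        have "setdist A (closure D) \<le> dist (h + w + M *v ?x) (M *v l' + (k + k'))"
          by (rule setdist_le_dist[OF 1 2])
        also have "\<dots> = norm ((h - (M *v l + k)) + (w - (M *v t + k')))"
          by (simp add: dist_norm matrix_vector_mult_diff_distrib algebra_simps)
        also have "\<dots> \<le> norm (h - (M *v l + k)) + norm (w - (M *v t + k'))" by (rule norm_triangle_ineq)
        also have "\<dots> \<le> e" using l(3) t(2) by (simp add: e'_def)
        finally show ?thesis .
      qed
      have "setdist A (closure D) \<le> 0"
        by (rule field_le_epsilon) (simp only: add_0 small)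
      then have "setdist A (closure D) = 0"
        by (rule antisym[OF _ setdist_pos_le])
      then have "A \<inter> closure D \<noteq> {}"
        using h \<epsilon> setdist_eq_0_compact_closed[OF \<open>compact A\<close> closed_closure, of D] by (auto simp: A_def)
      then show ?thesis by (auto simp: A_def)
    qed
    then show "\<exists>\<delta>>0. \<forall>h\<in>closure D. \<forall>w. norm w < \<delta> \<longrightarrow> (\<exists>x. norm x \<le> \<epsilon> \<and> h + w + M *v x \<in> closure D)"
      using \<delta>(1) by blast
  qed
  then show thesis using that H by simp
qed

section \<open>The orthogonal projection is a covering map\<close>

context uniform_transversal
begin

definition W :: "(real^'m) set"
  where "W = {w. w v* M = 0}"

definition P :: "real^'m \<Rightarrow> real^'m"
  where "P h = h - M *v (h v* M)"

lemma mult_left_inverse [simp]: "(M *v x) v* M = x"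
  using orthonormal by (metis matrix_vector_mul_assoc matrix_vector_mul_lid transpose_matrix_vector)

lemma norm_mult_M [simp]: "norm (M *v x) = norm x"
  by (rule norm_orthonormal_columns[OF orthonormal])

lemma vmult_add: "(x + y) v* M = x v* M + y v* M"
  and vmult_diff: "(x - y) v* M = x v* M - y v* M"
  and vmult_scaleR: "(c *\<^sub>R x) v* M = c *\<^sub>R (x v* M)"
  unfolding transpose_matrix_vector[symmetric]
  by (simp_all add: matrix_vector_right_distrib matrix_vector_mult_diff_distrib matrix_vector_mult_scaleR
      del: transpose_matrix_vector)

lemma continuous_on_mult_M [continuous_intros]:
  assumes "continuous_on A f"
  shows "continuous_on A (\<lambda>x. M *v f x)"
  using continuous_on_compose2[OF matrix_vector_mult_linear_continuous_on[of UNIV M] assms] by simp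

lemma continuous_on_vmult [continuous_intros]:
  assumes "continuous_on A f"
  shows "continuous_on A (\<lambda>x. f x v* M)"
  using continuous_on_compose2[OF matrix_vector_mult_linear_continuous_on[of UNIV "transpose M"] assms] by simp

lemma continuous_on_P: "continuous_on A P"
  unfolding P_def[abs_def] by (intro continuous_intros)

lemma P_add: "P (x + y) = P x + P y"
  and P_diff: "P (x - y) = P x - P y"
  and P_mult_M: "P (M *v z) = 0"
  and P_in_W: "P x \<in> W"
  by (simp_all add: P_def W_def vmult_add vmult_diff matrix_vector_right_distrib
      matrix_vector_mult_diff_distrib)

lemma P_ident: "w \<in> W \<Longrightarrow> P w = w"
  by (simp add: P_def W_def)

lemma subspace_W: "subspace W"
  by (auto simp: subspace_def W_def vmult_add vmult_scaleR)

lemma fibre_unique: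
  assumes "h \<in> H" "h' \<in> H" "P h = P h'" "norm ((h' - h) v* M) < r"
  shows "h = h'"
proof -
  have "h' - h = (P h' + M *v (h' v* M)) - (P h + M *v (h v* M))" by (simp add: P_def)
  also have "\<dots> = M *v ((h' - h) v* M)"
    by (simp add: assms(3) vmult_diff matrix_vector_mult_diff_distrib)
  finally have eq: "h' = h + M *v ((h' - h) v* M)" by (metis add.commute diff_add_cancel)
  then have "(h' - h) v* M = 0"
    using separated[OF assms(1), of "(h' - h) v* M"] assms(2,4) by simp
  then show ?thesis using eq by simp
qed

text \<open>Only small displacements can be followed at once, so \<open>v\<close> is divided into
  equal short steps and the corrections add up.\<close>

lemma translate_meets:
  assumes h: "h \<in> H"
  shows "\<exists>x. h + v + M *v x \<in> H"
proof -
  obtain \<delta> where \<delta>: "\<delta> > 0" "\<And>h w. h \<in> H \<Longrightarrow> norm w < \<delta> \<Longrightarrow> \<exists>x. h + w + M *v x \<in> H"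
    using movable[of 1] by (meson zero_less_one)
  obtain N :: nat where N: "norm v / \<delta> < real N"
    using reals_Archimedean2 by blast
  then have Npos: "real N > 0" using \<delta>(1) by (smt (verit) divide_nonneg_pos norm_ge_zero)
  define u where "u = (1 / real N) *\<^sub>R v"
  have u: "norm u < \<delta>" using N Npos \<delta>(1) by (simp add: u_def field_simps)
  have "\<exists>x. h + real j *\<^sub>R u + M *v x \<in> H" for j
  proof (induction j)
    case 0
    show ?case using h by (intro exI[of _ 0]) simp
  next
    case (Suc j)
    then obtain x where "h + real j *\<^sub>R u + M *v x \<in> H" by blast
    then obtain y where "h + real j *\<^sub>R u + M *v x + u + M *v y \<in> H" using \<delta>(2) u by blast
    then show ?case
      by (intro exI[of _ "x + y"]) (simp add: matrix_vector_right_distrib algebra_simps)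
  qed
  from this[of N] show ?thesis using Npos by (simp add: u_def)
qed

lemma image_P:
  assumes "H \<noteq> {}"
  shows "P ` H = W"
proof
  show "P ` H \<subseteq> W" using P_in_W by blast
  show "W \<subseteq> P ` H"
  proof
    fix w assume w: "w \<in> W"
    obtain h where h: "h \<in> H" using assms by blast
    obtain x where x: "h + (w - P h) + M *v x \<in> H" using translate_meets[OF h] by blast
    have "P (h + (w - P h) + M *v x) = w"
      using w P_in_W[of h] by (simp add: P_add P_diff P_mult_M P_ident)
    then show "w \<in> P ` H" using x by force
  qed
qed

text \<open>The sheet \<open>u h\<close> consists of the points over a small disc whose coordinate
  along the range of \<open>M\<close> is within \<open>r / 2\<close> of that of \<open>h\<close>.
  Distinct points of a fibre are at least \<open>r\<close> apart, so different sheets are disjoint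
  and each meets a fibre at most once. Moving with a correction of at most \<open>r / 4\<close>
  shows that each sheet meets every fibre over the disc and that the sheets exhaust the
  preimage.\<close>

lemma covering_space_P:
  assumes "H \<noteq> {}"
  shows "covering_space H P W"
proof (rule covering_spaceI[OF continuous_on_P image_P[OF assms]])
  fix w0 assume w0: "w0 \<in> W"
  obtain \<delta> where \<delta>: "\<delta> > 0"
    "\<And>h w. h \<in> H \<Longrightarrow> norm w < \<delta> \<Longrightarrow> \<exists>x. norm x \<le> r / 4 \<and> h + w + M *v x \<in> H"
    using movable[of "r / 4"] r_pos by auto
  define T where "T = W \<inter> ball w0 \<delta>"
  define u where "u h = {h' \<in> H. P h' \<in> T \<and> norm ((h' - h) v* M) < r / 2}" for h
  have open_ball_T: "openin (top_of_set W) T" unfolding T_def by (simp add: openin_open_Int)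
  have "\<Union> (u ` (H \<inter> P -` {w0})) = H \<inter> P -` T"
  proof (intro equalityI subsetI)
    fix h' assume h': "h' \<in> H \<inter> P -` T"
    then have "norm (w0 - P h') < \<delta>" by (simp add: T_def dist_norm)
    then obtain x where x: "norm x \<le> r / 4" "h' + (w0 - P h') + M *v x \<in> H" using \<delta>(2) h' by blast
    let ?h = "h' + (w0 - P h') + M *v x"
    have "P ?h = w0" using w0 by (simp add: P_add P_diff P_mult_M P_ident P_in_W)
    moreover have "(w0 - P h') v* M = 0" using w0 P_in_W[of h'] by (simp add: W_def vmult_diff)
    then have "(h' - ?h) v* M = - x" by (simp add: vmult_diff vmult_add)
    then have "norm ((h' - ?h) v* M) < r / 2" using x(1) r_pos by simp
    then have "h' \<in> u ?h" using h' unfolding u_def by blast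
    ultimately show "h' \<in> \<Union> (u ` (H \<inter> P -` {w0}))" using x(2) by blast
  qed (auto simp: u_def)
  moreover have "openin (top_of_set H) (u h)" for h
  proof -
    have "u h = (H \<inter> P -` T) \<inter> {h' \<in> H. norm ((h' - h) v* M) < r / 2}" by (auto simp: u_def)
    moreover have "openin (top_of_set H) (H \<inter> P -` T)"
      using continuous_on_P P_in_W open_ball_T by (intro continuous_openin_preimage[of H P W]) auto
    moreover have "openin (top_of_set H) (H \<inter> (\<lambda>h'. norm ((h' - h) v* M)) -` {..<r / 2})"
      by (intro continuous_openin_preimage_gen continuous_intros)
    then have "openin (top_of_set H) {h' \<in> H. norm ((h' - h) v* M) < r / 2}"
      by (simp add: vimage_def Int_def)
    ultimately show ?thesis by (simp add: openin_Int)
  qed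
  moreover have "disjnt (u h) (u k)" if "h \<in> H" "P h = w0" "k \<in> H" "P k = w0" "u h \<noteq> u k" for h k
  proof (rule ccontr)
    assume "\<not> disjnt (u h) (u k)"
    then obtain h' where h': "norm ((h' - h) v* M) < r / 2" "norm ((h' - k) v* M) < r / 2"
      by (auto simp: disjnt_def u_def)
    have "(k - h) v* M = (h' - h) v* M - (h' - k) v* M" by (simp add: vmult_diff)
    then have "norm ((k - h) v* M) < r"
      using norm_triangle_ineq4[of "(h' - h) v* M" "(h' - k) v* M"] h' by simp
    then have "h = k" using fibre_unique that by simp
    then show False using that by simp
  qed
  moreover have "\<exists>q. homeomorphism (u h) T P q" if h: "h \<in> H" "P h = w0" for h
  proof -
    have ex: "\<exists>h'\<in>u h. P h' = w" if w: "w \<in> T" for w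
    proof -
      have "norm (w - w0) < \<delta>" using w by (simp add: T_def dist_norm norm_minus_commute)
      then obtain x where x: "norm x \<le> r / 4" "h + (w - w0) + M *v x \<in> H" using \<delta>(2) h by blast
      let ?h = "h + (w - w0) + M *v x"
      have "P ?h = w" using w w0 h by (simp add: P_add P_diff P_mult_M P_ident T_def)
      moreover have "(w - w0) v* M = 0" using w w0 by (simp add: W_def T_def vmult_diff)
      then have "(?h - h) v* M = x" by (simp add: vmult_diff vmult_add)
      then have "norm ((?h - h) v* M) < r / 2" using x(1) r_pos by simp
      ultimately show ?thesis using x(2) w by (auto simp: u_def)
    qed
    have uniq: "a = b" if "a \<in> u h" "b \<in> u h" "P a = P b" for a b
    proof (rule fibre_unique)
      have "(b - a) v* M = (b - h) v* M - (a - h) v* M" by (simp add: vmult_diff)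
      then show "norm ((b - a) v* M) < r"
        using norm_triangle_ineq4[of "(b - h) v* M" "(a - h) v* M"] that by (simp add: u_def)
    qed (use that in \<open>auto simp: u_def\<close>)
    obtain q where q: "\<And>w. w \<in> T \<Longrightarrow> q w \<in> u h \<and> P (q w) = w" using ex by metis
    \<comment> \<open>Moving \<open>q w1\<close> slightly gives a point over \<open>w2\<close> that
      is still on the sheet, and uniqueness identifies it with \<open>q w2\<close>.\<close>
    have "continuous_on T q"
      unfolding continuous_on_iff
    proof (intro ballI allI impI)
      fix w1 and e :: real assume w1: "w1 \<in> T" and e: "e > 0"
      let ?c = "norm ((q w1 - h) v* M)"
      define \<epsilon> where "\<epsilon> = min (e / 2) ((r / 2 - ?c) / 2)"
      have c: "?c < r / 2" using q[OF w1] by (simp add: u_def)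
      then have \<epsilon>: "\<epsilon> > 0" using e by (simp add: \<epsilon>_def)
      obtain \<eta> where \<eta>: "\<eta> > 0"
        "\<And>h w. h \<in> H \<Longrightarrow> norm w < \<eta> \<Longrightarrow> \<exists>x. norm x \<le> \<epsilon> \<and> h + w + M *v x \<in> H"
        using movable[OF \<epsilon>] by auto
      show "\<exists>d>0. \<forall>w2\<in>T. dist w2 w1 < d \<longrightarrow> dist (q w2) (q w1) < e"
      proof (intro exI[of _ "min \<eta> (e / 2)"] conjI ballI impI)
        show "min \<eta> (e / 2) > 0" using \<eta> e by simp
        fix w2 assume w2: "w2 \<in> T" "dist w2 w1 < min \<eta> (e / 2)"
        have q1: "q w1 \<in> H" using q[OF w1] by (simp add: u_def)
        obtain x where x: "norm x \<le> \<epsilon>" "q w1 + (w2 - w1) + M *v x \<in> H"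
          using \<eta>(2)[OF q1, of "w2 - w1"] w2 by (auto simp: dist_norm)
        let ?h = "q w1 + (w2 - w1) + M *v x"
        have Ph: "P ?h = w2" using w1 w2 q[OF w1] by (simp add: P_add P_diff P_mult_M P_ident T_def)
        have "(w2 - w1) v* M = 0" using w1 w2 by (simp add: W_def T_def vmult_diff)
        then have "(?h - h) v* M = (q w1 - h) v* M + x" by (simp add: vmult_diff vmult_add)
        moreover have "?c + \<epsilon> < r / 2" using c by (simp add: \<epsilon>_def min_def) (simp add: field_simps)
        ultimately have "norm ((?h - h) v* M) < r / 2"
          using norm_triangle_ineq[of "(q w1 - h) v* M" x] x(1) by simp
        then have "?h \<in> u h" using x(2) Ph w2(1) by (simp add: u_def)
        then have "q w2 = ?h" using uniq q[OF w2(1)] Ph by simp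
        then have "q w2 - q w1 = (w2 - w1) + M *v x" by simp
        then have "dist (q w2) (q w1) = norm ((w2 - w1) + M *v x)" by (simp only: dist_norm)
        also have "\<dots> \<le> norm (w2 - w1) + norm x"
          using norm_triangle_ineq[of "w2 - w1" "M *v x"] by simp
        also have "\<dots> < e / 2 + e / 2"
          by (rule add_less_le_mono) (use w2(2) x(1) in \<open>auto simp: dist_norm \<epsilon>_def\<close>)
        finally show "dist (q w2) (q w1) < e" by simp
      qed
    qed
    have "homeomorphism (u h) T P q"
    proof (rule homeomorphismI)
      fix h' assume h': "h' \<in> u h"
      then have "P h' \<in> T" by (simp add: u_def)
      then show "q (P h') = h'" using q uniq h' by blast
    qed (use q \<open>continuous_on T q\<close> continuous_on_P in \<open>auto simp: u_def\<close>)
    then show ?thesis by blast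
  qed
  ultimately show "\<exists>T. w0 \<in> T \<and> openin (top_of_set W) T \<and> (\<exists>v. \<Union>v = H \<inter> P -` T \<and>
      (\<forall>u\<in>v. openin (top_of_set H) u) \<and> pairwise disjnt v \<and> (\<forall>u\<in>v. \<exists>q. homeomorphism u T P q))"
    using w0 \<delta>(1) open_ball_T
    by (intro exI[of _ T] conjI exI[of _ "u ` (H \<inter> P -` {w0})"])
       (auto simp: T_def pairwise_def)
qed

lemma convex_W: "convex W"
  by (rule subspace_imp_convex[OF subspace_W])

text \<open>Lift the identity of the simply connected \<open>W\<close> through a point of
  \<open>C\<close>. The lifted copy is connected, hence inside \<open>C\<close>; uniqueness of lifts
  on the connected set \<open>C\<close> shows that it is all of \<open>C\<close>.\<close>

lemma component_section:
  assumes C: "C \<in> components H"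
  obtains s where "continuous_on W s" "\<And>w. w \<in> W \<Longrightarrow> s w \<in> C \<and> P (s w) = w" "\<And>h. h \<in> C \<Longrightarrow> s (P h) = h"
proof -
  obtain h0 where h0: "h0 \<in> C" using in_components_nonempty[OF C] by blast
  have CH: "C \<subseteq> H" by (rule in_components_subset[OF C])
  then have cov: "covering_space H P W" using h0 covering_space_P by blast
  obtain s where s: "continuous_on W s" "s \<in> W \<rightarrow> H" "s (P h0) = h0" "\<And>w. w \<in> W \<Longrightarrow> P (s w) = w"
    by (rule covering_space_lift_strong[OF cov _ P_in_W[of h0] convex_imp_simply_connected[OF convex_W]
          convex_imp_locally_path_connected[OF convex_W] continuous_on_id, of h0])
       (use h0 CH P_in_W in auto)
  have "connected (s ` W)"
    by (rule connected_continuous_image[OF s(1) convex_connected[OF convex_W]])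
  moreover have "h0 \<in> s ` W" using s(3) P_in_W by (metis image_eqI)
  ultimately have sub: "s ` W \<subseteq> C"
    using s(2) h0 by (intro components_maximal[OF C]) auto
  have sP: "(s \<circ> P) h = id h" if "h \<in> C" for h
  proof (rule covering_space_lift_unique[OF cov, where a = h0 and T = C and f = P and ?g1.0 = "s \<circ> P" and ?g2.0 = id and x = h])
    show "connected C" by (rule in_components_connected[OF C])
    show "continuous_on C (s \<circ> P)"
      by (rule continuous_on_compose[OF continuous_on_P]) (use s(1) continuous_on_subset P_in_W in blast)
  qed (use s h0 CH P_in_W that continuous_on_P in auto)
  show thesis
    by (rule that[of s]) (use s sub sP in auto)
qed

lemma locally_connected_H: "locally connected H"
proof (cases "H = {}")
  case False
  then show ?thesis
    using covering_space_locally_connected_eq[OF covering_space_P[OF False]]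
      convex_imp_locally_connected[OF convex_W] by blast
qed (simp add: locally_empty)

text \<open>\<open>H\<close> inherits local connectedness from \<open>W\<close>, so components are
  open in \<open>H\<close>, and the complement of a union of components is again such a
  union.\<close>

lemma closed_Union_components:
  assumes "\<C> \<subseteq> components H"
  shows "closed (\<Union> \<C>)"
proof -
  have "openin (top_of_set H) (\<Union> (components H - \<C>))"
    by (intro openin_Union) (auto intro: openin_components_locally_connected[OF locally_connected_H])
  moreover have "\<Union> (components H - \<C>) = H - \<Union> \<C>"
  proof -
    have "A \<inter> B = {}" if "A \<in> \<C>" "B \<in> components H - \<C>" for A B
      using pairwiseD[OF pairwise_disjoint_components[of H], of A B] that assms by blast
    then have "\<Union> (components H - \<C>) = \<Union> (components H) - \<Union> \<C>"
      by blast
    then show ?thesis by simp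
  qed
  moreover have "\<Union> \<C> \<subseteq> H"
    using Union_mono[OF assms] by simp
  ultimately have "closedin (top_of_set H) (\<Union> \<C>)"
    unfolding closedin_def by simp
  then show ?thesis using closed_H closedin_closed_trans by blast
qed

end

text \<open>By periodicity the part of \<open>F\<close> in one unit cube already has the full image,
  and that part is compact.\<close>

lemma closed_rho_image:
  fixes F :: "(real^'m) set"
  assumes "closed F" "\<And>x k. x \<in> F \<Longrightarrow> k \<in> int_vecs \<Longrightarrow> x + k \<in> F"
  shows "compact (rho ` F)"
proof -
  define Q where "Q = F \<inter> cbox (- (\<chi> i. 1/2)) (\<chi> i. 1/2)"
  have "rho ` F = rho ` Q"
  proof (intro equalityI subsetI)
    fix z assume "z \<in> rho ` F"
    then obtain x where x: "x \<in> F" "z = rho x" by blast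
    have "x - nearest_int_vec x \<in> cbox (- (\<chi> i. 1/2)) (\<chi> i. 1/2)"
      unfolding mem_half_cube using nearest_int_vec_component by blast
    moreover have "x + - nearest_int_vec x \<in> F"
      by (intro assms(2) x int_vecs_minus nearest_int_vec_in_int_vecs)
    moreover have "z = rho (x - nearest_int_vec x)"
      using x nearest_int_vec_in_int_vecs by (simp add: rho_eq_iff)
    ultimately show "z \<in> rho ` Q" by (auto simp: Q_def)
  qed (auto simp: Q_def)
  moreover have "compact Q" using assms(1) by (simp add: Q_def closed_Int_compact)
  ultimately show ?thesis
    by (simp add: compact_continuous_image continuous_on_rho continuous_on_id)
qed

lemma translate_component:
  assumes "C \<in> components H" "(\<lambda>h. h + k) ` H = H"
  shows "(\<lambda>h. h + k) ` C \<in> components (H :: (real^'m) set)"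
proof -
  have h: "homeomorphism H H (\<lambda>h. h + k) (\<lambda>h. h - k)"
  proof (rule homeomorphismI)
    have "(\<lambda>h. h - k) ` H = H"
      by (subst assms(2)[symmetric]) (simp add: image_image)
    then show "(\<lambda>h. h - k) ` H \<subseteq> H" by simp
  qed (use assms(2) in \<open>auto intro!: continuous_intros\<close>)
  obtain x where x: "x \<in> H" "C = connected_component_set H x"
    using assms(1) by (auto simp: components_def)
  have "(\<lambda>h. h + k) ` C = connected_component_set H (x + k)"
    unfolding x(2) by (rule connected_component_set_homeomorphism[OF h x(1), symmetric])
  then show ?thesis using x assms(2) by (auto simp: components_def)
qed

section \<open>Integer vectors and rational subspaces\<close>

lemma dirichlet_finite:
  fixes \<theta> :: "'b \<Rightarrow> real"
  assumes "finite B" "\<epsilon> > 0"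
  obtains q :: nat and p :: "'b \<Rightarrow> int"
    where "q > 0" "\<And>b. b \<in> B \<Longrightarrow> \<bar>real q * \<theta> b - of_int (p b)\<bar> < \<epsilon>"
proof -
  obtain f where f: "bij_betw f {0..<card B} B"
    using ex_bij_betw_nat_finite[OF assms(1)] by blast
  obtain N where N: "N > 0" "1 / real N < \<epsilon>"
    using reals_Archimedean[OF assms(2)] by (metis inverse_eq_divide zero_less_Suc)
  obtain q :: int and p where q: "0 < q"
    "\<And>i. i < card B \<Longrightarrow> \<bar>of_int q * (\<theta> \<circ> f) i - of_int (p i)\<bar> < 1 / real N"
    using Dirichlet_approx_simult[OF N(1), of "card B" "\<theta> \<circ> f"] by metis
  show thesis
  proof (rule that[of "nat q"])
    show "nat q > 0" using q(1) by simp
    fix b assume "b \<in> B"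
    then have "b \<in> f ` {0..<card B}"
      using f by (simp add: bij_betw_def)
    then obtain i where i: "i < card B" "f i = b" by auto
    then have "the_inv_into {0..<card B} f b = i"
      using f by (auto simp: bij_betw_def the_inv_into_f_f)
    then show "\<bar>real (nat q) * \<theta> b - of_int ((p \<circ> the_inv_into {0..<card B} f) b)\<bar> < \<epsilon>"
      using q(1) q(2)[OF i(1)] N(2) i(2) by simp
  qed
qed

lemma dirichlet_vec:
  fixes u :: "real^'m"
  assumes "\<epsilon> > 0"
  obtains q :: nat and k where "q > 0" "k \<in> int_vecs" "norm (real q *\<^sub>R u - k) < \<epsilon>"
proof -
  obtain q :: nat and p :: "'m \<Rightarrow> int" where q: "q > 0"
    "\<And>i. i \<in> UNIV \<Longrightarrow> \<bar>real q * u $ i - of_int (p i)\<bar> < \<epsilon> / real CARD('m)"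
    using dirichlet_finite[of "UNIV :: 'm set" "\<epsilon> / real CARD('m)" "\<lambda>i. u $ i"] assms by auto
  show thesis
  proof (rule that[OF q(1)])
    show "(\<chi> i. of_int (p i)) \<in> int_vecs" by (simp add: int_vecs_def)
    have "norm (real q *\<^sub>R u - (\<chi> i. of_int (p i))) \<le> (\<Sum>i\<in>UNIV. \<bar>(real q *\<^sub>R u - (\<chi> i. of_int (p i))) $ i\<bar>)"
      by (rule norm_le_l1_cart)
    also have "\<dots> < (\<Sum>i\<in>(UNIV :: 'm set). \<epsilon> / real CARD('m))"
      by (rule sum_strict_mono) (use q in auto)
    finally show "norm (real q *\<^sub>R u - (\<chi> i. of_int (p i))) < \<epsilon>" by simp
  qed
qed

lemma int_vec_norm_less_one: "k \<in> int_vecs \<Longrightarrow> norm k < 1 \<Longrightarrow> k = 0"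
proof -
  assume k: "k \<in> int_vecs" "norm k < 1"
  have "k $ i = 0" for i
    using k component_le_norm_cart[of k i] by (intro Ints_nonzero_abs_less1) (auto simp: int_vecs_def)
  then show "k = 0" by (simp add: vec_eq_iff)
qed

lemma finite_spanning_subset:
  fixes S :: "(real^'m) set"
  obtains B where "finite B" "B \<subseteq> S" "span B = span S"
proof -
  obtain B where "B \<subseteq> S" "independent B" "S \<subseteq> span B" "card B = dim S"
    using basis_exists by blast
  then show thesis
    using that independent_imp_finite by (metis span_mono span_span subset_antisym span_subspace subspace_span)
qed

text \<open>If \<open>u\<close> is orthogonal to \<open>S\<close> and \<open>k\<close> is an integer vector close to a multiple of \<open>u\<close>, then the
  integers \<open>k \<bullet> s\<close> are small, hence zero.\<close>

lemma orthogonal_complement_rational: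
  fixes S :: "(real^'m) set"
  assumes S: "S \<subseteq> int_vecs" and u: "\<And>s. s \<in> S \<Longrightarrow> u \<bullet> s = 0"
  shows "u \<in> span {k \<in> int_vecs. \<forall>s\<in>S. k \<bullet> s = 0}"
proof -
  let ?T = "{k \<in> int_vecs. \<forall>s\<in>S. k \<bullet> s = 0}"
  obtain B where B: "finite B" "B \<subseteq> S" "span B = span S" by (rule finite_spanning_subset)
  \<comment> \<open>\<open>1 / C\<close> is small enough for Cauchy-Schwarz to give
    \<open>\<bar>k \<bullet> s\<bar> < 1\<close> on the finite set \<open>B\<close>; since
    \<open>B\<close> spans, orthogonality extends to \<open>S\<close>.\<close>
  define C where "C = 1 + (\<Sum>s\<in>B. norm s)"
  have C: "C > 0" by (simp add: C_def add_pos_nonneg sum_nonneg)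
  have "u \<in> closure (span ?T)"
    unfolding closure_approachable
  proof (intro allI impI)
    fix e :: real assume e: "e > 0"
    define \<epsilon> where "\<epsilon> = min e (1 / C)"
    have \<epsilon>: "\<epsilon> > 0" using e C by (simp add: \<epsilon>_def)
    obtain q :: nat and k where k: "q > 0" "k \<in> int_vecs" "norm (real q *\<^sub>R u - k) < \<epsilon>"
      by (rule dirichlet_vec[OF \<epsilon>])
    have kB: "k \<bullet> s = 0" if s: "s \<in> B" for s
    proof -
      have "k \<bullet> s = - ((real q *\<^sub>R u - k) \<bullet> s)"
        using u s B(2) by (auto simp: inner_diff_left)
      then have "\<bar>k \<bullet> s\<bar> \<le> norm (real q *\<^sub>R u - k) * norm s"
        using Cauchy_Schwarz_ineq2[of "real q *\<^sub>R u - k" s] by simp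
      also have "\<dots> \<le> \<epsilon> * norm s"
        using k(3) by (intro mult_right_mono) auto
      also have "\<dots> \<le> (1 / C) * norm s" by (intro mult_right_mono) (auto simp: \<epsilon>_def)
      also have "\<dots> < 1"
      proof -
        have "norm s \<le> (\<Sum>s\<in>B. norm s)" using B(1) s by (intro member_le_sum) auto
        then have "norm s < C" by (simp add: C_def)
        then show ?thesis using C by (simp add: field_simps)
      qed
      finally have "\<bar>k \<bullet> s\<bar> < 1" .
      moreover have "k \<bullet> s \<in> \<int>" using inner_int_vecs k(2) s B(2) S by blast
      ultimately show ?thesis using Ints_nonzero_abs_less1 by blast
    qed
    have "k \<bullet> s = 0" if "s \<in> S" for s
    proof -
      have "s \<in> span B" using that B(3) by (simp add: span_base)
      then show ?thesis
        using orthogonal_to_span[of s B k] kB by (auto simp: orthogonal_def)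
    qed
    then have "(1 / real q) *\<^sub>R k \<in> span ?T" using k(2) by (intro span_scale span_base) blast
    moreover have "dist ((1 / real q) *\<^sub>R k) u < e"
    proof -
      have "dist ((1 / real q) *\<^sub>R k) u = norm ((1 / real q) *\<^sub>R (real q *\<^sub>R u - k))"
        using k(1) by (simp add: dist_norm norm_minus_commute scaleR_diff_right)
      also have "\<dots> = norm (real q *\<^sub>R u - k) / real q" by simp
      also have "\<dots> \<le> norm (real q *\<^sub>R u - k)"
        using k(1) by (simp add: divide_le_eq mult_ge1_I) (simp add: mult_le_cancel_left1)
      finally show ?thesis using k(3) by (simp add: \<epsilon>_def)
    qed
    ultimately show "\<exists>y\<in>span ?T. dist y u < e" by blast
  qed
  then show ?thesis using closed_subspace[OF subspace_span] by simp
qed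

lemma axis_in_int_vecs: "axis i 1 \<in> int_vecs"
  by (simp add: int_vecs_def axis_def)

lemma matrix_mult_int_vec:
  fixes E :: "real^'n^'m"
  shows "(\<And>i j. E $ i $ j \<in> \<int>) \<Longrightarrow> k \<in> int_vecs \<Longrightarrow> E *v k \<in> int_vecs"
  by (auto simp: int_vecs_def matrix_vector_mult_def intro!: Ints_sum Ints_mult)

text \<open>\<open>v v* E = 0\<close> says that \<open>v\<close> is orthogonal to the integer
  vectors orthogonal to \<open>S\<close>. These span the whole real orthogonal complement of
  \<open>S\<close>, so \<open>v\<close> has no component there.\<close>

lemma kernel_transpose_eq_span:
  fixes E :: "real^'n^'m" and S :: "(real^'m) set"
  assumes S: "S \<subseteq> int_vecs"
    and E: "(\<lambda>k. E *v k) ` int_vecs = {k \<in> int_vecs. \<forall>s\<in>S. k \<bullet> s = 0}"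
  shows "v v* E = 0 \<longleftrightarrow> v \<in> span S"
proof
  assume "v \<in> span S"
  show "v v* E = 0"
  proof -
    have "v \<bullet> (E *v axis i 1) = 0" for i
    proof -
      have "E *v axis i 1 \<in> {k \<in> int_vecs. \<forall>s\<in>S. k \<bullet> s = 0}"
        using E axis_in_int_vecs by blast
      then show ?thesis
        using orthogonal_to_span[OF \<open>v \<in> span S\<close>, of "E *v axis i 1"]
        by (simp add: orthogonal_def inner_commute)
    qed
    then show ?thesis
      by (simp add: vec_eq_iff inner_axis flip: dot_lmul_matrix)
  qed
next
  assume v: "v v* E = 0"
  let ?T = "{k \<in> int_vecs. \<forall>s\<in>S. k \<bullet> s = 0}"
  have vT: "v \<bullet> k = 0" if "k \<in> ?T" for k
  proof -
    have "k \<in> (\<lambda>k. E *v k) ` int_vecs" using that E by simp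
    then obtain z where "k = E *v z" by blast
    then show ?thesis using v by (simp flip: dot_lmul_matrix)
  qed
  obtain y z where yz: "y \<in> span S" "\<And>w. w \<in> span S \<Longrightarrow> orthogonal z w" "v = y + z"
    using orthogonal_subspace_decomp_exists[of S v] by metis
  have "z \<bullet> s = 0" if "s \<in> S" for s
    using yz(2)[OF span_base[OF that]] by (simp add: orthogonal_def)
  then have "z \<in> span ?T" by (rule orthogonal_complement_rational[OF S])
  then have "orthogonal v z"
    by (rule orthogonal_to_span) (use vT in \<open>auto simp: orthogonal_def\<close>)
  then have "z \<bullet> z = 0"
    using yz(2)[OF yz(1)] yz(3) by (simp add: orthogonal_def inner_add_left inner_add_right inner_commute)
  then show "v \<in> span S" using yz by simp
qed

lemma Ints_det:
  fixes A :: "real^'n^'n"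
  shows "(\<And>i j. A $ i $ j \<in> \<int>) \<Longrightarrow> det A \<in> \<int>"
  unfolding det_def by (intro Ints_sum Ints_mult Ints_prod) auto

lemma Ints_matrix_mult:
  fixes A :: "real^'n^'m" and B :: "real^'k^'n"
  shows "(\<And>i j. A $ i $ j \<in> \<int>) \<Longrightarrow> (\<And>i j. B $ i $ j \<in> \<int>) \<Longrightarrow> (A ** B) $ i $ j \<in> \<int>"
  by (simp add: matrix_matrix_mult_def Ints_sum Ints_mult)

text \<open>By continuity of the determinant, a good rational approximation of \<open>M\<close>
  keeps it nonzero; then clear the common denominator.\<close>

lemma exists_int_matrix_det_nonzero:
  fixes A :: "real^'m^'n" and M :: "real^'n^'m"
  assumes "det (A ** M) \<noteq> 0"
  obtains N :: "real^'n^'m" where "\<And>i j. N $ i $ j \<in> \<int>" "det (A ** N) \<noteq> 0"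
proof -
  define X where "X q = (\<chi> i j. of_int (round (real (Suc q) * M $ i $ j)) / real (Suc q))" for q
  have lim: "(\<lambda>q. X q $ i $ j) \<longlonglongrightarrow> M $ i $ j" for i j
  proof -
    have bound: "norm (X q $ i $ j - M $ i $ j) \<le> inverse (real (Suc q))" for q
    proof -
      have "X q $ i $ j - M $ i $ j = (of_int (round (real (Suc q) * M $ i $ j)) - real (Suc q) * M $ i $ j) / real (Suc q)"
        by (simp add: X_def diff_divide_distrib del: of_nat_Suc)
      also have "norm \<dots> \<le> 1 / real (Suc q)"
        unfolding norm_divide
        using of_int_round_abs_le[of "real (Suc q) * M $ i $ j"]
        by (intro frac_le) (auto simp del: of_nat_Suc)
      finally show ?thesis by (simp add: inverse_eq_divide)
    qed
    have "(\<lambda>q. X q $ i $ j - M $ i $ j) \<longlonglongrightarrow> 0"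
      by (rule Lim_null_comparison[OF always_eventually[OF allI[OF bound]] LIMSEQ_inverse_real_of_nat])
    then show ?thesis by (rule LIM_zero_cancel)
  qed
  have "(\<lambda>q. det (A ** X q)) \<longlonglongrightarrow> det (A ** M)"
    unfolding det_def matrix_matrix_mult_def by (simp, intro tendsto_intros lim)
  then have "\<forall>\<^sub>F q in sequentially. det (A ** X q) \<noteq> 0"
    using assms by (rule tendsto_imp_eventually_ne)
  then obtain q where q: "det (A ** X q) \<noteq> 0" by (auto simp: eventually_sequentially)
  define N where "N = real (Suc q) *\<^sub>R X q"
  have "A ** N = real (Suc q) *\<^sub>R (A ** X q)"
    by (simp add: N_def matrix_scalar_ac(1) scalar_matrix_assoc flip: scalar_mult_eq_scaleR)
  show thesis
  proof (rule that)
    show "N $ i $ j \<in> \<int>" for i j by (simp add: N_def X_def del: of_nat_Suc)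
    have "x = 0" if "(A ** N) *v x = 0" for x
    proof -
      have "(A ** X q) *v x = 0"
        using that \<open>A ** N = _\<close> by (simp add: scaleR_matrix_vector_assoc[symmetric] del: of_nat_Suc)
      then show ?thesis
        using q by (metis invertible_det_nz invertible_left_inverse matrix_left_invertible_ker)
    qed
    then show "det (A ** N) \<noteq> 0"
      by (metis invertible_det_nz invertible_left_inverse matrix_left_invertible_ker)
  qed
qed

text \<open>Choose the columns of \<open>N\<close> such that the parallelepiped spanned by their images has minimal
  volume. Then, by Cramer's rule, these images generate the image lattice, and the assumption says
  that the dual of this lattice consists of integer vectors only.\<close>

lemma transpose_surjective_on_int_vecs:
  fixes E M :: "real^'n^'m"
  assumes E: "\<And>i j. E $ i $ j \<in> \<int>"
    and det: "det (transpose E ** M) \<noteq> 0"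
    and saturated: "\<And>u. E *v u \<in> int_vecs \<Longrightarrow> u \<in> int_vecs"
    and z: "z \<in> int_vecs"
  obtains k where "k \<in> int_vecs" "k v* E = z"
proof -
  define good where "good N \<longleftrightarrow> (\<forall>i j. N $ i $ j \<in> \<int>) \<and> det (transpose E ** N) \<noteq> 0" for N :: "real^'n^'m"
  obtain N0 :: "real^'n^'m" where "good N0"
    using exists_int_matrix_det_nonzero[OF det] unfolding good_def by metis
  then obtain N where N: "good N"
    and minimal: "\<And>N'. good N' \<Longrightarrow> nat \<lfloor>\<bar>det (transpose E ** N)\<bar>\<rfloor> \<le> nat \<lfloor>\<bar>det (transpose E ** N')\<bar>\<rfloor>"
    using ex_has_least_nat[of good N0 "\<lambda>N. nat \<lfloor>\<bar>det (transpose E ** N)\<bar>\<rfloor>"] by blast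
  have NI: "N $ i $ j \<in> \<int>" for i j using N by (simp add: good_def)
  define B where "B = transpose E ** N"
  have detB: "det B \<noteq> 0" using N by (simp add: good_def B_def)
  have ET: "transpose E $ i $ j \<in> \<int>" for i j using E by (simp add: transpose_def)
  \<comment> \<open>The minimum was taken over floors; nothing is lost because these determinants
    are integers.\<close>
  have least: "\<bar>det B\<bar> \<le> \<bar>det (transpose E ** N')\<bar>" if N': "good N'" for N'
  proof -
    have I: "\<bar>det (transpose E ** N'')\<bar> \<in> \<int>" if "good N''" for N''
      using that Ints_det[of "transpose E ** N''"] Ints_matrix_mult[of "transpose E" N''] ET
      by (auto simp: good_def)
    obtain a b :: int where ab: "\<bar>det (transpose E ** N)\<bar> = of_int a" "\<bar>det (transpose E ** N')\<bar> = of_int b"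
      using I[OF N] I[OF N'] by (auto elim!: Ints_cases)
    have "a \<ge> 0" "b \<ge> 0" using ab by (metis abs_ge_zero of_int_0_le_iff)+
    then show ?thesis using minimal[OF N'] ab by (simp add: B_def)
  qed
  obtain B' where B': "B' ** B = mat 1" "B ** B' = mat 1"
    using detB by (metis invertible_def invertible_det_nz)
  \<comment> \<open>These are the coordinates of an image vector in the basis of columns of
    \<open>B\<close>. If the \<open>j\<close>-th is fractional, replacing column \<open>j\<close> of
    \<open>N\<close> by the remainder \<open>g\<close> multiplies the determinant by its fractional
    part, against minimality.\<close>
  have coords: "(B' *v (k v* E)) $ j \<in> \<int>" if k: "k \<in> int_vecs" for k j
  proof (rule ccontr)
    define c where "c = B' *v (k v* E)"
    assume "\<not> ?thesis"
    then have cj: "c $ j \<notin> \<int>" by (simp add: c_def)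
    have Bc: "B *v c = k v* E"
      by (simp add: c_def matrix_vector_mul_assoc B'(2))
    define f where "f = (\<chi> i. real_of_int \<lfloor>c $ i\<rfloor>)"
    have f: "f \<in> int_vecs" by (simp add: f_def int_vecs_def)
    define g where "g = k - N *v f"
    have g: "g \<in> int_vecs" unfolding g_def by (intro int_vecs_diff k matrix_mult_int_vec NI f)
    define N' where "N' = (\<chi> i l. if l = j then g $ i else N $ i $ l)"
    have N'I: "N' $ i $ l \<in> \<int>" for i l
      using g NI by (simp add: N'_def int_vecs_def)
    have "transpose E ** N' = (\<chi> i l. if l = j then (B *v (c - f)) $ i else B $ i $ l)"
    proof -
      have "B *v f = transpose E *v (N *v f)"
        by (simp only: B_def matrix_vector_mul_assoc)
      then have "B *v (c - f) = transpose E *v g"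
        by (simp only: matrix_vector_mult_diff_distrib Bc g_def transpose_matrix_vector)
      moreover have "(transpose E ** N') $ i $ l = (if l = j then (transpose E *v g) $ i else B $ i $ l)" for i l
        by (simp add: matrix_matrix_mult_def matrix_vector_mult_def N'_def B_def del: transpose_matrix_vector)
      ultimately show ?thesis by (simp add: vec_eq_iff)
    qed
    then have d: "det (transpose E ** N') = (c - f) $ j * det B"
      by (simp only: cramer_lemma)
    have "(c - f) $ j = frac (c $ j)" by (simp add: f_def frac_def)
    then have dfr: "det (transpose E ** N') = frac (c $ j) * det B" by (simp only: d)
    have "frac (c $ j) > 0" "frac (c $ j) < 1" using cj by (simp_all add: frac_gt_0_iff frac_lt_1)
    then have "\<bar>det (transpose E ** N')\<bar> < \<bar>det B\<bar>" "det (transpose E ** N') \<noteq> 0"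
      using detB mult_strict_right_mono[of "frac (c $ j)" 1 "\<bar>det B\<bar>"] by (simp_all add: dfr abs_mult)
    moreover from this have "good N'" using N'I by (simp add: good_def)
    ultimately show False using least by fastforce
  qed
  \<comment> \<open>The rows of \<open>B'\<close> form the dual basis: integral coordinates mean
    that \<open>E\<close> maps each row to an integer vector, so saturation applies.\<close>
  have "B' $ j $ i \<in> \<int>" for i j
  proof -
    have "E *v (B' $ j) \<in> int_vecs"
    proof -
      have "(E *v (B' $ j)) $ i \<in> \<int>" for i
      proof -
        have "(E *v (B' $ j)) $ i = (E *v (B' $ j)) \<bullet> axis i 1" by (simp add: inner_axis)
        also have "\<dots> = (axis i 1 v* E) \<bullet> B' $ j" by (simp only: dot_lmul_matrix) (rule inner_commute)
        also have "\<dots> = (B' *v (axis i 1 v* E)) $ j"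
          by (simp add: matrix_vector_mult_def inner_vec_def mult.commute)
        finally show ?thesis using coords[OF axis_in_int_vecs] by simp
      qed
      then show ?thesis by (simp add: int_vecs_def)
    qed
    then have "B' $ j \<in> int_vecs" by (rule saturated)
    then show ?thesis by (simp add: int_vecs_def)
  qed
  then have "N *v (B' *v z) \<in> int_vecs" using z NI by (intro matrix_mult_int_vec)
  moreover have "N *v (B' *v z) v* E = z"
  proof -
    have "N *v (B' *v z) v* E = B *v (B' *v z)"
      by (simp only: B_def transpose_matrix_vector[symmetric] matrix_vector_mul_assoc matrix_mul_assoc)
    then show ?thesis by (simp only: matrix_vector_mul_assoc B'(2) matrix_vector_mul_lid)
  qed
  ultimately show thesis by (rule that)
qed

section \<open>Counting lattice points\<close>

lemma finite_int_vecs_ball: "finite (int_vecs \<inter> ball (0 :: real^'n) R)"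
proof (rule separated_finite_ball[of 1])
  fix a b :: "real^'n" assume "a \<in> int_vecs" "b \<in> int_vecs" "norm (a - b) < 1"
  then show "a = b" using int_vec_norm_less_one[OF int_vecs_diff] by fastforce
qed simp

lemma matrix_bounded:
  fixes A :: "real^'n^'m"
  obtains K where "K > 0" "\<And>x. norm (A *v x) \<le> K * norm x"
  using bounded_linear.pos_bounded[OF matrix_vector_mul_bounded_linear[of A]] by (metis mult.commute)

definition lattice_points :: "real^'n^'n \<Rightarrow> real \<Rightarrow> (real^'n) set"
  where "lattice_points D R = {z \<in> int_vecs. \<exists>y. norm y < R \<and> z = D *v y}"

text \<open>Attach a unit cube to each lattice point: the closed cubes cover the image of a slightly
  smaller ball, while the open ones are disjoint and lie in the image of a slightly larger
  ball.\<close>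

lemma lattice_point_count_wellorder:
  fixes D :: "((real, 'n::{finite,wellorder}) vec, 'n) vec"
  assumes "det D \<noteq> 0"
  shows "\<exists>d. \<forall>R. finite (lattice_points D R)
    \<and> \<bar>det D\<bar> * measure lborel (ball (0 :: (real, 'n) vec) (R - d)) \<le> real (card (lattice_points D R))
    \<and> real (card (lattice_points D R)) \<le> \<bar>det D\<bar> * measure lborel (ball (0 :: (real, 'n) vec) (R + d))"
proof -
  define T where "T R = (\<lambda>y. D *v y) ` ball 0 R" for R
  define Z where "Z R = int_vecs \<inter> T R" for R
  have Z_eq: "lattice_points D R = Z R" for R
    by (auto simp: Z_def T_def lattice_points_def)
  have linD: "linear ((*v) D)" by (rule matrix_vector_mul_linear)
  have Tm: "T R \<in> lmeasurable" for R
    unfolding T_def by (rule measurable_linear_image[OF linD]) simp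
  have T_measure: "measure lebesgue (T R) = \<bar>det D\<bar> * measure lborel (ball (0 :: (real, 'n) vec) R)" for R
  proof -
    have "measure lebesgue (T R) = \<bar>det (matrix ((*v) D))\<bar> * measure lebesgue (ball (0 :: (real, 'n) vec) R)"
      unfolding T_def by (rule measure_linear_image[OF linD]) simp
    then show ?thesis by (simp add: measure_completion)
  qed
  obtain B where B: "B ** D = mat 1" "D ** B = mat 1"
    using assms by (metis invertible_def invertible_det_nz)
  have BD: "B *v (D *v x) = x" "D *v (B *v x) = x" for x
    by (simp_all add: matrix_vector_mul_assoc B)
  obtain K where K: "K > 0" "\<And>x. norm (B *v x) \<le> K * norm x" by (rule matrix_bounded[of B]) blast
  obtain L where L: "L > 0" "\<And>x. norm (D *v x) \<le> L * norm x" by (rule matrix_bounded[of D]) blast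
  \<comment> \<open>A point of a unit cube is within \<open>CARD('n)\<close> of the lower corner,
    and \<open>K\<close> bounds the inverse of \<open>D\<close>.\<close>
  define d where "d = K * real CARD('n)"
  have finZ: "finite (Z R)" for R
  proof (rule finite_subset[OF _ finite_int_vecs_ball])
    show "Z R \<subseteq> int_vecs \<inter> ball 0 (L * R)"
    proof
      fix z assume "z \<in> Z R"
      then obtain y where y: "z \<in> int_vecs" "norm y < R" "z = D *v y" by (auto simp: Z_def T_def)
      have "norm z \<le> L * norm y" using L(2) y(3) by simp
      also have "\<dots> < L * R" using y(2) L(1) by simp
      finally show "z \<in> int_vecs \<inter> ball 0 (L * R)" using y(1) by simp
    qed
  qed
  have cube: "norm (B *v (x - z)) \<le> d" if "x \<in> cbox z (z + 1)" for x z
  proof -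
    have "norm (x - z) \<le> (\<Sum>i\<in>UNIV. \<bar>(x - z) $ i\<bar>)" by (rule norm_le_l1_cart)
    also have "\<dots> \<le> (\<Sum>i\<in>(UNIV :: 'n set). 1)"
      using that by (intro sum_mono) (auto simp: mem_box_cart abs_le_iff algebra_simps intro: order_trans[of _ 0])
    finally have "norm (x - z) \<le> real CARD('n)" by simp
    then have "K * norm (x - z) \<le> d" unfolding d_def using K(1) by (intro mult_left_mono) auto
    then show ?thesis using K(2)[of "x - z"] by linarith
  qed
  have content_cube: "measure lebesgue (cbox z (z + 1)) = 1" for z :: "(real, 'n) vec"
  proof -
    have "cbox z (z + 1) \<noteq> {}" by (simp add: interval_ne_empty_cart less_imp_le)
    then show ?thesis by (simp add: content_cbox_cart measure_completion)
  qed
  have content_cube': "measure lebesgue (box z (z + 1)) = 1" for z :: "(real, 'n) vec"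
    using content_cube[of z]
    by (simp add: measure_completion measure_lborel_box_eq measure_lborel_cbox_eq)
  have lower: "\<bar>det D\<bar> * measure lborel (ball (0 :: (real, 'n) vec) (R - d)) \<le> real (card (Z R))" for R
  proof -
    have "T (R - d) \<subseteq> (\<Union>z\<in>Z R. cbox z (z + 1))"
    proof
      fix x assume "x \<in> T (R - d)"
      then obtain y where y: "norm y < R - d" "x = D *v y" by (auto simp: T_def)
      define z where "z = (\<chi> i. real_of_int \<lfloor>x $ i\<rfloor>)"
      have xz: "x \<in> cbox z (z + 1)"
      proof -
        have "of_int \<lfloor>t\<rfloor> \<le> t \<and> t \<le> of_int \<lfloor>t\<rfloor> + 1" for t :: real by linarith
        then show ?thesis by (simp add: z_def mem_box_cart)
      qed
      have "z = D *v (y - B *v (x - z))" using BD y(2) by (simp add: matrix_vector_mult_diff_distrib)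
      moreover have "norm (y - B *v (x - z)) < R"
        using norm_triangle_ineq4[of y "B *v (x - z)"] cube[OF xz] y(1) by simp
      ultimately have "z \<in> T R" unfolding T_def by (intro image_eqI) auto
      then have "z \<in> Z R" by (simp add: Z_def z_def int_vecs_def)
      then show "x \<in> (\<Union>z\<in>Z R. cbox z (z + 1))" using xz by blast
    qed
    then have "measure lebesgue (T (R - d)) \<le> measure lebesgue (\<Union>z\<in>Z R. cbox z (z + 1))"
      by (rule measure_mono_fmeasurable) (use Tm finZ in \<open>auto intro!: fmeasurable.finite_UN\<close>)
    also have "\<dots> \<le> (\<Sum>z\<in>Z R. measure lebesgue (cbox z (z + 1)))"
      by (rule measure_UNION_le[OF finZ]) auto
    finally show ?thesis by (simp only: T_measure content_cube sum_constant mult_1_right)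
  qed
  have upper: "real (card (Z R)) \<le> \<bar>det D\<bar> * measure lborel (ball (0 :: (real, 'n) vec) (R + d))" for R
  proof -
    have disj: "disjoint_family_on (\<lambda>z. box z (z + 1)) (Z R)"
      unfolding disjoint_family_on_def
    proof (intro ballI impI, rule ccontr)
      fix a b assume ab: "a \<in> Z R" "b \<in> Z R" "a \<noteq> b" "box a (a + 1) \<inter> box b (b + 1) \<noteq> {}"
      then obtain x where x: "x \<in> box a (a + 1)" "x \<in> box b (b + 1)" by blast
      have "a $ i - b $ i = 0" for i
      proof (rule Ints_nonzero_abs_less1)
        show "a $ i - b $ i \<in> \<int>" using ab by (simp add: Z_def int_vecs_def)
        show "\<bar>a $ i - b $ i\<bar> < 1"
          using x by (auto simp: mem_box_cart abs_less_iff algebra_simps) (smt (verit, best))+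
      qed
      then show False using ab(3) by (simp add: vec_eq_iff)
    qed
    have "real (card (Z R)) = (\<Sum>z\<in>Z R. measure lebesgue (box z (z + 1)))"
      by (simp only: content_cube' sum_constant mult_1_right)
    also have "\<dots> = measure lebesgue (\<Union>z\<in>Z R. box z (z + 1))"
      by (rule measure_finite_Union[symmetric])
         (use finZ disj less_imp_neq[OF emeasure_lborel_box_finite] in auto)
    also have "\<dots> \<le> measure lebesgue (T (R + d))"
    proof (rule measure_mono_fmeasurable)
      show "(\<Union>z\<in>Z R. box z (z + 1)) \<subseteq> T (R + d)"
      proof clarify
        fix z x assume z: "z \<in> Z R" and x: "x \<in> box z (z + 1)"
        obtain y where y: "norm y < R" "z = D *v y" using z by (auto simp: Z_def T_def)
        have "x \<in> cbox z (z + 1)" using x box_subset_cbox by blast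
        then have "norm (y + B *v (x - z)) < R + d"
          using norm_triangle_ineq[of y "B *v (x - z)"] cube y(1) by fastforce
        moreover have "x = D *v (y + B *v (x - z))" using BD y(2) by (simp add: matrix_vector_right_distrib)
        ultimately show "x \<in> T (R + d)" unfolding T_def by (intro image_eqI) auto
      qed
      show "(\<Union>z\<in>Z R. box z (z + 1)) \<in> sets lebesgue" using finZ by auto
    qed (rule Tm)
    finally show ?thesis by (simp only: T_measure)
  qed
  show ?thesis using finZ lower upper unfolding Z_eq by blast
qed

text \<open>Conjugation turns a transposition into the transposition of the relabelled points, so
  the number of factors is kept.\<close>

lemma swapidseq_conjugate:
  assumes "swapidseq n p" "bij f"
  shows "swapidseq n (inv f \<circ> p \<circ> f)"
  using assms(1)
proof (induction rule: swapidseq.induct)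
  case id
  have "inv f \<circ> id \<circ> f = id"
    using assms(2) by (auto simp: fun_eq_iff bij_is_inj)
  then show ?case by (simp only: swapidseq.id)
next
  case (comp_Suc n p a b)
  have eq: "inv f \<circ> (Transposition.transpose a b \<circ> p) \<circ> f
      = Transposition.transpose (inv f a) (inv f b) \<circ> (inv f \<circ> p \<circ> f)"
  proof
    fix x
    have "inv f (Transposition.transpose a b y) = Transposition.transpose (inv f a) (inv f b) (inv f y)" for y
      using bij_is_inj[OF bij_imp_bij_inv[OF assms(2)]] by (auto simp: Transposition.transpose_def inj_eq)
    then show "(inv f \<circ> (Transposition.transpose a b \<circ> p) \<circ> f) x
        = (Transposition.transpose (inv f a) (inv f b) \<circ> (inv f \<circ> p \<circ> f)) x" by simp
  qed
  have "inv f a \<noteq> inv f b"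
    using comp_Suc.hyps bij_is_inj[OF bij_imp_bij_inv[OF assms(2)]] by (simp add: inj_eq)
  then show ?case unfolding eq by (rule swapidseq.comp_Suc[OF comp_Suc.IH])
qed

lemma sign_conjugate:
  fixes p :: "'a::finite \<Rightarrow> 'a" and f :: "'b \<Rightarrow> 'a"
  assumes "p permutes UNIV" "bij f"
  shows "sign (inv f \<circ> p \<circ> f) = sign p"
proof -
  have "permutation p" using assms(1) unfolding permutation_permutes by (intro exI[of _ UNIV]) simp
  then obtain n where n: "swapidseq n p" by (auto simp: permutation_def)
  have "evenperm p \<longleftrightarrow> even n" using evenperm_unique[OF n] by blast
  moreover have "evenperm (inv f \<circ> p \<circ> f) \<longleftrightarrow> even n"
    using evenperm_unique[OF swapidseq_conjugate[OF n assms(2)]] by blast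
  ultimately show ?thesis by (simp add: sign_def)
qed

text \<open>Conjugation by \<open>f\<close> is a sign-preserving bijection between the terms of the
  two Leibniz formulas.\<close>

lemma det_reindex:
  fixes A :: "real^'a^'a" and f :: "'b::finite \<Rightarrow> 'a"
  assumes f: "bij f"
  shows "det (\<chi> i j. A $ f i $ f j :: real^'b^'b) = det A"
proof -
  let ?c = "\<lambda>p. inv f \<circ> p \<circ> f"
  have ff: "f (inv f y) = y" "inv f (f x) = x" for x y
    using f by (simp_all add: bij_is_surj surj_f_inv_f bij_is_inj)
  have bij: "bij_betw ?c {p. p permutes UNIV} {p. p permutes UNIV}"
  proof (rule bij_betw_byWitness[where f' = "\<lambda>q. f \<circ> q \<circ> inv f"])
    show "?c ` {p. p permutes UNIV} \<subseteq> {p. p permutes UNIV}"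
      using f by (auto intro!: bij_imp_permutes bij_comp bij_imp_bij_inv dest: permutes_bij)
    show "(\<lambda>q. f \<circ> q \<circ> inv f) ` {p. p permutes UNIV} \<subseteq> {p. p permutes UNIV}"
      using f by (auto intro!: bij_imp_permutes bij_comp bij_imp_bij_inv dest: permutes_bij)
  qed (simp_all add: fun_eq_iff ff)
  have "det (\<chi> i j. A $ f i $ f j :: real^'b^'b)
      = (\<Sum>q | q permutes UNIV. of_int (sign q) * (\<Prod>i\<in>UNIV. A $ f i $ f (q i)))"
    by (simp add: det_def)
  also have "\<dots> = (\<Sum>p | p permutes UNIV. of_int (sign (?c p)) * (\<Prod>i\<in>UNIV. A $ f i $ f (?c p i)))"
    by (rule sum.reindex_bij_betw[OF bij, symmetric])
  also have "\<dots> = (\<Sum>p | p permutes UNIV. of_int (sign p) * (\<Prod>i\<in>UNIV. A $ i $ p i))"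
  proof (rule sum.cong[OF refl])
    fix p :: "'a \<Rightarrow> 'a" assume p: "p \<in> {p. p permutes UNIV}"
    have "(\<Prod>i\<in>UNIV. A $ f i $ f (?c p i)) = (\<Prod>i\<in>UNIV. A $ f i $ p (f i))" by (simp add: ff)
    also have "\<dots> = (\<Prod>i\<in>UNIV. A $ i $ p i)"
      by (rule prod.reindex_bij_betw[OF f])
    finally show "of_int (sign (?c p)) * (\<Prod>i\<in>UNIV. A $ f i $ f (?c p i))
        = of_int (sign p) * (\<Prod>i\<in>UNIV. A $ i $ p i)"
      using sign_conjugate[OF _ f, of p] p by simp
  qed
  finally show ?thesis by (simp add: det_def)
qed

text \<open>The change of variables formula for linear maps is only available for vectors indexed by a
  well-ordered type.\<close>

typedef 'a ordered_copy = "UNIV :: 'a set"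
  morphisms of_copy to_copy by simp

lemma bij_of_copy: "bij of_copy"
  by (metis UNIV_I bijI' of_copy_inject to_copy_inverse)

instance ordered_copy :: (finite) finite
  by standard (metis bij_betw_finite bij_of_copy finite)

definition index :: "'a::finite \<Rightarrow> nat"
  where "index = (SOME f. inj f)"

lemma inj_index: "inj (index :: 'a::finite \<Rightarrow> nat)"
proof -
  obtain f :: "'a \<Rightarrow> nat" where "inj f"
    using finite_imp_inj_to_nat_seg[of "UNIV :: 'a set"] by auto
  from someI[of "\<lambda>f. inj f", OF this] show ?thesis unfolding index_def .
qed

instantiation ordered_copy :: (finite) wellorder
begin

definition less_eq_ordered_copy :: "'a ordered_copy \<Rightarrow> 'a ordered_copy \<Rightarrow> bool"
  where "x \<le> y \<longleftrightarrow> index (of_copy x) \<le> index (of_copy y)"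

definition less_ordered_copy :: "'a ordered_copy \<Rightarrow> 'a ordered_copy \<Rightarrow> bool"
  where "x < y \<longleftrightarrow> index (of_copy x) < index (of_copy y)"

instance
proof
  fix P :: "'a ordered_copy \<Rightarrow> bool" and a
  assume step: "\<And>x. (\<And>y. y < x \<Longrightarrow> P y) \<Longrightarrow> P x"
  show "P a"
    by (induction a rule: measure_induct_rule[of "\<lambda>x. index (of_copy x)"])
       (rule step, simp add: less_ordered_copy_def)
qed (auto simp: less_eq_ordered_copy_def less_ordered_copy_def of_copy_inject inj_eq[OF inj_index])

end

text \<open>The relabelling \<open>\<phi>\<close> is an isometry that preserves integer vectors and
  intertwines \<open>D\<close> with its copy, so counts, volumes and determinants agree.\<close>

lemma lattice_point_count:
  fixes D :: "real^'n^'n"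
  assumes "det D \<noteq> 0"
  obtains d where
    "\<And>R. finite (lattice_points D R)"
    "\<And>R. \<bar>det D\<bar> * measure lborel (ball (0 :: real^'n) (R - d)) \<le> real (card (lattice_points D R))"
    "\<And>R. real (card (lattice_points D R)) \<le> \<bar>det D\<bar> * measure lborel (ball (0 :: real^'n) (R + d))"
proof -
  define D' :: "real^('n ordered_copy)^('n ordered_copy)" where "D' = (\<chi> i j. D $ of_copy i $ of_copy j)"
  define \<phi> :: "real^'n \<Rightarrow> real^('n ordered_copy)" where "\<phi> x = (\<chi> i. x $ of_copy i)" for x
  have det: "det D' = det D" unfolding D'_def by (rule det_reindex[OF bij_of_copy])
  have card: "CARD('n ordered_copy) = CARD('n)" by (rule bij_betw_same_card[OF bij_of_copy])
  have V: "measure lborel (ball (0 :: real^('n ordered_copy)) R) = measure lborel (ball (0 :: real^'n) R)" for R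
  proof (cases "R \<ge> 0")
    case True
    then show ?thesis by (simp only: measure_lborel_ball card)
  next
    case False
    then show ?thesis by (simp add: ball_empty)
  qed
  have bij: "bij \<phi>"
  proof (rule o_bij[of "\<lambda>y. \<chi> i. y $ to_copy i"])
    show "(\<lambda>y. \<chi> i. y $ to_copy i) \<circ> \<phi> = id"
      by (simp add: fun_eq_iff \<phi>_def vec_eq_iff to_copy_inverse)
    show "\<phi> \<circ> (\<lambda>y. \<chi> i. y $ to_copy i) = id"
      by (simp add: fun_eq_iff \<phi>_def vec_eq_iff of_copy_inverse)
  qed
  have int: "\<phi> z \<in> int_vecs \<longleftrightarrow> z \<in> int_vecs" for z
    by (simp add: int_vecs_def \<phi>_def) (metis UNIV_I to_copy_inverse)
  have norm: "norm (\<phi> y) = norm y" for y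
    unfolding norm_vec_def L2_set_def \<phi>_def
    using sum.reindex_bij_betw[OF bij_of_copy, of "\<lambda>i. (norm (y $ i))\<^sup>2"] by simp
  have mult: "D' *v \<phi> y = \<phi> (D *v y)" for y
    unfolding matrix_vector_mult_def D'_def \<phi>_def
    using sum.reindex_bij_betw[OF bij_of_copy, of "\<lambda>j. D $ i $ j * y $ j" for i] by simp
  have image: "lattice_points D' R = \<phi> ` lattice_points D R" for R
  proof (intro equalityI subsetI)
    fix z assume "z \<in> lattice_points D' R"
    then obtain y where y: "z \<in> int_vecs" "norm y < R" "z = D' *v y" by (auto simp: lattice_points_def)
    obtain y' where y': "y = \<phi> y'" using bij_is_surj[OF bij] by (metis surjD)
    then have "z = \<phi> (D *v y')" using y(3) mult by simp
    moreover have "D *v y' \<in> lattice_points D R"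
      using y y' int[of "D *v y'"] norm[of y'] \<open>z = \<phi> (D *v y')\<close> by (auto simp: lattice_points_def)
    ultimately show "z \<in> \<phi> ` lattice_points D R" by blast
  qed (force simp: lattice_points_def int norm mult[symmetric])
  have card_eq: "card (lattice_points D' R) = card (lattice_points D R)" for R
    unfolding image by (rule card_image) (use bij_is_inj[OF bij] inj_on_subset in blast)
  have fin_eq: "finite (lattice_points D' R) \<longleftrightarrow> finite (lattice_points D R)" for R
    unfolding image by (rule finite_image_iff) (use bij_is_inj[OF bij] inj_on_subset in blast)
  have "det D' \<noteq> 0" using assms by (simp add: det)
  from lattice_point_count_wellorder[OF this] obtain d where
    "\<forall>R. finite (lattice_points D' R)
    \<and> \<bar>det D'\<bar> * measure lborel (ball (0 :: real^('n ordered_copy)) (R - d)) \<le> real (card (lattice_points D' R))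
    \<and> real (card (lattice_points D' R)) \<le> \<bar>det D'\<bar> * measure lborel (ball (0 :: real^('n ordered_copy)) (R + d))"
    by blast
  then show thesis
    unfolding det V card_eq fin_eq by (intro that) auto
qed

text \<open>Each \<open>x\<close> is within a fixed distance \<open>e\<close> of the preimage of
  \<open>F x\<close> under \<open>D\<close>. Hence the part of \<open>A\<close> in a ball lies
  between the unions of fibres over the lattice points for the radii \<open>R - e\<close> and
  \<open>R + e\<close>, and each fibre counts \<open>q\<close> times.\<close>

lemma has_density_lattice_perturbation:
  fixes D :: "real^'n^'n" and F :: "real^'n \<Rightarrow> real^'n"
  assumes D: "det D \<noteq> 0"
    and F: "\<And>x. x \<in> A \<Longrightarrow> F x \<in> int_vecs"
    and C: "\<And>x. x \<in> A \<Longrightarrow> norm (D *v x - F x) \<le> C"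
    and fin: "\<And>z. z \<in> int_vecs \<Longrightarrow> finite {x \<in> A. F x = z}"
    and card: "\<And>z. z \<in> int_vecs \<Longrightarrow> card {x \<in> A. F x = z} = q"
  shows "has_density A (real q * \<bar>det D\<bar>)"
proof -
  let ?V = "\<lambda>R. measure lborel (ball (0 :: real^'n) R)"
  obtain d where finZ: "\<And>R. finite (lattice_points D R)"
    and lower: "\<And>R. \<bar>det D\<bar> * ?V (R - d) \<le> real (card (lattice_points D R))"
    and upper: "\<And>R. real (card (lattice_points D R)) \<le> \<bar>det D\<bar> * ?V (R + d)"
    using lattice_point_count[OF D] by metis
  obtain B where B: "B ** D = mat 1" "D ** B = mat 1"
    using D by (metis invertible_def invertible_det_nz)
  have BD: "B *v (D *v x) = x" "D *v (B *v x) = x" for x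
    by (simp_all add: matrix_vector_mul_assoc B)
  obtain K where K: "K > 0" "\<And>x. norm (B *v x) \<le> K * norm x" by (rule matrix_bounded[of B]) blast
  define e where "e = K * C"
  have disp: "norm (x - B *v F x) \<le> e" if "x \<in> A" for x
  proof -
    have "x - B *v F x = B *v (D *v x - F x)" by (simp add: matrix_vector_mult_diff_distrib BD)
    then have "norm (x - B *v F x) \<le> K * norm (D *v x - F x)" using K(2) by simp
    also have "\<dots> \<le> e" unfolding e_def using C[OF that] K(1) by simp
    finally show ?thesis .
  qed
  define U where "U R = (\<Union>z\<in>lattice_points D R. {x \<in> A. F x = z})" for R
  have finU: "finite (U R)" for R
    unfolding U_def using finZ fin by (auto simp: lattice_points_def)
  have cardU: "card (U R) = q * card (lattice_points D R)" for R
  proof -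
    have "card (U R) = (\<Sum>z\<in>lattice_points D R. card {x \<in> A. F x = z})"
      unfolding U_def by (rule card_UN_disjoint) (use finZ fin in \<open>auto simp: lattice_points_def\<close>)
    also have "\<dots> = (\<Sum>z\<in>lattice_points D R. q)" by (rule sum.cong) (auto simp: lattice_points_def card)
    finally show ?thesis by simp
  qed
  have sub1: "A \<inter> ball 0 R \<subseteq> U (R + e)" for R
  proof
    fix x assume x: "x \<in> A \<inter> ball 0 R"
    have "norm (B *v F x) < R + e"
      using norm_triangle_ineq4[of x "x - B *v F x"] disp[of x] x by simp
    then show "x \<in> U (R + e)" using x F BD by (auto simp: U_def lattice_points_def intro!: exI[of _ "B *v F x"])
  qed
  have sub2: "U (R - e) \<subseteq> A \<inter> ball 0 R" for R
  proof
    fix x assume "x \<in> U (R - e)"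
    then obtain y where x: "x \<in> A" "norm y < R - e" "F x = D *v y" by (auto simp: U_def lattice_points_def)
    then have "norm (x - y) \<le> e" using disp[of x] BD by simp
    then have "norm x < R" using norm_triangle_ineq[of "x - y" y] x(2) by simp
    then show "x \<in> A \<inter> ball 0 R" using x(1) by simp
  qed
  have finA: "finite (A \<inter> ball 0 R)" for R using finite_subset[OF sub1 finU] .
  have low: "real q * \<bar>det D\<bar> * ?V (R + - (e + d)) \<le> real (card (A \<inter> ball 0 R))" for R
  proof -
    have "real q * (\<bar>det D\<bar> * ?V (R - e - d)) \<le> real q * real (card (lattice_points D (R - e)))"
      by (rule mult_left_mono[OF lower]) simp
    also have "\<dots> = real (card (U (R - e)))" by (simp add: cardU)
    also have "\<dots> \<le> real (card (A \<inter> ball 0 R))" using card_mono[OF finA sub2] by simp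
    finally show ?thesis by (simp add: algebra_simps)
  qed
  have upp: "real (card (A \<inter> ball 0 R)) \<le> real q * \<bar>det D\<bar> * ?V (R + (e + d))" for R
  proof -
    have "real (card (A \<inter> ball 0 R)) \<le> real (card (U (R + e)))" using card_mono[OF finU sub1] by simp
    also have "\<dots> = real q * real (card (lattice_points D (R + e)))" by (simp add: cardU)
    also have "\<dots> \<le> real q * (\<bar>det D\<bar> * ?V (R + e + d))" by (rule mult_left_mono[OF upper]) simp
    finally show ?thesis by (simp add: algebra_simps)
  qed
  have "((\<lambda>R. real (card (A \<inter> ball 0 R)) / ?V R) \<longlongrightarrow> real q * \<bar>det D\<bar>) at_top"
  proof (rule real_tendsto_sandwich)
    show "((\<lambda>R. real q * \<bar>det D\<bar> * (?V (R + - (e + d)) / ?V R)) \<longlongrightarrow> real q * \<bar>det D\<bar>) at_top"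
      using tendsto_mult[OF tendsto_const measure_ball_ratio_tendsto] by fastforce
    show "((\<lambda>R. real q * \<bar>det D\<bar> * (?V (R + (e + d)) / ?V R)) \<longlongrightarrow> real q * \<bar>det D\<bar>) at_top"
      using tendsto_mult[OF tendsto_const measure_ball_ratio_tendsto] by fastforce
    show "\<forall>\<^sub>F R in at_top. real q * \<bar>det D\<bar> * (?V (R + - (e + d)) / ?V R) \<le> real (card (A \<inter> ball 0 R)) / ?V R"
      unfolding times_divide_eq_right
      by (intro always_eventually allI divide_right_mono low) simp
    show "\<forall>\<^sub>F R in at_top. real (card (A \<inter> ball 0 R)) / ?V R \<le> real q * \<bar>det D\<bar> * (?V (R + (e + d)) / ?V R)"
      unfolding times_divide_eq_right
      by (intro always_eventually allI divide_right_mono upp) simp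
  qed
  then show ?thesis using finA by (simp add: has_density_def)
qed

section \<open>Density of the points over a component\<close>

locale periodic_component = uniform_transversal M H r
  for M :: "real^'n^'m" and H :: "(real^'m) set" and r :: real +
  fixes C S :: "(real^'m) set"
  assumes periodic: "\<And>h k. h \<in> H \<Longrightarrow> k \<in> int_vecs \<Longrightarrow> h + k \<in> H"
    and component: "C \<in> components H"
    and S_eq: "S = {k \<in> int_vecs. (\<lambda>h. h + k) ` C = C}"
begin

lemma translate_H: "k \<in> int_vecs \<Longrightarrow> (\<lambda>h. h + k) ` H = H"
proof (intro equalityI subsetI)
  fix h assume "k \<in> int_vecs" "h \<in> H"
  then have "h - k \<in> H" using periodic[of h "- k"] int_vecs_minus[of k] by simp
  then show "h \<in> (\<lambda>h. h + k) ` H" by (intro image_eqI[of _ _ "h - k"]) auto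
qed (use periodic in auto)

lemma translate_C: "k \<in> int_vecs \<Longrightarrow> (\<lambda>h. h + k) ` C \<in> components H"
  by (rule translate_component[OF component translate_H])

lemma C_subset_H: "C \<subseteq> H"
  by (rule in_components_subset[OF component])

lemma S_subset: "S \<subseteq> int_vecs"
  by (auto simp: S_eq)

lemma S_shift: "k \<in> S \<Longrightarrow> h \<in> C \<Longrightarrow> h + k \<in> C"
  by (auto simp: S_eq)

text \<open>Components that meet are equal, so a single point decides whether translation by
  \<open>k\<close> preserves \<open>C\<close>.\<close>

lemma in_S_iff:
  assumes "k \<in> int_vecs" "h \<in> C"
  shows "k \<in> S \<longleftrightarrow> h + k \<in> C"
proof
  assume "h + k \<in> C"
  then have "(\<lambda>h. h + k) ` C \<inter> C \<noteq> {}" using assms(2) by blast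
  then have "(\<lambda>h. h + k) ` C = C"
    using components_nonoverlap[OF translate_C[OF assms(1)] component] by blast
  then show "k \<in> S" using assms(1) by (simp add: S_eq)
qed (use S_shift assms in blast)

lemma C_nonempty: obtains h where "h \<in> C"
  using in_components_nonempty[OF component] by blast

lemma S_zero: "0 \<in> S"
  by (simp add: S_eq int_vecs_zero)

lemma S_add: "k \<in> S \<Longrightarrow> l \<in> S \<Longrightarrow> k + l \<in> S"
  by (meson C_nonempty S_shift S_subset in_S_iff int_vecs_add subsetD add.assoc[THEN subst])

lemma S_minus:
  assumes "k \<in> S"
  shows "- k \<in> S"
proof -
  obtain h where h: "h \<in> C" by (rule C_nonempty)
  then have "h \<in> (\<lambda>h. h + k) ` C" using assms by (simp add: S_eq)
  then obtain h' where "h' \<in> C" "h = h' + k" by blast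
  then show ?thesis using in_S_iff[of "- k" h] h assms S_subset int_vecs_minus by auto
qed

lemma S_scale: "k \<in> S \<Longrightarrow> of_int a *\<^sub>R k \<in> S"
proof -
  assume k: "k \<in> S"
  have nat: "real n *\<^sub>R k \<in> S" for n
    by (induction n) (use k S_zero S_add in \<open>auto simp: scaleR_left_distrib\<close>)
  show ?thesis
  proof (cases "a \<ge> 0")
    case True
    then show ?thesis using nat[of "nat a"] by simp
  next
    case False
    then show ?thesis using S_minus[OF nat[of "nat (- a)"]] by simp
  qed
qed

lemma S_sum: "finite B \<Longrightarrow> B \<subseteq> S \<Longrightarrow> (\<Sum>b\<in>B. of_int (p b) *\<^sub>R b) \<in> S"
  by (induction B rule: finite_induct) (use S_zero S_add S_scale in auto)

text \<open>\<open>s w + k\<close> is a point of \<open>C\<close> over \<open>w + P k\<close>, and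
  \<open>C\<close> has only one such point.\<close>

lemma section_shift:
  assumes s: "\<And>w. w \<in> W \<Longrightarrow> s w \<in> C \<and> P (s w) = w" "\<And>h. h \<in> C \<Longrightarrow> s (P h) = h"
    and k: "k \<in> S" and w: "w \<in> W"
  shows "s (w + P k) = s w + k"
proof -
  have "s w + k \<in> C" using S_shift[OF k] s(1)[OF w] by blast
  then have "s (P (s w + k)) = s w + k" by (rule s(2))
  then show ?thesis using s(1)[OF w] by (simp add: P_add)
qed

text \<open>If \<open>P v = 0\<close> and \<open>\<sigma> \<in> S\<close> is close to a multiple of \<open>v\<close>, then \<open>P \<sigma>\<close> is close to \<open>0\<close>, hence so is
  \<open>s (P \<sigma>) - s 0 = \<sigma>\<close>; but \<open>\<sigma>\<close> is an integer vector.\<close>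

lemma P_inj_on_span:
  assumes v: "v \<in> span S" "P v = 0"
  shows "v = 0"
proof -
  obtain s where s: "continuous_on W s" "\<And>w. w \<in> W \<Longrightarrow> s w \<in> C \<and> P (s w) = w" "\<And>h. h \<in> C \<Longrightarrow> s (P h) = h"
    using component_section[OF component] by metis
  obtain B where B: "finite B" "B \<subseteq> S" "span B = span S" by (rule finite_spanning_subset)
  obtain a where a: "v = (\<Sum>b\<in>B. a b *\<^sub>R b)"
    using v(1) unfolding B(3)[symmetric] span_finite[OF B(1)] by auto
  have "continuous_on UNIV (s \<circ> P)"
    by (rule continuous_on_compose[OF continuous_on_P]) (use s(1) continuous_on_subset P_in_W in blast)
  then obtain d where d: "d > 0" "\<And>x. dist x 0 < d \<Longrightarrow> dist ((s \<circ> P) x) ((s \<circ> P) 0) < 1"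
    unfolding continuous_on_iff by (metis UNIV_I zero_less_one)
  have P0: "P 0 = 0" by (simp add: P_def)
  have W0: "0 \<in> W" by (simp add: W_def)
  define c where "c = 1 + (\<Sum>b\<in>B. norm b)"
  have c: "c > 0" by (simp add: c_def add_pos_nonneg sum_nonneg)
  have "norm v \<le> \<eta>" if \<eta>: "\<eta> > 0" for \<eta>
  proof -
    \<comment> \<open>Summed over \<open>B\<close>, the error stays below
      \<open>min \<eta> d\<close>: \<open>d\<close> makes \<open>s\<close> move by less than 1 and
      forces \<open>\<sigma> = 0\<close>; \<open>\<eta>\<close> then bounds
      \<open>real q * norm v\<close>.\<close>
    define \<epsilon> where "\<epsilon> = min \<eta> d / c"
    have \<epsilon>: "\<epsilon> > 0" using \<eta> d(1) c by (simp add: \<epsilon>_def)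
    obtain q :: nat and p where q: "q > 0" "\<And>b. b \<in> B \<Longrightarrow> \<bar>real q * a b - of_int (p b)\<bar> < \<epsilon>"
      using dirichlet_finite[OF B(1) \<epsilon>, of a] by metis
    define \<sigma> where "\<sigma> = (\<Sum>b\<in>B. of_int (p b) *\<^sub>R b)"
    have \<sigma>: "\<sigma> \<in> S" unfolding \<sigma>_def by (rule S_sum[OF B(1,2)])
    have "real q *\<^sub>R v - \<sigma> = (\<Sum>b\<in>B. (real q * a b - of_int (p b)) *\<^sub>R b)"
      by (simp add: a \<sigma>_def scaleR_sum_right scaleR_diff_left sum_subtractf)
    also have "norm \<dots> \<le> (\<Sum>b\<in>B. \<epsilon> * norm b)"
      by (rule sum_norm_le) (use q(2) in \<open>fastforce intro: mult_right_mono\<close>)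
    also have "\<dots> = \<epsilon> * (\<Sum>b\<in>B. norm b)" by (simp add: sum_distrib_left)
    also have "\<dots> < \<epsilon> * c" using \<epsilon> by (simp add: c_def)
    also have "\<dots> = min \<eta> d" using c by (simp add: \<epsilon>_def)
    finally have near: "norm (real q *\<^sub>R v - \<sigma>) < min \<eta> d" .
    have "P (\<sigma> - real q *\<^sub>R v) = P \<sigma>"
    proof -
      have "P (real q *\<^sub>R v) = real q *\<^sub>R P v"
        by (simp add: P_def vmult_scaleR matrix_vector_mult_scaleR scaleR_diff_right)
      then show ?thesis by (simp add: P_diff v(2))
    qed
    then have "dist (s (P \<sigma>)) (s 0) < 1"
      using d(2)[of "\<sigma> - real q *\<^sub>R v"] near by (simp add: P0 norm_minus_commute)
    moreover have "s (0 + P \<sigma>) = s 0 + \<sigma>"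
      by (rule section_shift[OF s(2,3) \<sigma> W0])
    ultimately have "norm \<sigma> < 1" by (simp add: dist_norm)
    then have "\<sigma> = 0" using int_vec_norm_less_one \<sigma> S_subset by blast
    then have "real q * norm v < \<eta>" using near by simp
    moreover have "norm v \<le> real q * norm v" using q(1) by (simp add: mult_le_cancel_right1)
    ultimately show ?thesis by simp
  qed
  then have "norm v \<le> 0" by (intro field_le_epsilon[of "norm v" 0]) simp
  then show ?thesis by simp
qed

text \<open>A kernel vector \<open>x\<close> puts \<open>M *v x\<close> into \<open>span S\<close>,
  where \<open>P\<close> is injective, although \<open>P\<close> annihilates the range of
  \<open>M\<close>.\<close>

lemma det_nonzero:
  fixes E :: "real^'n^'m"
  assumes ker: "\<And>v. v v* E = 0 \<longleftrightarrow> v \<in> span S"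
  shows "det (transpose E ** M) \<noteq> 0"
proof -
  have "x = 0" if "(transpose E ** M) *v x = 0" for x
  proof -
    have "(M *v x) v* E = 0"
      using that by (simp flip: matrix_vector_mul_assoc)
    then have "M *v x \<in> span S" by (simp add: ker)
    then have "M *v x = 0" by (rule P_inj_on_span) (rule P_mult_M)
    then have "norm (M *v x) = 0" by simp
    then show ?thesis by simp
  qed
  then show ?thesis
    by (metis invertible_det_nz invertible_left_inverse matrix_left_invertible_ker)
qed

text \<open>Every point of \<open>W\<close> is \<open>P v\<close> with \<open>v\<close> in
  \<open>span S\<close>: invertibility of \<open>transpose E ** M\<close> allows a correction along
  the range of \<open>M\<close>, which \<open>P\<close> ignores. Modulo \<open>S\<close>, on which
  \<open>v* E\<close> vanishes, \<open>v\<close> stays bounded, and the section is bounded on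
  bounded sets.\<close>

lemma component_bounded_mod_span:
  fixes E :: "real^'n^'m"
  assumes ker: "\<And>v. v v* E = 0 \<longleftrightarrow> v \<in> span S"
  obtains b where "\<And>h. h \<in> C \<Longrightarrow> norm (h v* E) \<le> b"
proof -
  obtain s where s: "continuous_on W s" "\<And>w. w \<in> W \<Longrightarrow> s w \<in> C \<and> P (s w) = w" "\<And>h. h \<in> C \<Longrightarrow> s (P h) = h"
    using component_section[OF component] by metis
  obtain B where B: "finite B" "B \<subseteq> S" "span B = span S" by (rule finite_spanning_subset)
  have E_add: "(x + y) v* E = x v* E + y v* E" and E_diff: "(x - y) v* E = x v* E - y v* E" for x y
    unfolding transpose_matrix_vector[symmetric]
    by (simp_all add: matrix_vector_right_distrib matrix_vector_mult_diff_distrib del: transpose_matrix_vector)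
  obtain A where A: "(transpose E ** M) ** A = mat 1"
    using det_nonzero[OF ker] by (metis invertible_def invertible_det_nz)
  define Q where "Q = (\<lambda>x. s (P x) v* E) ` cball 0 (\<Sum>b\<in>B. norm b)"
  have "continuous_on UNIV (\<lambda>x. s (P x))"
    using continuous_on_compose2[OF s(1) continuous_on_P] P_in_W by blast
  then have "continuous_on (cball 0 (\<Sum>b\<in>B. norm b)) (\<lambda>x. transpose E *v s (P x))"
    by (intro continuous_on_compose2[OF matrix_vector_mult_linear_continuous_on[of UNIV "transpose E"]])
       (auto intro: continuous_on_subset)
  then have "compact Q" unfolding Q_def by (intro compact_continuous_image) simp_all
  then obtain b where b: "\<And>y. y \<in> Q \<Longrightarrow> norm y \<le> b"
    using compact_imp_bounded bounded_iff by metis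
  show thesis
  proof (rule that[of b])
    fix h assume h: "h \<in> C"
    define w where "w = P h"
    have w: "w \<in> W" by (simp add: w_def P_in_W)
    define v where "v = w - M *v (A *v (w v* E))"
    have "(M *v (A *v (w v* E))) v* E = w v* E"
    proof -
      have "(M *v (A *v (w v* E))) v* E = ((transpose E ** M) ** A) *v (w v* E)"
        by (simp only: transpose_matrix_vector[symmetric] matrix_vector_mul_assoc matrix_mul_assoc)
      then show ?thesis by (simp add: A)
    qed
    then have "v v* E = 0" by (simp add: v_def E_diff)
    then have "v \<in> span B" by (simp add: ker B(3))
    then obtain a where a: "v = (\<Sum>b\<in>B. a b *\<^sub>R b)"
      unfolding span_finite[OF B(1)] by auto
    define \<sigma> where "\<sigma> = (\<Sum>b\<in>B. of_int \<lfloor>a b\<rfloor> *\<^sub>R b)"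
    have \<sigma>: "\<sigma> \<in> S" unfolding \<sigma>_def by (rule S_sum[OF B(1,2)])
    have "v - \<sigma> = (\<Sum>b\<in>B. frac (a b) *\<^sub>R b)"
      by (simp add: a \<sigma>_def frac_def scaleR_diff_left sum_subtractf)
    also have "norm \<dots> \<le> (\<Sum>b\<in>B. norm b)"
      by (rule sum_norm_le) (auto intro!: mult_left_le_one_le simp: frac_lt_1 less_imp_le)
    finally have small: "norm (v - \<sigma>) \<le> (\<Sum>b\<in>B. norm b)" .
    have "P v = w" using w by (simp add: v_def P_diff P_mult_M P_ident)
    then have "h = s (P (v - \<sigma>) + P \<sigma>)" using s(3)[OF h] by (simp add: w_def P_diff)
    also have "\<dots> = s (P (v - \<sigma>)) + \<sigma>"
      by (rule section_shift[OF s(2,3) \<sigma> P_in_W])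
    finally have "h v* E = s (P (v - \<sigma>)) v* E + \<sigma> v* E" by (simp only: E_add)
    also have "\<sigma> v* E = 0" using ker \<sigma> span_base by blast
    finally have "h v* E \<in> Q" unfolding Q_def using small by (intro image_eqI[of _ _ "v - \<sigma>"]) auto
    then show "norm (h v* E) \<le> b" by (rule b)
  qed
qed

text \<open>The points over \<open>C\<close> and its translates correspond to the cosets of \<open>S\<close>, via \<open>M x \<in> C + k\<close>; then
  \<open>E\<^sup>T M x\<close> is within bounded distance of \<open>E\<^sup>T k\<close>, and each integer vector is hit by \<open>E\<^sup>T k\<close> for as many cosets
  as there are in \<open>S\<^sub>1\<close>.\<close>

lemma has_density_component:
  fixes E :: "real^'n^'m"
  assumes E: "\<And>i j. E $ i $ j \<in> \<int>"
    and S2: "(\<lambda>k. E *v k) ` int_vecs = {k \<in> int_vecs. \<forall>s\<in>S. k \<bullet> s = 0}"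
    and S1: "S1 = {k \<in> int_vecs. \<exists>a::nat. a \<ge> 1 \<and> real a *\<^sub>R k \<in> S}"
  shows "has_density {x. \<exists>k\<in>int_vecs. M *v x - k \<in> C} (real (quotient_card S1 S) * \<bar>det (transpose E ** M)\<bar>)"
proof -
  let ?A = "{x. \<exists>k\<in>int_vecs. M *v x - k \<in> C}" and ?D = "transpose E ** M"
  have ker: "v v* E = 0 \<longleftrightarrow> v \<in> span S" for v
    by (rule kernel_transpose_eq_span[OF S_subset S2])
  have det: "det ?D \<noteq> 0" by (rule det_nonzero[OF ker])
  have E_add: "(x + y) v* E = x v* E + y v* E" and E_diff: "(x - y) v* E = x v* E - y v* E" for x y
    unfolding transpose_matrix_vector[symmetric]
    by (simp_all add: matrix_vector_right_distrib matrix_vector_mult_diff_distrib del: transpose_matrix_vector)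
  have E_scale: "(c *\<^sub>R x) v* E = c *\<^sub>R (x v* E)" for c x
    unfolding transpose_matrix_vector[symmetric]
    by (simp add: matrix_vector_mult_scaleR del: transpose_matrix_vector)
  have E_int: "k v* E \<in> int_vecs" if "k \<in> int_vecs" for k
    unfolding transpose_matrix_vector[symmetric]
    by (rule matrix_mult_int_vec[OF _ that]) (simp add: transpose_def E)
  have D_mult: "?D *v x = (M *v x) v* E" for x
    by (simp flip: matrix_vector_mul_assoc)
  have E_inj: "u = u'" if "E *v u = E *v u'" for u u'
  proof -
    have "E *v (u - u') = 0" using that by (simp add: matrix_vector_mult_diff_distrib)
    then have "(transpose M ** E) *v (u - u') = 0" by (simp flip: matrix_vector_mul_assoc)
    moreover have "det (transpose M ** E) \<noteq> 0"
      using det det_transpose[of ?D] by (simp add: matrix_transpose_mul)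
    ultimately have "u - u' = 0"
      by (metis invertible_det_nz invertible_left_inverse matrix_left_invertible_ker)
    then show ?thesis by simp
  qed
  \<comment> \<open>The real range of \<open>E\<close> is orthogonal to \<open>S\<close>, so
    \<open>S2\<close> makes its integer vectors images of integer vectors; injectivity identifies
    the preimage.\<close>
  have saturated: "u \<in> int_vecs" if u: "E *v u \<in> int_vecs" for u
  proof -
    have "(E *v u) \<bullet> s = 0" if "s \<in> S" for s
    proof -
      have "s v* E = 0" using ker span_base that by blast
      then show ?thesis using dot_lmul_matrix[of s E u] by (simp add: inner_commute)
    qed
    then have "E *v u \<in> (\<lambda>k. E *v k) ` int_vecs" using u S2 by blast
    then show ?thesis using E_inj by blast
  qed
  obtain s where s: "continuous_on W s" "\<And>w. w \<in> W \<Longrightarrow> s w \<in> C \<and> P (s w) = w" "\<And>h. h \<in> C \<Longrightarrow> s (P h) = h"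
    using component_section[OF component] by metis
  \<comment> \<open>\<open>M *v x - k\<close> projects to \<open>P (- k)\<close>, so it lies in
    \<open>C\<close> only if it equals \<open>s (P (- k))\<close>; solving for \<open>x\<close>
    gives \<open>X k\<close>.\<close>
  define X where "X k = (s (P (- k)) + k) v* M" for k
  have X: "M *v X k - k \<in> C" for k
  proof -
    have "P (s (P (- k)) + k) = 0"
      using s(2)[OF P_in_W, of "- k"] P_add[of "- k" k] by (simp add: P_add) (simp add: P_def)
    then have "M *v X k = s (P (- k)) + k" by (simp add: P_def X_def)
    then show ?thesis using s(2)[OF P_in_W] by simp
  qed
  have X_unique: "x = X k" if "M *v x - k \<in> C" for x k
  proof -
    have "P (M *v x - k) = P (M *v X k - k)" by (simp add: P_diff P_mult_M)
    then have "M *v x - k = M *v X k - k" using s(3)[OF that] s(3)[OF X] by metis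
    then show ?thesis by (metis diff_add_cancel mult_left_inverse)
  qed
  have X_eq_iff: "X k = X l \<longleftrightarrow> l - k \<in> S" if "k \<in> int_vecs" "l \<in> int_vecs" for k l
  proof -
    have "l - k \<in> S \<longleftrightarrow> (M *v X l - l) + (l - k) \<in> C"
      by (rule in_S_iff[OF int_vecs_diff[OF that(2,1)] X])
    also have "(M *v X l - l) + (l - k) = M *v X l - k" by simp
    also have "M *v X l - k \<in> C \<longleftrightarrow> X k = X l" using X[of k] X_unique[of "X l" k] by auto
    finally show ?thesis by simp
  qed
  have A_eq: "?A = X ` int_vecs" using X X_unique by blast
  \<comment> \<open>The choice is harmless: \<open>k\<close> is determined modulo \<open>S\<close>,
    on which \<open>v* E\<close> vanishes.\<close>
  define \<kappa> where "\<kappa> x = (SOME k. k \<in> int_vecs \<and> x = X k)" for x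
  have \<kappa>: "\<kappa> x \<in> int_vecs \<and> x = X (\<kappa> x)" if "x \<in> ?A" for x
    unfolding \<kappa>_def by (rule someI_ex) (use that A_eq in blast)
  define F where "F x = \<kappa> x v* E" for x
  have FX: "F (X k) = k v* E" if k: "k \<in> int_vecs" for k
  proof -
    have "X k \<in> ?A" using A_eq k by blast
    then have "\<kappa> (X k) \<in> int_vecs" "X k = X (\<kappa> (X k))" using \<kappa> by blast+
    then have "\<kappa> (X k) - k \<in> S" using X_eq_iff k by blast
    then have "(\<kappa> (X k) - k) v* E = 0" using ker span_base by blast
    then show ?thesis by (simp add: F_def E_diff)
  qed
  have fibre: "{x \<in> ?A. F x = z} = X ` {k \<in> int_vecs. k v* E = z}" for z
    using A_eq FX by auto
  obtain b where b: "\<And>h. h \<in> C \<Longrightarrow> norm (h v* E) \<le> b"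
    by (rule component_bounded_mod_span[OF ker]) blast
  have close: "norm (?D *v x - F x) \<le> b" if "x \<in> ?A" for x
  proof -
    have "?D *v x - F x = (M *v x - \<kappa> x) v* E" by (simp only: D_mult F_def E_diff)
    moreover have "M *v x - \<kappa> x \<in> C" using X[of "\<kappa> x"] \<kappa>[OF that] by simp
    ultimately show ?thesis using b by simp
  qed
  \<comment> \<open>\<open>M\<close> maps \<open>?A\<close> into \<open>H\<close>, so its points are
    separated; \<open>close\<close> and the invertibility of \<open>?D\<close> bound the
    fibre.\<close>
  have finite_fibre: "finite {x \<in> ?A. F x = z}" for z
  proof -
    obtain D' where D': "D' ** ?D = mat 1" using det by (metis invertible_def invertible_det_nz)
    obtain K where K: "K > 0" "\<And>x. norm (D' *v x) \<le> K * norm x" by (rule matrix_bounded[of D']) blast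
    have sepA: "x = y" if "x \<in> ?A" "y \<in> ?A" "norm (x - y) < r" for x y
    proof -
      have H: "M *v x \<in> H" if "x \<in> ?A" for x
        using that periodic[of "M *v x - k" k for k] C_subset_H by force
      have "x - y = 0"
        by (rule separated[OF H[OF that(2)]])
           (use H[OF that(1)] that(3) in \<open>simp_all add: matrix_vector_mult_diff_distrib\<close>)
      then show ?thesis by simp
    qed
    have "{x \<in> ?A. F x = z} \<subseteq> ?A \<inter> ball 0 (K * (b + norm z) + 1)"
    proof
      fix x assume x: "x \<in> {x \<in> ?A. F x = z}"
      have "norm (?D *v x) \<le> b + norm z"
        using close[of x] x norm_triangle_ineq[of "?D *v x - z" z] by simp
      then have "norm (D' *v (?D *v x)) \<le> K * (b + norm z)"
        using K by (meson less_imp_le mult_left_mono order_trans)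
      moreover have "D' *v (?D *v x) = x" by (simp only: matrix_vector_mul_assoc D' matrix_vector_mul_lid)
      ultimately show "x \<in> ?A \<inter> ball 0 (K * (b + norm z) + 1)" using x by simp
    qed
    then show ?thesis
      using separated_finite_ball[OF r_pos sepA] finite_subset by blast
  qed
  have S1_eq: "S1 = {k \<in> int_vecs. k v* E = 0}"
  proof (intro equalityI subsetI)
    fix k assume "k \<in> S1"
    then obtain a :: nat where a: "k \<in> int_vecs" "a \<ge> 1" "real a *\<^sub>R k \<in> S" by (auto simp: S1)
    then have "(real a *\<^sub>R k) v* E = 0" using ker span_base by blast
    then show "k \<in> {k \<in> int_vecs. k v* E = 0}" using a by (simp add: E_scale)
  next
    fix k assume "k \<in> {k \<in> int_vecs. k v* E = 0}"
    then have k: "k \<in> int_vecs" "k v* E = 0" by auto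
    \<comment> \<open>All multiples of \<open>k\<close> give points of the finite fibre over 0. Two
      of these points coincide, and the difference of the multipliers brings \<open>k\<close> into
      \<open>S\<close>.\<close>
    have mult: "real j *\<^sub>R k \<in> int_vecs" for j :: nat
      using k(1) by (simp add: int_vecs_def)
    have "(\<lambda>j::nat. X (real j *\<^sub>R k)) ` UNIV \<subseteq> {x \<in> ?A. F x = 0}"
      unfolding fibre using mult k(2) by (auto simp: E_scale)
    then have "finite ((\<lambda>j::nat. X (real j *\<^sub>R k)) ` UNIV)" using finite_fibre finite_subset by blast
    then have "\<not> inj (\<lambda>j::nat. X (real j *\<^sub>R k))" using finite_imageD infinite_UNIV_nat by blast
    then obtain i j :: nat where ij: "i < j" "X (real i *\<^sub>R k) = X (real j *\<^sub>R k)"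
      unfolding inj_def by (metis linorder_neqE_nat)
    then have "real j *\<^sub>R k - real i *\<^sub>R k \<in> S" using X_eq_iff[OF mult mult] by blast
    then have "real (j - i) *\<^sub>R k \<in> S" using ij(1) by (simp add: of_nat_diff scaleR_diff_left)
    then show "k \<in> S1" using k(1) ij(1) by (auto simp: S1 intro!: exI[of _ "j - i"])
  qed
  have card_fibre: "card {x \<in> ?A. F x = z} = quotient_card S1 S" if z: "z \<in> int_vecs" for z
  proof -
    obtain k0 where k0: "k0 \<in> int_vecs" "k0 v* E = z"
      by (rule transpose_surjective_on_int_vecs[OF E det saturated z])
    define Y where "Y k = X (k0 + k)" for k
    have "{k \<in> int_vecs. k v* E = z} = (\<lambda>k. k0 + k) ` S1"
    proof (intro equalityI subsetI)
      fix k assume "k \<in> {k \<in> int_vecs. k v* E = z}"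
      then show "k \<in> (\<lambda>k. k0 + k) ` S1"
        using k0 by (intro image_eqI[of _ _ "k - k0"]) (auto simp: S1_eq E_diff int_vecs_diff)
    qed (use k0 in \<open>auto simp: S1_eq E_add int_vecs_add\<close>)
    then have fib: "{x \<in> ?A. F x = z} = Y ` S1"
      unfolding fibre by (simp add: Y_def image_image)
    define R where "R = {(a, b). a \<in> S1 \<and> b \<in> S1 \<and> b - a \<in> S}"
    have Y_eq: "(a, b) \<in> R \<longleftrightarrow> a \<in> S1 \<and> b \<in> S1 \<and> Y a = Y b" for a b
      unfolding R_def Y_def using X_eq_iff[of "k0 + a" "k0 + b"] k0(1)
      by (auto simp: S1_eq int_vecs_add)
    \<comment> \<open>The level sets of \<open>Y\<close> on \<open>S1\<close> are exactly the cosets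
      of \<open>S\<close>.\<close>
    have "bij_betw (\<lambda>y. {k \<in> S1. Y k = y}) (Y ` S1) (S1 // R)"
      unfolding bij_betw_def
    proof
      show "inj_on (\<lambda>y. {k \<in> S1. Y k = y}) (Y ` S1)" by (auto simp: inj_on_def)
      have "R `` {a} = {k \<in> S1. Y k = Y a}" if "a \<in> S1" for a
        using that Y_eq by auto
      then show "(\<lambda>y. {k \<in> S1. Y k = y}) ` Y ` S1 = S1 // R"
        unfolding quotient_def by auto
    qed
    then have "card (Y ` S1) = card (S1 // R)" by (rule bij_betw_same_card)
    then show ?thesis unfolding fib quotient_card_def R_def .
  qed
  show ?thesis
  proof (rule has_density_lattice_perturbation[OF det, of _ F b])
    show "F x \<in> int_vecs" if "x \<in> ?A" for x
      using \<kappa>[OF that] E_int by (simp add: F_def)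
  qed (use close finite_fibre card_fibre in blast)+
qed

end

lemma connected_subset_compact:
  fixes A B :: "'a::t2_space set"
  assumes "connected s" "compact A" "compact B" "A \<inter> B = {}" "s \<subseteq> A \<union> B" "A \<inter> s \<noteq> {}"
  shows "s \<subseteq> A"
  using connected_closedD[of s A B] assms compact_imp_closed by blast

theorem theorem5:
  fixes \<Lambda> \<Lambda>\<^sub>c :: "(real^'n) set"
    and M E :: "real^'n^'m"
    and \<psi> :: "real^'n \<Rightarrow> complex^'m"
    and K K\<^sub>c :: "(complex^'m) set"
    and H\<^sub>c S S\<^sub>1 S\<^sub>2 :: "(real^'m) set"
  assumes "CARD('n) < CARD('m)"
    and "delone \<Lambda>" and "bohr_ap_set \<Lambda>" and "toral_type \<Lambda>"
    and "toral_compactification \<psi>"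
    and "\<psi> = (\<lambda>x. rho (M *v x))"
    and "associated M \<Lambda>"
    and "transpose M ** M = mat 1"
    and "K = closure (\<psi> ` \<Lambda>)"
    and "K\<^sub>c \<in> components K"
    and "H\<^sub>c \<in> components (rho -` K\<^sub>c)"
    and "\<Lambda>\<^sub>c = \<psi> -` K\<^sub>c"
    and "S = {k \<in> int_vecs. (\<lambda>h. h + k) ` H\<^sub>c = H\<^sub>c}"
    and "S\<^sub>1 = {k \<in> int_vecs. \<exists>a::nat. a \<ge> 1 \<and> real a *\<^sub>R k \<in> S}"
    and "S\<^sub>2 = {k \<in> int_vecs. \<forall>s\<in>S. k \<bullet> s = 0}"
    and "\<forall>i j. E $ i $ j \<in> \<int>"
    and "S\<^sub>2 = (\<lambda>k. E *v k) ` int_vecs"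
  shows "has_density \<Lambda>\<^sub>c (real (quotient_card S\<^sub>1 S) * \<bar>det (transpose E ** M)\<bar>)"
proof -
  define H where "H = rho -` K"
  obtain r where "uniform_transversal M H r"
    unfolding H_def \<open>K = _\<close> \<open>\<psi> = _\<close>
    by (rule uniform_transversal_of_point_set[OF assms(2,3,7) _ assms(8)]) (use assms(5,6) in auto)
  then interpret uniform_transversal M H r .
  have KcK: "K\<^sub>c \<subseteq> K" by (rule in_components_subset[OF assms(10)])
  \<comment> \<open>The component of \<open>H\<close> through a point of \<open>H\<^sub>c\<close>
    has a connected image meeting \<open>K\<^sub>c\<close>, hence lying in \<open>K\<^sub>c\<close>;
    so it is no larger than \<open>H\<^sub>c\<close>.\<close>
  have component: "H\<^sub>c \<in> components H"
  proof -
    obtain h where h: "h \<in> H\<^sub>c" using in_components_nonempty[OF assms(11)] by blast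
    have sub: "H\<^sub>c \<subseteq> rho -` K\<^sub>c" by (rule in_components_subset[OF assms(11)])
    then have hH: "h \<in> H" using h KcK by (auto simp: H_def)
    define C where "C = connected_component_set H h"
    have C: "C \<in> components H" using hH by (auto simp: C_def components_def)
    have hC: "h \<in> C" using hH by (simp add: C_def)
    have "connected (rho ` C)"
      by (rule connected_continuous_image[OF continuous_on_rho[OF continuous_on_id] in_components_connected[OF C]])
    then have "rho ` C \<subseteq> K\<^sub>c"
      using in_components_subset[OF C] h hC sub
      by (intro components_maximal[OF assms(10)]) (auto simp: H_def)
    then have "C \<subseteq> H\<^sub>c"
      using hC h by (intro components_maximal[OF assms(11) in_components_connected[OF C]]) auto
    moreover have "H\<^sub>c \<subseteq> C"
      using hC h sub KcK by (intro components_maximal[OF C in_components_connected[OF assms(11)]]) (auto simp: H_def)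
    ultimately show ?thesis using C by simp
  qed
  interpret periodic_component M H r "H\<^sub>c" S
    by unfold_locales (use component assms(13) in \<open>auto simp: H_def rho_add_int_vec\<close>)
  \<comment> \<open>The translates of \<open>H\<^sub>c\<close> and the remaining components of
    \<open>H\<close> form two disjoint closed periodic sets. Their images are disjoint compact sets
    covering \<open>K\<^sub>c\<close>, so the connected set \<open>K\<^sub>c\<close> lies in the
    first.\<close>
  define \<C> where "\<C> = (\<lambda>k. (\<lambda>h. h + k) ` H\<^sub>c) ` int_vecs"
  have \<C>: "\<C> \<subseteq> components H" using translate_C by (auto simp: \<C>_def)
  have closed1: "closed (\<Union> \<C>)" by (rule closed_Union_components[OF \<C>])
  have closed2: "closed (\<Union> (components H - \<C>))" by (rule closed_Union_components) blast
  have cover: "\<Union> \<C> \<union> \<Union> (components H - \<C>) = H"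
    using \<C> Union_components[of H] by blast
  have disj: "\<Union> \<C> \<inter> \<Union> (components H - \<C>) = {}"
    using \<C> components_nonoverlap[of _ H] by blast
  have periodic1: "x + k \<in> \<Union> \<C>" if x: "x \<in> \<Union> \<C>" and k: "k \<in> int_vecs" for x k
  proof -
    obtain l h where "l \<in> int_vecs" "h \<in> H\<^sub>c" "x = h + l" using x by (auto simp: \<C>_def)
    then show ?thesis
      using k int_vecs_add by (auto simp: \<C>_def add.assoc intro!: bexI[of _ "l + k"])
  qed
  have periodic2: "x + k \<in> \<Union> (components H - \<C>)" if x: "x \<in> \<Union> (components H - \<C>)" and k: "k \<in> int_vecs" for x k
  proof (rule ccontr)
    assume "x + k \<notin> \<Union> (components H - \<C>)"
    moreover have "x + k \<in> H" using periodic cover x k by blast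
    ultimately have "x + k \<in> \<Union> \<C>" using cover by blast
    then have "x \<in> \<Union> \<C>" using periodic1[of "x + k" "- k"] int_vecs_minus[OF k] by simp
    then show False using disj x by blast
  qed
  have compact1: "compact (rho ` \<Union> \<C>)" by (rule closed_rho_image[OF closed1 periodic1])
  have compact2: "compact (rho ` \<Union> (components H - \<C>))" by (rule closed_rho_image[OF closed2 periodic2])
  have disjoint: "rho ` \<Union> \<C> \<inter> rho ` \<Union> (components H - \<C>) = {}"
  proof (rule ccontr)
    assume "\<not> ?thesis"
    then obtain x y where xy: "x \<in> \<Union> \<C>" "y \<in> \<Union> (components H - \<C>)" "rho x = rho y" by auto
    then have "x + (y - x) \<in> \<Union> \<C>" by (intro periodic1) (simp_all flip: rho_eq_iff)
    then show False using xy disj by auto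
  qed
  have covered: "K\<^sub>c \<subseteq> rho ` \<Union> \<C> \<union> rho ` \<Union> (components H - \<C>)"
  proof
    fix z assume "z \<in> K\<^sub>c"
    then have "z \<in> K" using KcK by blast
    moreover have "K \<subseteq> range rho"
    proof -
      have "K \<subseteq> torus"
        unfolding \<open>K = _\<close>
        using assms(5) closure_mono[of "\<psi> ` \<Lambda>" "range \<psi>"] by (auto simp: toral_compactification_def)
      moreover have "torus \<subseteq> range (rho :: real^'m \<Rightarrow> complex^'m)"
      proof
        fix z :: "complex^'m" assume z: "z \<in> torus"
        have "cis (Arg c) = c" if "norm c = 1" for c
        proof -
          have "c \<noteq> 0" using that by auto
          then show ?thesis using that by (simp add: cis_Arg sgn_eq)
        qed
        then have "rho (\<chi> i. Arg (z $ i) / (2 * pi)) = z"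
          using z by (simp add: rho_def torus_def vec_eq_iff)
        then show "z \<in> range rho" by (metis rangeI)
      qed
      ultimately show ?thesis by blast
    qed
    ultimately obtain h where "h \<in> H" "z = rho h" by (auto simp: H_def)
    then show "z \<in> rho ` \<Union> \<C> \<union> rho ` \<Union> (components H - \<C>)" using cover by blast
  qed
  have nonempty: "rho ` \<Union> \<C> \<inter> K\<^sub>c \<noteq> {}"
  proof -
    obtain h where h: "h \<in> H\<^sub>c" by (rule C_nonempty)
    then have "h \<in> \<Union> \<C>" using int_vecs_zero by (auto simp: \<C>_def intro!: bexI[of _ 0])
    moreover have "rho h \<in> K\<^sub>c" using h in_components_subset[OF assms(11)] by blast
    ultimately show ?thesis by blast
  qed
  have Kc: "K\<^sub>c \<subseteq> rho ` \<Union> \<C>"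
    by (rule connected_subset_compact[OF in_components_connected[OF assms(10)] compact1 compact2
          disjoint covered nonempty])
  have "\<Lambda>\<^sub>c = {x. \<exists>k\<in>int_vecs. M *v x - k \<in> H\<^sub>c}"
  proof (intro equalityI subsetI)
    fix x assume "x \<in> \<Lambda>\<^sub>c"
    then have "rho (M *v x) \<in> K\<^sub>c" using assms(6,12) by simp
    then obtain y where "y \<in> \<Union> \<C>" "rho (M *v x) = rho y" using Kc by blast
    then have "y + (M *v x - y) \<in> \<Union> \<C>" by (intro periodic1) (simp_all flip: rho_eq_iff)
    then obtain k h where "k \<in> int_vecs" "h \<in> H\<^sub>c" "M *v x = h + k" by (auto simp: \<C>_def)
    then show "x \<in> {x. \<exists>k\<in>int_vecs. M *v x - k \<in> H\<^sub>c}" by (auto intro!: bexI[of _ k])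
  next
    fix x assume "x \<in> {x. \<exists>k\<in>int_vecs. M *v x - k \<in> H\<^sub>c}"
    then obtain k where k: "k \<in> int_vecs" "M *v x - k \<in> H\<^sub>c" by blast
    then have "rho (M *v x - k) \<in> K\<^sub>c" using in_components_subset[OF assms(11)] by blast
    moreover have "rho (M *v x - k) = rho (M *v x)" using k(1) by (simp add: rho_eq_iff int_vecs_minus)
    ultimately show "x \<in> \<Lambda>\<^sub>c" using assms(6,12) by simp
  qed
  moreover have "has_density {x. \<exists>k\<in>int_vecs. M *v x - k \<in> H\<^sub>c}
      (real (quotient_card S\<^sub>1 S) * \<bar>det (transpose E ** M)\<bar>)"
    by (rule has_density_component) (use assms(14-17) in auto)
  ultimately show ?thesis by simp
qed

end
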